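(* Let $L$ be the Lelek fan. (1) There is a continuous mapping $f:L\to L$, which is not a homeomorphism, such that $(L,f)$ is mixing. (2) There is a homeomorphism $h:L\to L$ such that $(L,h)$ is mixing.
   Context: A continuum is a non-empty compact connected metric space. A continuum $X$ is unicoherent if for any subcontinua $A,B$ of $X$ with $X=A\cup B$ the set $A\cap B$ is connected; it is hereditarily unicoherent if each of its subcontinua is unicoherent. A dendroid is an arcwise connected hereditarily unicoherent continuum. An arc is a space homeomorphic to $[0,1]$. A point $x$ of a dendroid $X$ is an end-point of $X$ if $x$ is an end-point of every arc in $X$ that contains it; $E(X)$ is the set of end-points. A simple triod is a space homeomorphic to $([-1,1]\times\{0\})\cup(\{0\}\times[0,1])$, its top being the point corresponding to $(0,0)$; a ramification point of a dendroid $X$ is the top of some simple triod in $X$. A fan is a dendroid with at most one ramification point $v$, called its top (if it exists). For points $x\neq y$ of a fan $X$, $A_X[x,y]$ is the arc in $X$ with end-points $x$ and $y$, and $A_X[x,x]=\{x\}$. A fan $X$ with top $v$ is smooth if for any $x\in X$ and any sequence $(x_n)$ in $X$, $\lim x_n=x$ implies $\lim A_X[v,x_n]=A_X[v,x]$ in the Hausdorff metric. A Lelek fan is a smooth fan $X$ such that the closure of $E(X)$ equals $X$; any two Lelek fans are homeomorphic, so one speaks of the Lelek fan. A dynamical system $(X,f)$ is a non-empty compact metric space $X$ with a continuous $f:X\to X$. It is mixing if for all non-empty open sets $U,V$ in $X$ there is a non-negative integer $n_0$ such that $f^n(U)\cap V\neq\emptyset$ for each positive integer $n\geq n_0$. 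*)

theory Defs
  imports "HOL-Analysis.Analysis"
begin

text \<open>
  All spaces are subsets of an ambient type of class \<^class>\<open>metric_space\<close>, carrying the
  subspace metric.
\<close>

definition continuum :: "'a::metric_space set \<Rightarrow> bool" where
  "continuum X \<longleftrightarrow> X \<noteq> {} \<and> compact X \<and> connected X"

text \<open>
  The library's \<^const>\<open>unicoherent\<close> ranges over relatively closed connected subsets; in a continuum
  the non-empty ones among these are exactly the subcontinua, and empty ones are harmless.
\<close>

definition hereditarily_unicoherent :: "'a::metric_space set \<Rightarrow> bool" where
  "hereditarily_unicoherent X \<longleftrightarrow> (\<forall>Y. Y \<subseteq> X \<and> continuum Y \<longrightarrow> unicoherent Y)"

definition arc_between :: "'a::metric_space set \<Rightarrow> 'a \<Rightarrow> 'a \<Rightarrow> bool" where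
  "arc_between A x y \<longleftrightarrow> (\<exists>g g'. homeomorphism {0..1::real} A g g' \<and> g 0 = x \<and> g 1 = y)"

definition arcwise_connected :: "'a::metric_space set \<Rightarrow> bool" where
  "arcwise_connected X \<longleftrightarrow>
     (\<forall>x\<in>X. \<forall>y\<in>X. x \<noteq> y \<longrightarrow> (\<exists>A. A \<subseteq> X \<and> arc_between A x y))"

definition dendroid :: "'a::metric_space set \<Rightarrow> bool" where
  "dendroid X \<longleftrightarrow> continuum X \<and> arcwise_connected X \<and> hereditarily_unicoherent X"

text \<open>
  Reversing the parametrization exchanges the two end-points of an arc, so \<open>x\<close> is an end-point
  of \<open>A\<close> iff it is the initial point of some parametrization of \<open>A\<close>.
\<close>

definition end_points :: "'a::metric_space set \<Rightarrow> 'a set" where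
  "end_points X =
     {x \<in> X. \<forall>A. A \<subseteq> X \<and> A homeomorphic {0..1::real} \<and> x \<in> A \<longrightarrow> (\<exists>y. arc_between A x y)}"

definition standard_triod :: "(real \<times> real) set" where
  "standard_triod = ({-1..1} \<times> {0}) \<union> ({0} \<times> {0..1})"

definition ramification_point :: "'a::metric_space set \<Rightarrow> 'a \<Rightarrow> bool" where
  "ramification_point X v \<longleftrightarrow>
     (\<exists>T g g'. T \<subseteq> X \<and> homeomorphism standard_triod T g g' \<and> g (0, 0) = v)"

definition fan :: "'a::metric_space set \<Rightarrow> bool" where
  "fan X \<longleftrightarrow> dendroid X \<and>
     (\<forall>v w. ramification_point X v \<and> ramification_point X w \<longrightarrow> v = w)"

text \<open>Arcs with prescribed end-points are unique in a dendroid, so the description is proper there.\<close>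

definition arc_in :: "'a::metric_space set \<Rightarrow> 'a \<Rightarrow> 'a \<Rightarrow> 'a set" where
  "arc_in X x y = (if x = y then {x} else (THE A. A \<subseteq> X \<and> arc_between A x y))"

text \<open>Only meaningful for non-empty bounded sets; it is applied below to compact ones.\<close>

definition hausdorff_dist :: "'a::metric_space set \<Rightarrow> 'a set \<Rightarrow> real" where
  "hausdorff_dist A B = max (SUP a\<in>A. infdist a B) (SUP b\<in>B. infdist b A)"

text \<open>
  Smoothness refers to the top of the fan, so a smooth fan is required to have one. This excludes
  arcs and, in particular, one-point spaces (whose only point is an end-point).
\<close>

definition smooth_fan :: "'a::metric_space set \<Rightarrow> bool" where
  "smooth_fan X \<longleftrightarrow> fan X \<and>
     (\<exists>v. ramification_point X v \<and>
       (\<forall>x\<in>X. \<forall>s::nat \<Rightarrow> 'a. (\<forall>n. s n \<in> X) \<and> s \<longlonglongrightarrow> x \<longrightarrow>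
          (\<lambda>n. hausdorff_dist (arc_in X v (s n)) (arc_in X v x)) \<longlonglongrightarrow> 0))"

definition lelek_fan :: "'a::metric_space set \<Rightarrow> bool" where
  "lelek_fan X \<longleftrightarrow> smooth_fan X \<and> closure (end_points X) = X"

definition dynamical_system :: "'a::metric_space set \<Rightarrow> ('a \<Rightarrow> 'a) \<Rightarrow> bool" where
  "dynamical_system X f \<longleftrightarrow> X \<noteq> {} \<and> compact X \<and> continuous_on X f \<and> f ` X \<subseteq> X"

definition mixing :: "'a::metric_space set \<Rightarrow> ('a \<Rightarrow> 'a) \<Rightarrow> bool" where
  "mixing X f \<longleftrightarrow> dynamical_system X f \<and>
     (\<forall>U V. openin (top_of_set X) U \<and> openin (top_of_set X) V \<and> U \<noteq> {} \<and> V \<noteq> {} \<longrightarrow>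
        (\<exists>n0::nat. \<forall>n. 0 < n \<and> n0 \<le> n \<longrightarrow> (f ^^ n) ` U \<inter> V \<noteq> {}))"

end

theory Submission
  imports Defs
begin

text \<open>
  A Lelek fan is determined by very little data: the set of its legs and the length of each leg.
  Concretely, let \<open>C\<close> be a compact totally disconnected metric space and \<open>\<phi>\<close> an upper semicontinuous
  non-negative function on \<open>C\<close>; collapsing the zero level of the hypograph
  \<open>{(c, t). 0 \<le> t \<le> \<phi> c}\<close> to a point yields a fan with legs of lengths \<open>\<phi> c\<close>. The tips are dense
  in the fan if \<open>\<phi>\<close> is a \<open>lelek_function\<close> on \<open>C\<close>, as defined below. The proof has three parts,
  which meet only in this notion.

  Every Lelek fan arises in this way (\<open>lelek_fan_chart\<close>). In a smooth fan with top \<open>v\<close> a Whitney map,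
  applied to the arcs from \<open>v\<close> to the points, gives a continuous height \<open>h\<close> that increases
  strictly along the legs. Hereditary unicoherence makes the level sets of \<open>h\<close> totally disconnected, and
  the legs retract continuously onto the levels; so there are countably many sets of legs,
  clopen away from \<open>v\<close>, that separate any two legs. Their indicator functions give codes for the
  legs in \<open>{0, 1}\<close>-sequences, and height and code together describe the fan as a collapsed hypograph.

  Any two Lelek functions are equivalent (\<open>lelek_functions_equivalent\<close>): a homeomorphism of the
  domains carries one to the other up to a continuous positive factor. This is a back-and-forth argument
  with finite matchings between clopen partitions of the two domains. Density of the tips allows
  pieces with any prescribed smaller maximum to be cut off, so each matching can be refined while the ratios of
  the maxima of matched cells hardly change.

  So it suffices to find suitable maps over one convenient Lelek function. Take sequences \<open>c\<close> over a finite
  set of real steps and the map \<open>(c, t) \<mapsto> (shift c, t * exp (c 0))\<close>, on the set of those \<open>(c, t)\<close> whose orbit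
  never leaves the interval from \<open>0\<close> to \<open>1\<close>. The steps \<open>-1\<close> and \<open>sqrt 2\<close> generate a dense
  group, so by Kronecker's theorem any height can be steered close to any other, and the step \<open>0\<close>
  allows waiting; this makes the map mixing (\<open>step_map_mixing\<close>). With two-sided sequences it is
  a homeomorphism, with one-sided sequences it is not injective. Both facts pass to the fan,
  because the map preserves the zero level.
\<close>

section \<open>Clopen subsets of compact totally disconnected sets\<close>

definition clopen_in :: "'a::topological_space set \<Rightarrow> 'a set \<Rightarrow> bool" where
  "clopen_in C A \<longleftrightarrow> openin (top_of_set C) A \<and> closedin (top_of_set C) A"

definition totally_disconnected :: "'a::topological_space set \<Rightarrow> bool" where
  "totally_disconnected C \<longleftrightarrow> (\<forall>T\<subseteq>C. connected T \<longrightarrow> (\<forall>x\<in>T. \<forall>y\<in>T. x = y))"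

lemma clopen_in_subset: "clopen_in C A \<Longrightarrow> A \<subseteq> C"
  using openin_imp_subset by (auto simp: clopen_in_def)

lemma clopen_in_empty [simp]: "clopen_in C {}"
  by (simp add: clopen_in_def)

lemma clopen_in_self [simp]: "clopen_in C C"
  by (simp add: clopen_in_def)

lemma clopen_in_Un: "clopen_in C A \<Longrightarrow> clopen_in C B \<Longrightarrow> clopen_in C (A \<union> B)"
  by (simp add: clopen_in_def openin_Un closedin_Un)

lemma clopen_in_Int: "clopen_in C A \<Longrightarrow> clopen_in C B \<Longrightarrow> clopen_in C (A \<inter> B)"
  by (simp add: clopen_in_def openin_Int closedin_Int)

lemma clopen_in_Diff: "clopen_in C A \<Longrightarrow> clopen_in C B \<Longrightarrow> clopen_in C (A - B)"
  by (simp add: clopen_in_def openin_diff closedin_diff)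

lemma clopen_in_Union: "finite F \<Longrightarrow> (\<And>A. A \<in> F \<Longrightarrow> clopen_in C A) \<Longrightarrow> clopen_in C (\<Union>F)"
  by (induction F rule: finite_induct) (auto intro: clopen_in_Un)

lemma clopen_in_compact: "compact C \<Longrightarrow> clopen_in C A \<Longrightarrow> compact A"
  by (metis clopen_in_def closedin_compact)

lemma clopen_in_near:
  fixes C :: "'a::metric_space set"
  assumes "clopen_in C A" "x \<in> A"
  obtains e where "e > 0" "\<And>y. y \<in> C \<Longrightarrow> dist y x < e \<Longrightarrow> y \<in> A"
  using assms unfolding clopen_in_def openin_euclidean_subtopology_iff by metis

text \<open>
  In a compact Hausdorff space the quasi-components are the components, so two points of a totally
  disconnected one lie in complementary clopen sets. Compactness of both sets leads from points to sets.
\<close>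

lemma clopen_separation:
  fixes K :: "'a::metric_space set"
  assumes "compact K" "totally_disconnected K" "compact A" "compact B" "A \<subseteq> K" "B \<subseteq> K" "A \<inter> B = {}"
  obtains Q where "clopen_in K Q" "A \<subseteq> Q" "Q \<inter> B = {}"
proof -
  let ?X = "top_of_set K"
  have hs: "Hausdorff_space ?X"
    by (simp add: Hausdorff_space_subtopology)
  have cs: "compact_space ?X"
    using assms(1) by (simp add: compact_space_subtopology)
  have eq: "quasi_components_of ?X = connected_components_of ?X"
    using hs cs quasi_eq_connected_components_of by blast
  have pt: "\<not> quasi_component_of ?X x y" if "x \<in> K" "y \<in> K" "x \<noteq> y" for x y
  proof
    assume "quasi_component_of ?X x y"
    then have "connected_component_of ?X x y"
      using eq quasi_eq_connected_components_of_pointwise_alt by metis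
    then obtain T where "connectedin ?X T" "x \<in> T" "y \<in> T"
      by (auto simp: connected_component_of_def)
    then show False
      using assms(2) that unfolding totally_disconnected_def
      by (auto simp: connectedin_subtopology)
  qed
  have sp: "separated_between ?X {x} {y}" if "x \<in> A" "y \<in> B" for x y
  proof -
    have "x \<in> K" "y \<in> K" "x \<noteq> y" using that assms by auto
    from pt[OF this] \<open>x \<in> K\<close> \<open>y \<in> K\<close> show ?thesis
      unfolding quasi_component_of_alt separated_between_def by auto
  qed
  have "separated_between ?X A B"
    using sp assms by (auto simp: separated_between_pointwise_left separated_between_pointwise_right compactin_subtopology)
  then obtain U where "closedin ?X U" "openin ?X U" "A \<subseteq> U" "B \<subseteq> K - U"
    by (auto simp: separated_between)
  then show ?thesis
    by (intro that[of U]) (auto simp: clopen_in_def)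
qed

lemma small_clopen_neighbourhood:
  fixes K :: "'a::metric_space set"
  assumes "compact K" "totally_disconnected K" "x \<in> K" "r > 0"
  obtains Q where "clopen_in K Q" "x \<in> Q" "Q \<subseteq> ball x r"
proof -
  have "compact (K - ball x r)"
    using assms(1) by (simp add: compact_diff)
  moreover have "{x} \<inter> (K - ball x r) = {}"
    using assms(4) by simp
  ultimately obtain Q where Q: "clopen_in K Q" "{x} \<subseteq> Q" "Q \<inter> (K - ball x r) = {}"
    using assms(3) by (elim clopen_separation[OF assms(1,2) compact_sing]) auto
  then have "Q \<subseteq> ball x r"
    using clopen_in_subset[of K Q] by auto
  then show ?thesis using that Q by auto
qed

lemma clopen_partition:
  fixes K :: "'a::metric_space set"
  assumes "compact K" "totally_disconnected K" "\<delta> > 0"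
  obtains \<A> where "finite \<A>" "disjoint \<A>" "\<Union>\<A> = K" "\<And>A. A \<in> \<A> \<Longrightarrow> clopen_in K A \<and> A \<noteq> {}"
    "\<And>A x y. A \<in> \<A> \<Longrightarrow> x \<in> A \<Longrightarrow> y \<in> A \<Longrightarrow> dist x y < \<delta>"
proof -
  have "\<exists>Q. clopen_in K Q \<and> x \<in> Q \<and> Q \<subseteq> ball x (\<delta>/2)" if xK: "x \<in> K" for x
    using small_clopen_neighbourhood[OF assms(1,2) xK, of "\<delta>/2"] assms(3) by auto
  then obtain Q where Q: "\<And>x. x \<in> K \<Longrightarrow> clopen_in K (Q x) \<and> x \<in> Q x \<and> Q x \<subseteq> ball x (\<delta>/2)"
    by metis
  obtain I where I: "finite I" "I \<subseteq> K" "K \<subseteq> \<Union>(Q ` I)"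
  proof -
    have "\<forall>x\<in>K. \<exists>V. open V \<and> Q x = K \<inter> V"
      using Q unfolding clopen_in_def openin_open by blast
    then obtain V where V: "\<And>x. x \<in> K \<Longrightarrow> open (V x) \<and> Q x = K \<inter> V x" by metis
    have "K \<subseteq> \<Union>(V ` K)"
    proof
      fix x assume "x \<in> K"
      then show "x \<in> \<Union>(V ` K)" using V[of x] Q[of x] by blast
    qed
    from compactE_image[OF assms(1) _ this] V
    obtain I where I: "I \<subseteq> K" "finite I" "K \<subseteq> \<Union>(V ` I)" by metis
    have "K \<subseteq> \<Union>(Q ` I)"
    proof
      fix x assume "x \<in> K"
      then obtain i where "i \<in> I" "x \<in> V i" using I(3) by auto
      moreover have "Q i = K \<inter> V i" using V I(1) \<open>i \<in> I\<close> by auto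
      ultimately show "x \<in> \<Union>(Q ` I)" using \<open>x \<in> K\<close> by auto
    qed
    then show ?thesis using that I by simp
  qed
  \<comment> \<open>make the finite cover disjoint, one member at a time\<close>
  have "\<exists>\<A>. finite \<A> \<and> disjoint \<A> \<and> \<Union>\<A> = \<Union>(Q ` J) \<and> (\<forall>A\<in>\<A>. clopen_in K A \<and> (\<exists>x\<in>J. A \<subseteq> Q x))"
    if "finite J" "J \<subseteq> K" for J
    using that
  proof (induction J rule: finite_induct)
    case empty
    show ?case by (rule exI[of _ "{}"]) auto
  next
    case (insert x J)
    then obtain \<A> where A: "finite \<A>" "disjoint \<A>" "\<Union>\<A> = \<Union>(Q ` J)" "\<forall>A\<in>\<A>. clopen_in K A \<and> (\<exists>x\<in>J. A \<subseteq> Q x)"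
      by auto
    have "clopen_in K (Q x - \<Union>\<A>)"
      using A Q insert.prems by (intro clopen_in_Diff clopen_in_Union) auto
    moreover have "disjoint (insert (Q x - \<Union>\<A>) \<A>)"
      using A(2) by (auto simp: pairwise_insert disjnt_def)
    ultimately show ?case
      using A by (intro exI[of _ "insert (Q x - \<Union>\<A>) \<A>"]) auto
  qed
  then obtain \<A> where A: "finite \<A>" "disjoint \<A>" "\<Union>\<A> = \<Union>(Q ` I)" "\<forall>A\<in>\<A>. clopen_in K A \<and> (\<exists>x\<in>I. A \<subseteq> Q x)"
    using I(1,2) by metis
  show ?thesis
  proof (rule that[of "\<A> - {{}}"])
    show "disjoint (\<A> - {{}})" using A(2) by (rule pairwise_subset) auto
    show "\<Union>(\<A> - {{}}) = K"
    proof -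
      have "\<Union>(\<A> - {{}}) = \<Union>\<A>" by blast
      moreover have "\<Union>\<A> \<subseteq> K" using A(4) clopen_in_subset by (metis Sup_least)
      ultimately show ?thesis using A(3) I(3) by simp
    qed
    show "dist u w < \<delta>" if uw: "A \<in> \<A> - {{}}" "u \<in> A" "w \<in> A" for A u w
    proof -
      obtain x where "x \<in> I" "A \<subseteq> Q x" using A(4) uw(1) by blast
      then have "A \<subseteq> ball x (\<delta>/2)" using Q[of x] I(2) by (metis order_trans subsetD)
      then have "dist x u < \<delta>/2" "dist x w < \<delta>/2" using uw by auto
      then show ?thesis by (metis dist_commute dist_triangle_half_r)
    qed
  qed (use A in auto)
qed

text \<open>
  The maps constructed below are given by closed relations and have compact ranges; in this form
  the closed graph theorem proves their continuity without any estimate.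
\<close>

lemma continuous_on_compact_closed_graph:
  fixes f :: "'a::metric_space \<Rightarrow> 'b::metric_space"
  assumes "compact T" and "\<And>x. x \<in> S \<Longrightarrow> f x \<in> T"
    and graph: "\<And>s x y. (\<And>n::nat. s n \<in> S) \<Longrightarrow> x \<in> S \<Longrightarrow> s \<longlonglongrightarrow> x \<Longrightarrow> (\<lambda>n. f (s n)) \<longlonglongrightarrow> y \<Longrightarrow> y = f x"
  shows "continuous_on S f"
proof (rule continuous_on_sequentiallyI)
  fix u a assume u: "\<forall>n. u n \<in> S" "a \<in> S" "u \<longlonglongrightarrow> a"
  show "(\<lambda>n. f (u n)) \<longlonglongrightarrow> f a"
  proof (rule ccontr)
    assume "\<not> (\<lambda>n. f (u n)) \<longlonglongrightarrow> f a"
    then obtain e where e: "e > 0" "\<exists>\<^sub>F n in sequentially. \<not> dist (f (u n)) (f a) < e"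
      unfolding tendsto_iff using not_eventually by metis
    let ?far = "{n. \<not> dist (f (u n)) (f a) < e}"
    have "infinite ?far"
      using e(2) unfolding frequently_cofinite[symmetric] cofinite_eq_sequentially .
    then obtain r :: "nat \<Rightarrow> nat" where r0: "strict_mono r" "\<forall>n. r n \<in> ?far"
      using infinite_enumerate by blast
    then have r: "strict_mono r" "\<And>n. \<not> dist (f (u (r n))) (f a) < e"
      by simp_all
    have "seq_compact T" using assms(1) by (simp add: compact_imp_seq_compact)
    then obtain y q where y: "strict_mono q" "(\<lambda>n. f (u (r (q n)))) \<longlonglongrightarrow> y"
    proof -
      have "\<forall>n. f (u (r n)) \<in> T" using assms(2) u(1) by blast
      from seq_compactE[OF \<open>seq_compact T\<close> this] show ?thesis
        using that unfolding o_def by metis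
    qed
    have "(\<lambda>n. u (r (q n))) \<longlonglongrightarrow> a"
      using LIMSEQ_subseq_LIMSEQ[OF LIMSEQ_subseq_LIMSEQ[OF u(3) r(1)] y(1)] by (simp add: o_def)
    then have "y = f a" using graph[of "\<lambda>n. u (r (q n))" a y] u y by auto
    then have "(\<lambda>n. dist (f (u (r (q n)))) (f a)) \<longlonglongrightarrow> 0"
      using y(2) tendsto_dist[OF y(2) tendsto_const[of "f a"]] by simp
    then have "e \<le> 0"
      using r(2) by (intro LIMSEQ_le_const[of _ 0 e]) (auto simp: not_less)
    then show False using e by simp
  qed
qed

lemma continuous_on_near:
  fixes f :: "'a::metric_space \<Rightarrow> 'b::metric_space"
  assumes "continuous_on S f" "x \<in> S" "0 < e"
  shows "\<exists>d>0. \<forall>y\<in>S. dist y x < d \<longrightarrow> dist (f y) (f x) < e"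
  using assms unfolding continuous_on_iff by blast

lemma compact_finite_products:
  fixes S :: "'i \<Rightarrow> real set"
  assumes "\<And>i. finite (S i)"
  shows "compact {c. \<forall>i. c i \<in> S i}"
proof -
  have eq: "{c. \<forall>i. c i \<in> S i} = PiE UNIV S" by (auto simp: PiE_def Pi_def)
  have "compactin (product_topology (\<lambda>i::'i. euclidean) UNIV) (PiE UNIV S)"
    unfolding compactin_PiE using assms by (auto simp: finite_imp_compact)
  then show ?thesis by (simp add: eq euclidean_product_topology)
qed

lemma totally_disconnected_finite_products:
  fixes K :: "('i \<Rightarrow> real) set"
  assumes "\<And>i. finite (S i)" "\<And>c i. c \<in> K \<Longrightarrow> c i \<in> S i"
  shows "totally_disconnected K"
  unfolding totally_disconnected_def
proof (intro allI impI ballI)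
  fix T x y assume T: "T \<subseteq> K" "connected T" "x \<in> T" "y \<in> T"
  show "x = y"
  proof
    fix i
    have "continuous_on T (\<lambda>c. c i)"
      by (rule continuous_on_subset[OF continuous_on_product_coordinates]) auto
    then have "connected ((\<lambda>c. c i) ` T)" using T(2) connected_continuous_image by blast
    moreover have "finite ((\<lambda>c. c i) ` T)"
      by (rule finite_subset[OF _ assms(1)[of i]]) (use T(1) assms(2) in blast)
    ultimately obtain a where "(\<lambda>c. c i) ` T = {a}"
      using T(3) connected_finite_iff_sing by blast
    moreover have "x i \<in> (\<lambda>c. c i) ` T" "y i \<in> (\<lambda>c. c i) ` T" using T(3,4) by auto
    ultimately show "x i = y i" by simp
  qed
qed

section \<open>Lelek functions and finite matchings\<close>

definition hypograph :: "'c set \<Rightarrow> ('c \<Rightarrow> real) \<Rightarrow> ('c \<times> real) set" where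
  "hypograph C \<phi> = {p. fst p \<in> C \<and> 0 \<le> snd p \<and> snd p \<le> \<phi> (fst p)}"

lemma hypograph_iff [simp]: "(c, t) \<in> hypograph C \<phi> \<longleftrightarrow> c \<in> C \<and> 0 \<le> t \<and> t \<le> \<phi> c"
  by (simp add: hypograph_def)

text \<open>
  Compactness of the hypograph expresses upper semicontinuity. The last condition says that the tips
  \<open>(c, \<phi> c)\<close> with \<open>0 < \<phi> c\<close> are dense in the hypograph, also over the zeros of \<open>\<phi>\<close>; this is what the density of the
  end-points of a fan becomes.
\<close>

definition lelek_function :: "'c::metric_space set \<Rightarrow> ('c \<Rightarrow> real) \<Rightarrow> bool" where
  "lelek_function C \<phi> \<longleftrightarrow>
     compact C \<and> C \<noteq> {} \<and> totally_disconnected C \<and> (\<forall>c\<in>C. 0 \<le> \<phi> c) \<and> compact (hypograph C \<phi>) \<and>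
     (\<forall>c\<in>C. \<forall>t e. 0 \<le> t \<and> t \<le> \<phi> c \<and> 0 < e \<longrightarrow>
        (\<exists>c'\<in>C. dist c' c < e \<and> 0 < \<phi> c' \<and> \<bar>\<phi> c' - t\<bar> < e))"

lemma lelek_functionD:
  assumes "lelek_function C \<phi>"
  shows "compact C" "C \<noteq> {}" "totally_disconnected C" "\<And>c. c \<in> C \<Longrightarrow> 0 \<le> \<phi> c" "compact (hypograph C \<phi>)"
  using assms by (simp_all add: lelek_function_def)

definition peak :: "('c \<Rightarrow> real) \<Rightarrow> 'c set \<Rightarrow> real" where
  "peak \<phi> A = (SUP a\<in>A. \<phi> a)"

lemma peak_eqI:
  assumes "a \<in> A" "\<And>x. x \<in> A \<Longrightarrow> \<phi> x \<le> \<phi> a"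
  shows "peak \<phi> A = \<phi> a"
  unfolding peak_def by (rule cSup_eq_maximum) (use assms in auto)

text \<open>
  An upper semicontinuous function attains its maximum; here this is compactness of the part of the
  hypograph over \<open>A\<close>.
\<close>

lemma peak_attained:
  assumes L: "lelek_function C \<phi>" and A: "clopen_in C A" "A \<noteq> {}"
  obtains a where "a \<in> A" "\<phi> a = peak \<phi> A" "\<And>x. x \<in> A \<Longrightarrow> \<phi> x \<le> peak \<phi> A"
proof -
  let ?K = "hypograph C \<phi> \<inter> (A \<times> UNIV)"
  have AC: "A \<subseteq> C" using A clopen_in_subset by blast
  have "compact A" using L A(1) clopen_in_compact unfolding lelek_function_def by blast
  then have "compact ?K"
    using L unfolding lelek_function_def
    by (intro compact_Int_closed closed_Times) (auto simp: compact_imp_closed)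
  then have cK: "compact (snd ` ?K)"
    by (intro compact_continuous_image continuous_intros)
  have pos: "0 \<le> \<phi> x" if "x \<in> A" for x using L AC that unfolding lelek_function_def by auto
  obtain x0 where "x0 \<in> A" using A by auto
  then have "(x0, \<phi> x0) \<in> ?K" using AC pos by auto
  then have "snd ` ?K \<noteq> {}" by blast
  from compact_attains_sup[OF cK this]
  obtain p where p: "p \<in> ?K" "\<And>q. q \<in> ?K \<Longrightarrow> snd q \<le> snd p" by auto
  have le: "\<phi> x \<le> snd p" if "x \<in> A" for x
    using p(2)[of "(x, \<phi> x)"] AC pos that by auto
  have "fst p \<in> A" "snd p \<le> \<phi> (fst p)" using p(1) by (auto simp: hypograph_def)
  then have "fst p \<in> A" "\<phi> (fst p) = snd p" using le by force+
  moreover have "peak \<phi> A = \<phi> (fst p)"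
    by (rule peak_eqI) (use calculation le in auto)
  ultimately show ?thesis using le that by auto
qed

lemma peak_upper: "lelek_function C \<phi> \<Longrightarrow> clopen_in C A \<Longrightarrow> x \<in> A \<Longrightarrow> \<phi> x \<le> peak \<phi> A"
  by (metis empty_iff peak_attained)

lemma peak_pos:
  assumes L: "lelek_function C \<phi>" and A: "clopen_in C A" "A \<noteq> {}"
  shows "0 < peak \<phi> A"
proof -
  obtain a where a: "a \<in> A" using A by auto
  then have aC: "a \<in> C" using A clopen_in_subset by blast
  obtain e where e: "e > 0" "\<And>y. y \<in> C \<Longrightarrow> dist y a < e \<Longrightarrow> y \<in> A"
    using clopen_in_near[OF A(1) a] by metis
  have "0 \<le> \<phi> a" using L aC unfolding lelek_function_def by auto
  then obtain c where "c \<in> C" "dist c a < e" "0 < \<phi> c"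
    using L aC e(1) unfolding lelek_function_def by (metis order_refl)
  then show ?thesis using e(2) peak_upper[OF L A(1)] by fastforce
qed

text \<open>
  The point above the tip over \<open>c\<close> at distance \<open>e\<close> lies outside the closed hypograph, and so does a ball around it.
\<close>

lemma lelek_upper_semicontinuous:
  assumes L: "lelek_function C \<phi>" and c: "c \<in> C" and e: "e > 0"
  obtains \<delta> where "\<delta> > 0" "\<And>x. x \<in> C \<Longrightarrow> dist x c < \<delta> \<Longrightarrow> \<phi> x < \<phi> c + e"
proof -
  have pos: "0 \<le> \<phi> c" using L c unfolding lelek_function_def by auto
  have "open (- hypograph C \<phi>)"
    using L unfolding lelek_function_def by (auto simp: compact_imp_closed)
  moreover have "(c, \<phi> c + e) \<in> - hypograph C \<phi>" using e by simp
  ultimately obtain \<delta> where d: "\<delta> > 0" "ball (c, \<phi> c + e) \<delta> \<subseteq> - hypograph C \<phi>"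
    using openE by blast
  show ?thesis
  proof (rule that[OF d(1)])
    fix x assume x: "x \<in> C" "dist x c < \<delta>"
    then have "(x, \<phi> c + e) \<in> ball (c, \<phi> c + e) \<delta>"
      by (simp add: dist_Pair_Pair dist_commute)
    then have "(x, \<phi> c + e) \<notin> hypograph C \<phi>" using d(2) by auto
    then show "\<phi> x < \<phi> c + e" using x pos e by auto
  qed
qed

text \<open>
  A function is recovered from its maxima over shrinking clopen sets. This needs upper semicontinuity, and it is
  how information about finite partitions becomes information about points.
\<close>

lemma peak_tendsto:
  assumes L: "lelek_function C \<phi>" and c: "c \<in> C"
    and A: "\<And>n. clopen_in C (A n)" "\<And>n. c \<in> A n"
    and mesh: "\<And>n x. x \<in> A (Suc n) \<Longrightarrow> dist x c < inverse (real (Suc n))"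
  shows "(\<lambda>n. peak \<phi> (A n)) \<longlonglongrightarrow> \<phi> c"
proof (rule LIMSEQ_I)
  fix r :: real assume r: "0 < r"
  obtain \<delta> where d: "\<delta> > 0" "\<And>x. x \<in> C \<Longrightarrow> dist x c < \<delta> \<Longrightarrow> \<phi> x < \<phi> c + r"
    using lelek_upper_semicontinuous[OF L c r] by metis
  obtain N where N: "inverse (real (Suc N)) < \<delta>"
    using reals_Archimedean d(1) by blast
  show "\<exists>no. \<forall>n\<ge>no. norm (peak \<phi> (A n) - \<phi> c) < r"
  proof (intro exI allI impI)
    fix n assume n: "Suc N \<le> n"
    then obtain m where m: "n = Suc m" "N \<le> m" by (cases n) auto
    obtain a where a: "a \<in> A n" "\<phi> a = peak \<phi> (A n)"
      using peak_attained[OF L A(1)] A(2) by (metis empty_iff)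
    have "dist a c < inverse (real (Suc m))" using a mesh m by auto
    also have "\<dots> \<le> inverse (real (Suc N))" using m by (simp add: field_simps)
    finally have "dist a c < \<delta>" using N by simp
    moreover have "a \<in> C" using a(1) A(1) clopen_in_subset by blast
    ultimately have "peak \<phi> (A n) < \<phi> c + r" using d(2) a(2) by metis
    moreover have "\<phi> c \<le> peak \<phi> (A n)" using peak_upper[OF L A(1) A(2)] .
    ultimately show "norm (peak \<phi> (A n) - \<phi> c) < r" by simp
  qed
qed

lemma ln_near:
  fixes t e :: real
  assumes "0 < t" "0 < e"
  obtains d where "d > 0" "\<And>p. \<bar>p - t\<bar> < d \<Longrightarrow> 0 < p \<and> \<bar>ln p - ln t\<bar> < e"
proof -
  have "isCont ln t" using assms by (intro isCont_ln) auto
  then obtain d where d: "d > 0" "\<And>p. dist p t < d \<Longrightarrow> dist (ln p) (ln t) < e"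
    using assms(2) unfolding continuous_at_eps_delta by metis
  show ?thesis
    by (rule that[of "min d t"]) (use d assms in \<open>auto simp: dist_real_def\<close>)
qed

text \<open>
  Close to \<open>b\<close> there are tips of height nearly \<open>t\<close>, and over a small clopen neighbourhood of such a tip
  the maximum is hardly larger. As \<open>t < \<psi> b\<close>, the tip is not the one over \<open>b\<close>; therefore
  the neighbourhood can avoid \<open>b\<close>, and if \<open>\<psi>\<close> is maximal at \<open>b\<close>, cutting it off does not lower the maximum of the rest.
\<close>

lemma peak_prescribed:
  assumes L: "lelek_function D \<psi>" and B: "clopen_in D B" "b \<in> B"
    and t: "0 < t" "t < \<psi> b" and e: "0 < e"
  obtains B' where "clopen_in D B'" "B' \<subseteq> B" "B' \<noteq> {}" "b \<notin> B'" "\<bar>ln (peak \<psi> B') - ln t\<bar> < e"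
proof -
  have cD: "compact D" "totally_disconnected D" using L unfolding lelek_function_def by auto
  have bD: "b \<in> D" using B clopen_in_subset by blast
  obtain d0 where d0: "d0 > 0" "\<And>p. \<bar>p - t\<bar> < d0 \<Longrightarrow> 0 < p \<and> \<bar>ln p - ln t\<bar> < e"
    using ln_near[OF t(1) e] by metis
  define d1 where "d1 = min d0 (\<psi> b - t)"
  have d1: "d1 > 0" using d0 t by (simp add: d1_def)
  obtain r where r: "r > 0" "\<And>y. y \<in> D \<Longrightarrow> dist y b < r \<Longrightarrow> y \<in> B"
    using clopen_in_near[OF B] by metis
  obtain d where d: "d \<in> D" "dist d b < min r (d1/2)" "\<bar>\<psi> d - t\<bar> < min r (d1/2)"
    using L bD t r(1) d1 unfolding lelek_function_def
    by (metis half_gt_zero less_eq_real_def min_less_iff_conj)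
  have db: "d \<in> B" "d \<noteq> b" using d r(2) by (auto simp: d1_def)
  obtain s where s: "s > 0" "\<And>x. x \<in> D \<Longrightarrow> dist x d < s \<Longrightarrow> \<psi> x < \<psi> d + d1/2"
    using lelek_upper_semicontinuous[OF L d(1), of "d1/2"] d1 by (metis half_gt_zero)
  have "min s (dist d b) > 0" using s(1) db(2) by simp
  then obtain Q where Q: "clopen_in D Q" "d \<in> Q" "Q \<subseteq> ball d (min s (dist d b))"
    using small_clopen_neighbourhood[OF cD d(1)] by metis
  have cl: "clopen_in D (Q \<inter> B)" using Q B clopen_in_Int by blast
  have ne: "Q \<inter> B \<noteq> {}" using Q db by auto
  obtain a where a: "a \<in> Q \<inter> B" "\<psi> a = peak \<psi> (Q \<inter> B)"
    using peak_attained[OF L cl ne] by metis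
  have "dist a d < s" using a(1) Q(3) by (auto simp: dist_commute)
  moreover have "a \<in> D" using a(1) B(1) clopen_in_subset by blast
  ultimately have "peak \<psi> (Q \<inter> B) < \<psi> d + d1/2" using s(2) a(2) by metis
  moreover have "\<psi> d \<le> peak \<psi> (Q \<inter> B)" using peak_upper[OF L cl] Q db by auto
  moreover have "\<bar>\<psi> d - t\<bar> < d1/2" using d(3) by simp
  moreover have "d1 \<le> d0" by (simp add: d1_def)
  ultimately have "\<bar>peak \<psi> (Q \<inter> B) - t\<bar> < d0" by linarith
  then show ?thesis
  proof (intro that[OF cl _ ne])
    show "b \<notin> Q \<inter> B" using Q(3) by (auto simp: dist_commute)
  qed (use d0(2) in auto)
qed

text \<open>
  The pieces are cut off one at a time; what remains always contains \<open>b\<close>, so that the next cut is possible.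
\<close>

lemma peaks_prescribed:
  assumes L: "lelek_function D \<psi>" and B: "clopen_in D B" "b \<in> B"
    and I: "finite I" "\<And>i. i \<in> I \<Longrightarrow> 0 < t i \<and> t i < \<psi> b" and e: "0 < e"
  shows "\<exists>\<beta>. disjoint_family_on \<beta> I \<and> b \<notin> \<Union>(\<beta> ` I) \<and>
    (\<forall>i\<in>I. clopen_in D (\<beta> i) \<and> \<beta> i \<subseteq> B \<and> \<beta> i \<noteq> {} \<and> \<bar>ln (peak \<psi> (\<beta> i)) - ln (t i)\<bar> < e)"
  using I
proof (induction I rule: finite_induct)
  case empty
  show ?case by (auto simp: disjoint_family_on_def)
next
  case (insert i I)
  then obtain \<beta> where \<beta>: "disjoint_family_on \<beta> I" "b \<notin> \<Union>(\<beta> ` I)"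
    "\<And>j. j \<in> I \<Longrightarrow> clopen_in D (\<beta> j) \<and> \<beta> j \<subseteq> B \<and> \<beta> j \<noteq> {} \<and> \<bar>ln (peak \<psi> (\<beta> j)) - ln (t j)\<bar> < e"
    by auto
  have "clopen_in D (B - \<Union>(\<beta> ` I))"
    using B \<beta> insert.hyps by (intro clopen_in_Diff clopen_in_Union) auto
  moreover have "b \<in> B - \<Union>(\<beta> ` I)" using B \<beta> by auto
  moreover have "0 < t i" "t i < \<psi> b" using insert.prems by auto
  ultimately obtain B' where B': "clopen_in D B'" "B' \<subseteq> B - \<Union>(\<beta> ` I)" "B' \<noteq> {}" "b \<notin> B'"
    "\<bar>ln (peak \<psi> B') - ln (t i)\<bar> < e"
    using peak_prescribed[OF L _ _ _ _ e] by metis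
  have "disjoint_family_on (\<beta>(i := B')) (insert i I)"
    unfolding disjoint_family_on_def
  proof (intro ballI impI)
    fix m n assume "m \<in> insert i I" "n \<in> insert i I" "m \<noteq> n"
    then show "(\<beta>(i := B')) m \<inter> (\<beta>(i := B')) n = {}"
      using \<beta>(1) B'(2) by (auto simp: disjoint_family_on_def)
  qed
  moreover have "b \<notin> \<Union>((\<beta>(i := B')) ` insert i I)"
    using \<beta>(2) B'(4) by (auto split: if_splits)
  moreover have "\<forall>j\<in>insert i I. clopen_in D ((\<beta>(i := B')) j) \<and> (\<beta>(i := B')) j \<subseteq> B \<and> (\<beta>(i := B')) j \<noteq> {} \<and>
      \<bar>ln (peak \<psi> ((\<beta>(i := B')) j)) - ln (t j)\<bar> < e"
    using \<beta>(3) B' by auto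
  ultimately show ?case by blast
qed

text \<open>
  Each point of \<open>A\<close> lies in \<open>f p\<close> for exactly one \<open>p\<close>. With \<open>fst\<close> and \<open>snd\<close> for \<open>f\<close>, both sides of a set of pairs
  are treated at once.
\<close>

definition cells :: "('p \<Rightarrow> 'a set) \<Rightarrow> 'a set \<Rightarrow> 'p set \<Rightarrow> bool" where
  "cells f A R \<longleftrightarrow> (\<forall>a\<in>A. \<exists>!p. p \<in> R \<and> a \<in> f p)"

lemma cellsI:
  assumes "\<And>a. a \<in> A \<Longrightarrow> \<exists>p\<in>R. a \<in> f p"
    and "\<And>a p p'. a \<in> A \<Longrightarrow> p \<in> R \<Longrightarrow> p' \<in> R \<Longrightarrow> a \<in> f p \<Longrightarrow> a \<in> f p' \<Longrightarrow> p = p'"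
  shows "cells f A R"
  unfolding cells_def
proof (intro ballI ex_ex1I)
  fix a assume a: "a \<in> A"
  show "\<exists>p. p \<in> R \<and> a \<in> f p" using assms(1)[OF a] by blast
  show "p = p'" if "p \<in> R \<and> a \<in> f p" "p' \<in> R \<and> a \<in> f p'" for p p'
    using that assms(2)[OF a] by simp
qed

lemma cells_unique: "cells f A R \<Longrightarrow> a \<in> A \<Longrightarrow> p \<in> R \<Longrightarrow> p' \<in> R \<Longrightarrow> a \<in> f p \<Longrightarrow> a \<in> f p' \<Longrightarrow> p = p'"
  unfolding cells_def by blast

lemma cells_cover: "cells f A R \<Longrightarrow> a \<in> A \<Longrightarrow> \<exists>p\<in>R. a \<in> f p"
  unfolding cells_def by blast

lemma cells_swap:
  assumes "cells (\<lambda>p. f (prod.swap p)) A R" shows "cells f A (prod.swap ` R)"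
proof (rule cellsI)
  show "\<exists>p\<in>prod.swap ` R. a \<in> f p" if "a \<in> A" for a
    using cells_cover[OF assms that] by auto
  fix a p p' assume "a \<in> A" "p \<in> prod.swap ` R" "p' \<in> prod.swap ` R" "a \<in> f p" "a \<in> f p'"
  then show "p = p'" using cells_unique[OF assms] by blast
qed

lemma cells_UN:
  assumes R: "cells f A R" and S: "\<And>p. p \<in> R \<Longrightarrow> cells f (f p) (S p)"
    and sub: "\<And>p q. p \<in> R \<Longrightarrow> q \<in> S p \<Longrightarrow> f q \<subseteq> f p"
  shows "cells f A (\<Union>p\<in>R. S p)"
proof (rule cellsI)
  show "\<exists>q\<in>\<Union>p\<in>R. S p. a \<in> f q" if "a \<in> A" for a
    using cells_cover[OF R that] cells_cover[OF S] by blast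
  fix a q q' assume a: "a \<in> A" "q \<in> (\<Union>p\<in>R. S p)" "q' \<in> (\<Union>p\<in>R. S p)" "a \<in> f q" "a \<in> f q'"
  then obtain p p' where p: "p \<in> R" "q \<in> S p" "p' \<in> R" "q' \<in> S p'" by blast
  then have ap: "a \<in> f p" "a \<in> f p'" using sub a(4,5) by blast+
  then have "p = p'" using cells_unique[OF R a(1)] p by blast
  then show "q = q'" using cells_unique[OF S[OF p(1)] ap(1)] p a(4,5) by blast
qed

text \<open>
  A bijection between a clopen partition of \<open>A\<close> and one of \<open>B\<close>, as a finite set of pairs. The ambient
  spaces \<open>C\<close> and \<open>D\<close> are recorded so that cells of cells are again clopen in the whole space.
\<close>

definition matching :: "'c::metric_space set \<Rightarrow> 'd::metric_space set \<Rightarrow> 'c set \<Rightarrow> 'd set \<Rightarrow> ('c set \<times> 'd set) set \<Rightarrow> bool" where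
  "matching C D A B R \<longleftrightarrow> finite R \<and>
     (\<forall>p\<in>R. clopen_in C (fst p) \<and> fst p \<noteq> {} \<and> fst p \<subseteq> A \<and> clopen_in D (snd p) \<and> snd p \<noteq> {} \<and> snd p \<subseteq> B) \<and>
     cells fst A R \<and> cells snd B R"

lemma matching_cell:
  assumes "matching C D A B R" "a \<in> A"
  shows "\<exists>p. p \<in> R \<and> a \<in> fst p \<and> (\<forall>p'\<in>R. a \<in> fst p' \<longrightarrow> p' = p)"
proof -
  have "\<exists>!p. p \<in> R \<and> a \<in> fst p" using assms by (simp add: matching_def cells_def)
  then show ?thesis by (elim ex1E) blast
qed

lemma matching_clopen:
  assumes "matching C D A B R" "p \<in> R"
  shows "clopen_in C (fst p)" "fst p \<noteq> {}" "fst p \<subseteq> A" "clopen_in D (snd p)" "snd p \<noteq> {}" "snd p \<subseteq> B"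
  using assms by (auto simp: matching_def)

text \<open>
  The stretching factor that a pair of cells suggests. It is taken logarithmically because the corrections
  in successive refinements have to be summable.
\<close>

definition log_ratio :: "('c \<Rightarrow> real) \<Rightarrow> ('d \<Rightarrow> real) \<Rightarrow> 'c set \<times> 'd set \<Rightarrow> real" where
  "log_ratio \<phi> \<psi> p = ln (peak \<psi> (snd p)) - ln (peak \<phi> (fst p))"

definition refinement :: "('c \<Rightarrow> real) \<Rightarrow> ('d \<Rightarrow> real) \<Rightarrow> real \<Rightarrow> ('c set \<times> 'd set) set \<Rightarrow> ('c set \<times> 'd set) set \<Rightarrow> bool" where
  "refinement \<phi> \<psi> \<epsilon> R R' \<longleftrightarrow> (\<forall>q\<in>R'. \<exists>p\<in>R. fst q \<subseteq> fst p \<and> snd q \<subseteq> snd p \<and>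
      \<bar>log_ratio \<phi> \<psi> q - log_ratio \<phi> \<psi> p\<bar> \<le> \<epsilon>)"

text \<open>
  Partition \<open>A\<close> into small cells. The cell that contains a maximum point of \<open>\<phi>\<close> is put aside; for each other one,
  a piece with nearly proportional maximum is cut off from \<open>B\<close>. The rest of \<open>B\<close> still contains a maximum
  point of \<open>\<psi>\<close> and is the partner of the cell put aside.
\<close>

lemma refine_pair:
  assumes LC: "lelek_function C \<phi>" and LD: "lelek_function D \<psi>"
    and A: "clopen_in C A" "A \<noteq> {}" and B: "clopen_in D B" "B \<noteq> {}" and \<epsilon>: "0 < \<epsilon>" and \<delta>: "0 < \<delta>"
  shows "\<exists>R. matching C D A B R \<and> refinement \<phi> \<psi> \<epsilon> {(A, B)} R \<and>
    (\<forall>p\<in>R. \<forall>x\<in>fst p. \<forall>y\<in>fst p. dist x y < \<delta>)"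
proof -
  have tr: "clopen_in C X" if "clopen_in A X" for X
    using that A unfolding clopen_in_def by (meson openin_trans closedin_trans)
  have cC: "compact C" "totally_disconnected C" using LC unfolding lelek_function_def by auto
  have "compact A" using A cC clopen_in_compact by blast
  moreover have "totally_disconnected A"
    using cC(2) A(1) clopen_in_subset[of C A] unfolding totally_disconnected_def by (metis subset_trans)
  ultimately obtain \<A> where \<A>: "finite \<A>" "disjoint \<A>" "\<Union>\<A> = A"
    "\<And>K. K \<in> \<A> \<Longrightarrow> clopen_in A K \<and> K \<noteq> {}"
    "\<And>K x y. K \<in> \<A> \<Longrightarrow> x \<in> K \<Longrightarrow> y \<in> K \<Longrightarrow> dist x y < \<delta>"
    using clopen_partition \<delta> by metis
  obtain a where a: "a \<in> A" "\<phi> a = peak \<phi> A" "\<And>x. x \<in> A \<Longrightarrow> \<phi> x \<le> peak \<phi> A"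
    using peak_attained[OF LC A] by metis
  obtain b where b: "b \<in> B" "\<psi> b = peak \<psi> B" "\<And>x. x \<in> B \<Longrightarrow> \<psi> x \<le> peak \<psi> B"
    using peak_attained[OF LD B] by metis
  obtain A1 where A1: "A1 \<in> \<A>" "a \<in> A1" using \<A>(3) a(1) by blast
  define M where "M = peak \<psi> B"
  define m where "m = peak \<phi> A"
  have Mm: "0 < M" "0 < m" unfolding M_def m_def using peak_pos LC LD A B by blast+
  have pk: "0 < peak \<phi> K \<and> peak \<phi> K \<le> m" if "K \<in> \<A>" for K
  proof -
    have K: "clopen_in C K" "K \<noteq> {}" using \<A>(4) tr that by auto
    obtain x where "x \<in> K" "\<phi> x = peak \<phi> K" using peak_attained[OF LC K] by metis
    then have "peak \<phi> K \<le> m" using a(3) \<A>(3) that unfolding m_def by (metis UnionI)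
    then show ?thesis using peak_pos[OF LC K] by simp
  qed
  have pA1: "peak \<phi> A1 = m"
  proof -
    have "clopen_in C A1" using \<A>(4) tr A1 by auto
    then have "m \<le> peak \<phi> A1" using peak_upper[OF LC _ A1(2)] a(2) unfolding m_def by metis
    then show ?thesis using pk[OF A1(1)] by simp
  qed
  \<comment> \<open>targets strictly below the maximum, so that the pieces found for them avoid its point\<close>
  define t where "t = (\<lambda>K. M * (peak \<phi> K / m) * exp (- \<epsilon>/2))"
  have t: "0 < t K \<and> t K < \<psi> b" if "K \<in> \<A> - {A1}" for K
  proof -
    have "0 < peak \<phi> K / m" "peak \<phi> K / m \<le> 1" using pk[of K] that Mm by auto
    then have "peak \<phi> K / m * exp (-\<epsilon>/2) < 1 * 1"
      using \<epsilon> by (intro mult_le_less_imp_less) auto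
    then have "M * (peak \<phi> K / m * exp (-\<epsilon>/2)) < M * 1" using Mm by (intro mult_strict_left_mono) auto
    then have "t K < \<psi> b" using b(2) by (simp add: t_def M_def mult.assoc)
    moreover have "0 < t K" unfolding t_def using \<open>0 < peak \<phi> K / m\<close> Mm by (intro mult_pos_pos) auto
    ultimately show ?thesis by simp
  qed
  have fin: "finite (\<A> - {A1})" using \<A>(1) by simp
  have "\<exists>\<beta>. disjoint_family_on \<beta> (\<A> - {A1}) \<and> b \<notin> \<Union>(\<beta> ` (\<A> - {A1})) \<and>
    (\<forall>K\<in>\<A> - {A1}. clopen_in D (\<beta> K) \<and> \<beta> K \<subseteq> B \<and> \<beta> K \<noteq> {} \<and> \<bar>ln (peak \<psi> (\<beta> K)) - ln (t K)\<bar> < \<epsilon>/2)"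
    by (rule peaks_prescribed[OF LD B(1) b(1) fin t]) (use \<epsilon> in auto)
  then obtain \<beta> where \<beta>: "disjoint_family_on \<beta> (\<A> - {A1})" "b \<notin> \<Union>(\<beta> ` (\<A> - {A1}))"
    "\<forall>K\<in>\<A> - {A1}. clopen_in D (\<beta> K) \<and> \<beta> K \<subseteq> B \<and> \<beta> K \<noteq> {} \<and> \<bar>ln (peak \<psi> (\<beta> K)) - ln (t K)\<bar> < \<epsilon>/2"
    by (elim exE conjE)
  define B1 where "B1 = B - \<Union>(\<beta> ` (\<A> - {A1}))"
  define \<gamma> where "\<gamma> = \<beta>(A1 := B1)"
  have B1: "clopen_in D B1" "b \<in> B1" "B1 \<subseteq> B"
  proof -
    show "clopen_in D B1" unfolding B1_def
      using B(1) \<beta>(3) fin by (intro clopen_in_Diff clopen_in_Union) auto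
    show "b \<in> B1" "B1 \<subseteq> B" unfolding B1_def using b(1) \<beta>(2) by auto
  qed
  have pB1: "peak \<psi> B1 = M"
    unfolding M_def b(2)[symmetric] by (rule peak_eqI) (use B1 b in auto)
  have \<gamma>: "clopen_in D (\<gamma> K) \<and> \<gamma> K \<subseteq> B \<and> \<gamma> K \<noteq> {}" if "K \<in> \<A>" for K
    using \<beta>(3) B1 that by (auto simp: \<gamma>_def)
  have \<gamma>dis: "\<gamma> K \<inter> \<gamma> K' = {}" if "K \<in> \<A>" "K' \<in> \<A>" "K \<noteq> K'" for K K'
    using that \<beta>(1) unfolding disjoint_family_on_def \<gamma>_def B1_def by auto
  have \<gamma>cov: "\<exists>K\<in>\<A>. x \<in> \<gamma> K" if "x \<in> B" for x
    using that A1 unfolding \<gamma>_def B1_def by (cases "x \<in> B1") (auto simp: B1_def)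
  define R where "R = (\<lambda>K. (K, \<gamma> K)) ` \<A>"
  have "matching C D A B R"
    unfolding matching_def
  proof (intro conjI ballI)
    show "finite R" using \<A>(1) by (simp add: R_def)
    fix p assume "p \<in> R"
    then obtain K where K: "K \<in> \<A>" "p = (K, \<gamma> K)" by (auto simp: R_def)
    show "clopen_in C (fst p)" "fst p \<noteq> {}" "fst p \<subseteq> A" "clopen_in D (snd p)" "snd p \<noteq> {}" "snd p \<subseteq> B"
      using K \<gamma>[OF K(1)] \<A>(3,4) tr by auto
  next
    show "cells fst A R"
    proof (rule cellsI)
      show "\<exists>p\<in>R. x \<in> fst p" if "x \<in> A" for x using that \<A>(3) by (auto simp: R_def)
      fix x p p' assume "p \<in> R" "p' \<in> R" "x \<in> fst p" "x \<in> fst p'"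
      then obtain K K' where K: "K \<in> \<A>" "p = (K, \<gamma> K)" "K' \<in> \<A>" "p' = (K', \<gamma> K')" "x \<in> K" "x \<in> K'"
        by (auto simp: R_def)
      then have "K = K'" using \<A>(2) unfolding pairwise_def disjnt_def by blast
      then show "p = p'" using K by simp
    qed
    show "cells snd B R"
    proof (rule cellsI)
      show "\<exists>p\<in>R. x \<in> snd p" if "x \<in> B" for x using \<gamma>cov[OF that] by (auto simp: R_def)
      fix x p p' assume "p \<in> R" "p' \<in> R" "x \<in> snd p" "x \<in> snd p'"
      then obtain K K' where K: "K \<in> \<A>" "p = (K, \<gamma> K)" "K' \<in> \<A>" "p' = (K', \<gamma> K')" "x \<in> \<gamma> K" "x \<in> \<gamma> K'"
        by (auto simp: R_def)
      then have "K = K'" using \<gamma>dis by blast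
      then show "p = p'" using K by simp
    qed
  qed
  moreover have "refinement \<phi> \<psi> \<epsilon> {(A, B)} R"
    unfolding refinement_def
  proof (intro ballI)
    fix q assume "q \<in> R"
    then obtain K where K: "K \<in> \<A>" "q = (K, \<gamma> K)" by (auto simp: R_def)
    have "\<bar>log_ratio \<phi> \<psi> q - log_ratio \<phi> \<psi> (A, B)\<bar> \<le> \<epsilon>"
    proof (cases "K = A1")
      case True
      then show ?thesis using pA1 pB1 K \<epsilon> by (simp add: log_ratio_def \<gamma>_def m_def M_def)
    next
      case False
      then have h: "\<bar>ln (peak \<psi> (\<gamma> K)) - ln (t K)\<bar> < \<epsilon>/2" using \<beta>(3) K by (simp add: \<gamma>_def)
      have "ln (t K) = ln M + (ln (peak \<phi> K) - ln m) - \<epsilon>/2"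
        unfolding t_def using Mm pk[OF K(1)] by (simp add: ln_mult ln_div)
      then have "log_ratio \<phi> \<psi> q - log_ratio \<phi> \<psi> (A, B) = (ln (peak \<psi> (\<gamma> K)) - ln (t K)) - \<epsilon>/2"
        using K by (simp add: log_ratio_def m_def M_def)
      then show ?thesis using h by linarith
    qed
    moreover have "fst q \<subseteq> A" "snd q \<subseteq> B" using K \<A>(3) \<gamma> by auto
    ultimately show "\<exists>p\<in>{(A, B)}. fst q \<subseteq> fst p \<and> snd q \<subseteq> snd p \<and> \<bar>log_ratio \<phi> \<psi> q - log_ratio \<phi> \<psi> p\<bar> \<le> \<epsilon>"
      by simp
  qed
  moreover have "\<forall>p\<in>R. \<forall>x\<in>fst p. \<forall>y\<in>fst p. dist x y < \<delta>"
    using \<A>(5) by (auto simp: R_def)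
  ultimately show ?thesis by blast
qed

lemma matching_swap: "matching C D A B R \<Longrightarrow> matching D C B A (prod.swap ` R)"
  unfolding matching_def using cells_swap[of fst B R] cells_swap[of snd A R] by simp

lemma refinement_swap: "refinement \<phi> \<psi> \<epsilon> R R' \<Longrightarrow> refinement \<psi> \<phi> \<epsilon> (prod.swap ` R) (prod.swap ` R')"
proof -
  assume r: "refinement \<phi> \<psi> \<epsilon> R R'"
  show ?thesis
    unfolding refinement_def
  proof
    fix q assume "q \<in> prod.swap ` R'"
    then obtain q' where q': "q' \<in> R'" "q = prod.swap q'" by blast
    then obtain p where "p \<in> R" "fst q' \<subseteq> fst p" "snd q' \<subseteq> snd p"
      "\<bar>log_ratio \<phi> \<psi> q' - log_ratio \<phi> \<psi> p\<bar> \<le> \<epsilon>"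
      using r unfolding refinement_def by blast
    then show "\<exists>p\<in>prod.swap ` R. fst q \<subseteq> fst p \<and> snd q \<subseteq> snd p \<and>
        \<bar>log_ratio \<psi> \<phi> q - log_ratio \<psi> \<phi> p\<bar> \<le> \<epsilon>"
      using q' by (intro bexI[of _ "prod.swap p"]) (auto simp: log_ratio_def)
  qed
qed

lemma refinement_trans:
  assumes "refinement \<phi> \<psi> \<epsilon> R R'" "refinement \<phi> \<psi> \<epsilon>' R' R''"
  shows "refinement \<phi> \<psi> (\<epsilon> + \<epsilon>') R R''"
  unfolding refinement_def
proof
  fix r assume "r \<in> R''"
  then obtain q where q: "q \<in> R'" "fst r \<subseteq> fst q" "snd r \<subseteq> snd q" "\<bar>log_ratio \<phi> \<psi> r - log_ratio \<phi> \<psi> q\<bar> \<le> \<epsilon>'"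
    using assms(2) unfolding refinement_def by blast
  then obtain p where p: "p \<in> R" "fst q \<subseteq> fst p" "snd q \<subseteq> snd p" "\<bar>log_ratio \<phi> \<psi> q - log_ratio \<phi> \<psi> p\<bar> \<le> \<epsilon>"
    using assms(1) unfolding refinement_def by blast
  have "\<bar>log_ratio \<phi> \<psi> r - log_ratio \<phi> \<psi> p\<bar> \<le> \<epsilon> + \<epsilon>'" using p q by linarith
  then show "\<exists>p\<in>R. fst r \<subseteq> fst p \<and> snd r \<subseteq> snd p \<and> \<bar>log_ratio \<phi> \<psi> r - log_ratio \<phi> \<psi> p\<bar> \<le> \<epsilon> + \<epsilon>'"
    using p q by blast
qed

lemma refine_matching_left:
  assumes LC: "lelek_function C \<phi>" and LD: "lelek_function D \<psi>" and m: "matching C D C D R"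
    and \<epsilon>: "0 < \<epsilon>" and \<delta>: "0 < \<delta>"
  shows "\<exists>R'. matching C D C D R' \<and> refinement \<phi> \<psi> \<epsilon> R R' \<and>
    (\<forall>p\<in>R'. \<forall>x\<in>fst p. \<forall>y\<in>fst p. dist x y < \<delta>)"
proof -
  have "\<exists>S. matching C D (fst p) (snd p) S \<and> refinement \<phi> \<psi> \<epsilon> {p} S \<and>
    (\<forall>p\<in>S. \<forall>x\<in>fst p. \<forall>y\<in>fst p. dist x y < \<delta>)" if "p \<in> R" for p
    using refine_pair[OF LC LD _ _ _ _ \<epsilon> \<delta>, of "fst p" "snd p"] m that unfolding matching_def by simp
  then obtain S where S: "\<And>p. p \<in> R \<Longrightarrow> matching C D (fst p) (snd p) (S p)"
     "\<And>p. p \<in> R \<Longrightarrow> refinement \<phi> \<psi> \<epsilon> {p} (S p)"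
     "\<And>p q x y. p \<in> R \<Longrightarrow> q \<in> S p \<Longrightarrow> x \<in> fst q \<Longrightarrow> y \<in> fst q \<Longrightarrow> dist x y < \<delta>"
    by metis
  define R' where "R' = (\<Union>p\<in>R. S p)"
  have sub: "clopen_in C (fst q) \<and> fst q \<noteq> {} \<and> fst q \<subseteq> fst p \<and> clopen_in D (snd q) \<and> snd q \<noteq> {} \<and> snd q \<subseteq> snd p"
    if "p \<in> R" "q \<in> S p" for p q
    using S(1)[OF that(1)] that(2) unfolding matching_def by blast
  have subC: "fst p \<subseteq> C \<and> snd p \<subseteq> D" if "p \<in> R" for p
    using m that unfolding matching_def by blast
  have "matching C D C D R'"
    unfolding matching_def
  proof (intro conjI ballI)
    show "finite R'" unfolding R'_def
      using m S(1) by (intro finite_UN_I) (auto simp: matching_def)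
    fix q assume "q \<in> R'"
    then obtain p where p: "p \<in> R" "q \<in> S p" by (auto simp: R'_def)
    show "clopen_in C (fst q)" "fst q \<noteq> {}" "fst q \<subseteq> C" "clopen_in D (snd q)" "snd q \<noteq> {}" "snd q \<subseteq> D"
      using sub[OF p] subC[OF p(1)] by auto
  next
    have R: "cells fst C R" "cells snd D R" using m by (simp_all add: matching_def)
    have Sp: "cells fst (fst p) (S p)" "cells snd (snd p) (S p)" if "p \<in> R" for p
      using S(1)[OF that] by (simp_all add: matching_def)
    show "cells fst C R'" unfolding R'_def by (rule cells_UN[OF R(1) Sp(1)]) (use sub in blast)+
    show "cells snd D R'" unfolding R'_def by (rule cells_UN[OF R(2) Sp(2)]) (use sub in blast)+
  qed
  moreover have "refinement \<phi> \<psi> \<epsilon> R R'"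
    using S(2) unfolding refinement_def R'_def by blast
  moreover have "\<forall>p\<in>R'. \<forall>x\<in>fst p. \<forall>y\<in>fst p. dist x y < \<delta>"
    using S(3) unfolding R'_def by blast
  ultimately show ?thesis by blast
qed

text \<open>
  Refining from the left makes the cells in \<open>C\<close> small, and refining the swapped matching then makes those in \<open>D\<close> small.
\<close>

lemma refine_matching:
  assumes LC: "lelek_function C \<phi>" and LD: "lelek_function D \<psi>" and m: "matching C D C D R"
    and \<epsilon>: "0 < \<epsilon>" and \<delta>: "0 < \<delta>"
  shows "\<exists>R'. matching C D C D R' \<and> refinement \<phi> \<psi> \<epsilon> R R' \<and>
    (\<forall>p\<in>R'. (\<forall>x\<in>fst p. \<forall>y\<in>fst p. dist x y < \<delta>) \<and> (\<forall>x\<in>snd p. \<forall>y\<in>snd p. dist x y < \<delta>))"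
proof -
  have e2: "0 < \<epsilon>/2" using \<epsilon> by simp
  from refine_matching_left[OF LC LD m e2 \<delta>]
  obtain R1 where R1: "matching C D C D R1" "refinement \<phi> \<psi> (\<epsilon>/2) R R1"
    "\<forall>p\<in>R1. \<forall>x\<in>fst p. \<forall>y\<in>fst p. dist x y < \<delta>" by blast
  from refine_matching_left[OF LD LC matching_swap[OF R1(1)] e2 \<delta>]
  obtain R2 where R2: "matching D C D C R2" "refinement \<psi> \<phi> (\<epsilon>/2) (prod.swap ` R1) R2"
    "\<forall>p\<in>R2. \<forall>x\<in>fst p. \<forall>y\<in>fst p. dist x y < \<delta>" by blast
  let ?R = "prod.swap ` R2"
  have ref: "refinement \<phi> \<psi> (\<epsilon>/2) R1 ?R"
    using refinement_swap[OF R2(2)] by (simp add: image_image)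
  have "refinement \<phi> \<psi> \<epsilon> R ?R"
    using refinement_trans[OF R1(2) ref] by simp
  moreover have "dist x y < \<delta>" if xy: "p \<in> ?R" "x \<in> fst p" "y \<in> fst p" for p x y
  proof -
    obtain q where "q \<in> R1" "fst p \<subseteq> fst q"
      using ref xy(1) unfolding refinement_def by blast
    then show ?thesis using R1(3) xy by blast
  qed
  moreover have "dist x y < \<delta>" if "p \<in> ?R" "x \<in> snd p" "y \<in> snd p" for p x y
    using R2(3) that by auto
  ultimately show ?thesis using matching_swap[OF R2(1)] by blast
qed

section \<open>Equivalence of Lelek functions\<close>

text \<open>
  A point of \<open>C\<close> lies in one cell of each matching; the partners of these cells are nested non-empty
  compact sets whose diameters tend to \<open>0\<close>.
\<close>

lemma matching_thread:
  fixes C :: "'c::metric_space set" and D :: "'d::metric_space set" and R :: "nat \<Rightarrow> ('c set \<times> 'd set) set"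
  assumes D: "compact D" and m: "\<And>n. matching C D C D (R n)"
    and ref: "\<And>n q. q \<in> R (Suc n) \<Longrightarrow> \<exists>p\<in>R n. fst q \<subseteq> fst p \<and> snd q \<subseteq> snd p"
    and mesh: "\<And>n p x y. p \<in> R (Suc n) \<Longrightarrow> x \<in> snd p \<Longrightarrow> y \<in> snd p \<Longrightarrow> dist x y < inverse (real (Suc n))"
    and c: "c \<in> C"
  shows "\<exists>!d. d \<in> D \<and> (\<forall>n. \<exists>p\<in>R n. c \<in> fst p \<and> d \<in> snd p)"
proof -
  have "\<forall>n. \<exists>p. p \<in> R n \<and> c \<in> fst p \<and> (\<forall>p'\<in>R n. c \<in> fst p' \<longrightarrow> p' = p)"
    by (intro allI) (rule matching_cell[OF m c])
  from choice[OF this] obtain p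
    where p': "\<forall>n. p n \<in> R n \<and> c \<in> fst (p n) \<and> (\<forall>q\<in>R n. c \<in> fst q \<longrightarrow> q = p n)"
    by (elim exE)
  have p: "p n \<in> R n \<and> c \<in> fst (p n)" "\<forall>q\<in>R n. c \<in> fst q \<longrightarrow> q = p n" for n
    using p' by auto
  have nest: "snd (p (Suc n)) \<subseteq> snd (p n)" for n
  proof -
    obtain q where q: "q \<in> R n" "fst (p (Suc n)) \<subseteq> fst q" "snd (p (Suc n)) \<subseteq> snd q"
      using ref p(1) by blast
    then have "q = p n" using p(2)[of n] p(1)[of "Suc n"] by blast
    then show ?thesis using q by simp
  qed
  have nest': "snd (p n) \<subseteq> snd (p k)" if "k \<le> n" for k n
    using that nest by (rule lift_Suc_antimono_le[rotated])
  have cl: "clopen_in D (snd (p n)) \<and> snd (p n) \<noteq> {}" for n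
    using matching_clopen[OF m] p(1) by metis
  have ex: "\<forall>n. \<exists>d. d \<in> snd (p n)" using cl by blast
  obtain s where s: "\<And>n. s n \<in> snd (p n)" using choice[OF ex] by blast
  have "\<forall>n. s n \<in> D" using s cl clopen_in_subset by blast
  from seq_compactE[OF compact_imp_seq_compact[OF D] this]
  obtain d r where d: "d \<in> D" "strict_mono r" "(s \<circ> r) \<longlonglongrightarrow> d" by metis
  have dn: "d \<in> snd (p n)" for n
  proof -
    have "closed (snd (p n))" using cl D clopen_in_compact compact_imp_closed by blast
    moreover have "(s \<circ> r) (k + n) \<in> snd (p n)" for k
    proof -
      have "n \<le> r (k + n)" using seq_suble[OF d(2), of "k + n"] by simp
      then show ?thesis using s[of "r (k + n)"] nest' by auto
    qed
    ultimately show ?thesis using LIMSEQ_ignore_initial_segment[OF d(3), of n]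
      by (rule closed_sequentially)
  qed
  show ?thesis
  proof (rule ex1I[of _ d])
    show "d \<in> D \<and> (\<forall>n. \<exists>p\<in>R n. c \<in> fst p \<and> d \<in> snd p)" using d(1) dn p(1) by blast
    fix d' assume d': "d' \<in> D \<and> (\<forall>n. \<exists>p\<in>R n. c \<in> fst p \<and> d' \<in> snd p)"
    show "d' = d"
    proof (rule ccontr)
      assume "d' \<noteq> d"
      then obtain n where "inverse (real (Suc n)) < dist d' d"
        using reals_Archimedean[of "dist d' d"] by auto
      moreover have "d' \<in> snd (p (Suc n))" using d' p(2) by metis
      then have "dist d' d < inverse (real (Suc n))" using mesh[of "p (Suc n)" n] p(1) dn by blast
      ultimately show False by simp
    qed
  qed
qed

text \<open>
  Matchings with mesh tending to \<open>0\<close> define the homeomorphism \<open>H\<close>. The logarithmic ratios of the cells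
  around \<open>c\<close> are locally constant functions of \<open>c\<close> that change by at most \<open>(1/2)^n\<close> in step \<open>n\<close>, so they converge
  uniformly, to \<open>ln \<circ> \<alpha>\<close>. Finally, the maxima over the cells around \<open>c\<close> and \<open>H c\<close> tend to \<open>\<phi> c\<close> and \<open>\<psi> (H c)\<close>.
\<close>

theorem lelek_functions_equivalent:
  fixes C :: "'c::metric_space set" and D :: "'d::metric_space set"
  assumes LC: "lelek_function C \<phi>" and LD: "lelek_function D \<psi>"
  obtains H \<alpha> where "continuous_on C H" "bij_betw H C D" "continuous_on C \<alpha>"
    "\<And>c. c \<in> C \<Longrightarrow> 0 < \<alpha> c" "\<And>c. c \<in> C \<Longrightarrow> \<psi> (H c) = \<alpha> c * \<phi> c"
proof -
  have cC: "compact C" "C \<noteq> {}" and cD: "compact D" "D \<noteq> {}"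
    using lelek_functionD LC LD by blast+
  define Q where "Q = (\<lambda>(n::nat) R R'. refinement \<phi> \<psi> ((1/2)^n) R R' \<and>
    (\<forall>p\<in>R'. (\<forall>x\<in>fst p. \<forall>y\<in>fst p. dist x y < inverse (real (Suc n))) \<and>
      (\<forall>x\<in>snd p. \<forall>y\<in>snd p. dist x y < inverse (real (Suc n)))))"
  have start: "\<exists>R. matching C D C D R"
  proof
    show "matching C D C D {(C, D)}" unfolding matching_def using cC cD by (auto intro!: cellsI)
  qed
  have step: "\<exists>R'. matching C D C D R' \<and> Q n R R'" if "matching C D C D R" for R n
    unfolding Q_def by (rule refine_matching[OF LC LD that]) auto
  obtain R where R: "\<And>n. matching C D C D (R n)" "\<And>n. Q n (R n) (R (Suc n))"
    using dependent_nat_choice[where P = "\<lambda>n. matching C D C D" and Q = Q, OF start step] by blast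
  have m: "matching C D C D (R n)" for n using R(1) .
  have ref: "\<exists>p\<in>R n. fst q \<subseteq> fst p \<and> snd q \<subseteq> snd p \<and> \<bar>log_ratio \<phi> \<psi> q - log_ratio \<phi> \<psi> p\<bar> \<le> (1/2)^n"
    if "q \<in> R (Suc n)" for n q
    using R(2)[of n] that unfolding Q_def refinement_def by blast
  have mesh1: "dist x y < inverse (real (Suc n))" if "p \<in> R (Suc n)" "x \<in> fst p" "y \<in> fst p" for n p x y
    using R(2)[of n] that unfolding Q_def by blast
  have mesh2: "dist x y < inverse (real (Suc n))" if "p \<in> R (Suc n)" "x \<in> snd p" "y \<in> snd p" for n p x y
    using R(2)[of n] that unfolding Q_def by blast
  have thr1: "\<exists>!d. d \<in> D \<and> (\<forall>n. \<exists>p\<in>R n. c \<in> fst p \<and> d \<in> snd p)" if "c \<in> C" for c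
  proof (rule matching_thread[OF cD(1) m])
    show "\<exists>p\<in>R n. fst q \<subseteq> fst p \<and> snd q \<subseteq> snd p" if "q \<in> R (Suc n)" for n q
      using ref[OF that] by blast
  qed (use mesh2 that in auto)
  have thr2: "\<exists>!c. c \<in> C \<and> (\<forall>n. \<exists>p\<in>prod.swap ` R n. d \<in> fst p \<and> c \<in> snd p)" if "d \<in> D" for d
  proof (rule matching_thread[OF cC(1) matching_swap[OF m]])
    show "\<exists>p\<in>prod.swap ` R n. fst q \<subseteq> fst p \<and> snd q \<subseteq> snd p" if q: "q \<in> prod.swap ` R (Suc n)" for n q
    proof -
      obtain q' where q': "q' \<in> R (Suc n)" "q = prod.swap q'" using q by blast
      then obtain p where "p \<in> R n" "fst q' \<subseteq> fst p" "snd q' \<subseteq> snd p" using ref by blast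
      then show ?thesis using q' by (intro bexI[of _ "prod.swap p"]) auto
    qed
  qed (use mesh1 that in auto)
  define E where "E = (\<lambda>c d. \<forall>n. \<exists>p\<in>R n. c \<in> fst p \<and> d \<in> snd p)"
  have E1: "\<exists>!d. d \<in> D \<and> E c d" if "c \<in> C" for c using thr1[OF that] by (simp add: E_def)
  have E2: "\<exists>!c. c \<in> C \<and> E c d" if "d \<in> D" for d
    using thr2[OF that] by (simp add: E_def conj_commute)
  define H where "H = (\<lambda>c. THE d. d \<in> D \<and> E c d)"
  have H: "H c \<in> D" "E c (H c)" if "c \<in> C" for c
    using theI'[OF E1[OF that]] by (auto simp: H_def)
  have H_eq: "H c = d" if "c \<in> C" "d \<in> D" "E c d" for c d
    using E1[OF that(1)] H[OF that(1)] that by blast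
  have "inj_on H C"
  proof (rule inj_onI)
    fix x y assume xy: "x \<in> C" "y \<in> C" "H x = H y"
    then have "E x (H x)" "E y (H x)" using H(2)[of x] H(2)[of y] by auto
    then show "x = y" using E2[OF H(1)[OF xy(1)]] xy by blast
  qed
  moreover have "H ` C = D"
  proof
    show "H ` C \<subseteq> D" using H by blast
    show "D \<subseteq> H ` C"
    proof
      fix d assume d: "d \<in> D"
      then obtain c where "c \<in> C" "E c d" using E2[OF d] by blast
      then show "d \<in> H ` C" using H_eq d by (metis imageI)
    qed
  qed
  ultimately have bij: "bij_betw H C D" by (simp add: bij_betw_def)
  have ex: "\<forall>z. \<exists>p. fst z \<in> C \<longrightarrow> p \<in> R (snd z) \<and> fst z \<in> fst p \<and> (\<forall>p'\<in>R (snd z). fst z \<in> fst p' \<longrightarrow> p' = p)"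
    using matching_cell[OF m] by blast
  obtain pp where pp: "\<forall>z. fst z \<in> C \<longrightarrow> pp z \<in> R (snd z) \<and> fst z \<in> fst (pp z) \<and> (\<forall>p'\<in>R (snd z). fst z \<in> fst p' \<longrightarrow> p' = pp z)"
    using choice[OF ex] by (elim exE)
  define P where "P = (\<lambda>n c. pp (c, n))"
  have P: "P n c \<in> R n" "c \<in> fst (P n c)" if "c \<in> C" for n c
    using pp that by (auto simp: P_def)
  have P_eq: "p = P n c" if "c \<in> C" "p \<in> R n" "c \<in> fst p" for n c p
    using spec[OF pp, of "(c, n)"] that by (simp add: P_def)
  have PH: "H c \<in> snd (P n c)" if c: "c \<in> C" for n c
  proof -
    obtain p where p: "p \<in> R n" "c \<in> fst p" "H c \<in> snd p" using H(2)[OF c] unfolding E_def by blast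
    then show ?thesis using P_eq[OF c] by simp
  qed
  have contH: "continuous_on C H"
  proof (rule continuous_on_compact_closed_graph[OF cD(1)])
    show "H x \<in> D" if "x \<in> C" for x using H that by blast
    fix s x y assume s: "\<And>n::nat. s n \<in> C" "x \<in> C" "s \<longlonglongrightarrow> x" "(\<lambda>n. H (s n)) \<longlonglongrightarrow> y"
    have "closed D" using cD compact_imp_closed by blast
    then have y: "y \<in> D" using s(4) H(1) s(1) by (metis closed_sequentially)
    have "y \<in> snd (P n x)" for n
    proof -
      have cl: "clopen_in C (fst (P n x))" "clopen_in D (snd (P n x))"
        using matching_clopen[OF m P(1)[OF s(2)]] by auto
      obtain e where e: "e > 0" "\<And>z. z \<in> C \<Longrightarrow> dist z x < e \<Longrightarrow> z \<in> fst (P n x)"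
        using clopen_in_near[OF cl(1) P(2)[OF s(2)]] by metis
      have "eventually (\<lambda>k. dist (s k) x < e) sequentially" using s(3) e(1) by (rule tendstoD)
      then have "eventually (\<lambda>k. H (s k) \<in> snd (P n x)) sequentially"
      proof eventually_elim
        case (elim k)
        then have "P n x = P n (s k)" using P_eq[OF s(1) P(1)[OF s(2)]] e(2) s(1) by blast
        then show ?case using PH[OF s(1)] by simp
      qed
      moreover have "closed (snd (P n x))" using cl(2) cD clopen_in_compact compact_imp_closed by blast
      ultimately show ?thesis using s(4) Lim_in_closed_set trivial_limit_sequentially by metis
    qed
    then have "E x y" unfolding E_def using P[OF s(2)] by blast
    then show "y = H x" using H_eq s(2) y by simp
  qed
  define a where "a = (\<lambda>n c. log_ratio \<phi> \<psi> (P n c))"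
  have a_step: "\<bar>a (Suc n) c - a n c\<bar> \<le> (1/2)^n" if c: "c \<in> C" for n c
  proof -
    obtain p where p: "p \<in> R n" "fst (P (Suc n) c) \<subseteq> fst p"
      "\<bar>log_ratio \<phi> \<psi> (P (Suc n) c) - log_ratio \<phi> \<psi> p\<bar> \<le> (1/2)^n"
      using ref[OF P(1)[OF c]] by blast
    then have "p = P n c" using P_eq[OF c] P(2)[OF c] by blast
    then show ?thesis using p(3) by (simp add: a_def)
  qed
  have a_cont: "continuous_on C (a n)" for n
    unfolding continuous_on_iff
  proof (intro ballI allI impI)
    fix x and e :: real assume x: "x \<in> C" "0 < e"
    obtain d where d: "d > 0" "\<And>z. z \<in> C \<Longrightarrow> dist z x < d \<Longrightarrow> z \<in> fst (P n x)"
      using clopen_in_near[OF matching_clopen(1)[OF m P(1)[OF x(1)]] P(2)[OF x(1)]] by metis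
    have "dist (a n z) (a n x) < e" if "z \<in> C" "dist z x < d" for z
      using P_eq[OF that(1) P(1)[OF x(1)] d(2)[OF that]] x(2) by (simp add: a_def)
    then show "\<exists>d>0. \<forall>x'\<in>C. dist x' x < d \<longrightarrow> dist (a n x') (a n x) < e" using d(1) by blast
  qed
  define b where "b = (\<lambda>c. \<Sum>i. a (Suc i) c - a i c)"
  have ul: "uniform_limit C (\<lambda>n c. \<Sum>i<n. a (Suc i) c - a i c) b sequentially"
    unfolding b_def
  proof (rule Weierstrass_m_test)
    show "summable (\<lambda>n. (1/2::real)^n)" by (intro summable_geometric) auto
  qed (use a_step in auto)
  have b_cont: "continuous_on C b"
  proof (rule uniform_limit_theorem[OF _ ul])
    show "\<forall>\<^sub>F n in sequentially. continuous_on C (\<lambda>c. \<Sum>i<n. a (Suc i) c - a i c)"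
      using a_cont by (intro always_eventually allI continuous_intros)
  qed auto
  have a_lim: "(\<lambda>n. a n c) \<longlonglongrightarrow> a 0 c + b c" if c: "c \<in> C" for c
  proof -
    have "(\<lambda>n. \<Sum>i<n. a (Suc i) c - a i c) \<longlonglongrightarrow> b c"
      using tendsto_uniform_limitI[OF ul c] .
    moreover have "(\<Sum>i<n. a (Suc i) c - a i c) = a n c - a 0 c" for n
      by (rule sum_lessThan_telescope)
    ultimately have "(\<lambda>n. a n c - a 0 c) \<longlonglongrightarrow> b c" by simp
    from tendsto_add[OF this tendsto_const[of "a 0 c"]] show ?thesis by (simp add: add.commute)
  qed
  define \<alpha> where "\<alpha> = (\<lambda>c. exp (a 0 c + b c))"
  have "continuous_on C \<alpha>" unfolding \<alpha>_def using a_cont b_cont by (intro continuous_intros)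
  moreover have "\<psi> (H c) = \<alpha> c * \<phi> c" if c: "c \<in> C" for c
  proof -
    have l1: "(\<lambda>n. peak \<phi> (fst (P n c))) \<longlonglongrightarrow> \<phi> c"
    proof (rule peak_tendsto[OF LC c])
      show "clopen_in C (fst (P n c))" for n using matching_clopen[OF m P(1)[OF c]] by blast
    qed (use P[OF c] mesh1[OF P(1)[OF c]] in blast)+
    have l2: "(\<lambda>n. peak \<psi> (snd (P n c))) \<longlonglongrightarrow> \<psi> (H c)"
    proof (rule peak_tendsto[OF LD H(1)[OF c]])
      show "clopen_in D (snd (P n c))" for n using matching_clopen[OF m P(1)[OF c]] by blast
    qed (use PH[OF c] mesh2[OF P(1)[OF c]] in blast)+
    have "peak \<psi> (snd (P n c)) = exp (a n c) * peak \<phi> (fst (P n c))" for n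
    proof -
      have "0 < peak \<phi> (fst (P n c))" "0 < peak \<psi> (snd (P n c))"
        using matching_clopen[OF m P(1)[OF c]] peak_pos LC LD by blast+
      then show ?thesis by (simp add: a_def log_ratio_def exp_diff)
    qed
    then have "(\<lambda>n. peak \<psi> (snd (P n c))) \<longlonglongrightarrow> \<alpha> c * \<phi> c"
      unfolding \<alpha>_def using tendsto_mult[OF tendsto_exp[OF a_lim[OF c]] l1] by simp
    then show ?thesis using l2 LIMSEQ_unique by blast
  qed
  moreover have "0 < \<alpha> c" for c by (simp add: \<alpha>_def)
  ultimately show ?thesis using that[OF contH bij] by blast
qed

section \<open>A mixing map on the hypograph of a Lelek function\<close>

lemma sqrt_2_irrational: "sqrt 2 \<notin> \<rat>"
proof
  assume "sqrt 2 \<in> \<rat>"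
  then obtain m n :: nat where mn: "n \<noteq> 0" "\<bar>sqrt 2\<bar> = m / n" "coprime m n"
    by (rule Rats_abs_nat_div_natE)
  then have "real m = sqrt 2 * real n" by (simp add: field_simps)
  then have "(real m)\<^sup>2 = 2 * (real n)\<^sup>2" by (simp add: power_mult_distrib)
  then have eq: "m\<^sup>2 = 2 * n\<^sup>2" by (metis of_nat_eq_iff of_nat_mult of_nat_numeral of_nat_power)
  then have "even m" by (metis dvd_triv_left even_power zero_less_numeral)
  then obtain k where "m = 2 * k" by blast
  then have "n\<^sup>2 = 2 * k\<^sup>2" using eq by (simp add: power2_eq_square)
  then have "even n" by (metis dvd_triv_left even_power zero_less_numeral)
  then show False using \<open>even m\<close> mn(3) by (metis coprime_common_divisor odd_one)
qed

text \<open>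
  The admissible logarithmic factors. With \<open>-1\<close> and \<open>sqrt 2\<close> every real number is approximated, the step
  \<open>0\<close> makes words of every large length available, and \<open>1\<close> spares a case distinction about signs in
  the approximation.
\<close>

definition steps :: "real set" where
  "steps = {-1, 0, 1, sqrt 2}"

lemma finite_steps: "finite steps"
  by (simp add: steps_def)

lemma steps_le: "x \<in> steps \<Longrightarrow> x \<le> sqrt 2"
  by (auto simp: steps_def intro: order_trans[of "-1" 0])

text \<open>
  The sum of the steps from time \<open>0\<close> to time \<open>i\<close>; for negative \<open>i\<close> the steps are undone.
\<close>

definition height :: "(int \<Rightarrow> real) \<Rightarrow> int \<Rightarrow> real" where
  "height c i = (if 0 \<le> i then \<Sum>j\<in>{0..<i}. c j else - (\<Sum>j\<in>{i..<0}. c j))"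

lemma height_0 [simp]: "height c 0 = 0"
  by (simp add: height_def)

lemma height_step: "height c (i + 1) = height c i + c i"
proof (cases "0 \<le> i")
  case True
  then have "{0..<i + 1} = insert i {0..<i}" by auto
  then show ?thesis using True by (simp add: height_def)
next
  case False
  then have "{i..<0} = insert i {i + 1..<0}" by auto
  then have "(\<Sum>j\<in>{i..<0}. c j) = c i + (\<Sum>j\<in>{i + 1..<0}. c j)" by simp
  then show ?thesis using False by (auto simp: height_def)
qed

lemma height_unique:
  assumes "\<And>i. z (i + 1) = z i + c i"
  shows "z i = z 0 + height c i"
proof (induction i rule: int_induct[where k = 0])
  case base
  show ?case by simp
next
  case (step1 i)
  then show ?case using assms[of i] height_step[of c i] by simp
next
  case (step2 i)
  then show ?case using assms[of "i - 1"] height_step[of c "i - 1"] by simp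
qed

lemma height_shift: "height (\<lambda>i. c (i + k)) i = height c (i + k) - height c k"
proof -
  have "height c (i + 1 + k) = height c (i + k) + c (i + k)" for i
    using height_step[of c "i + k"] by (simp add: algebra_simps)
  from height_unique[of "\<lambda>i. height c (i + k)", OF this] show ?thesis by simp
qed

lemma height_cong:
  assumes "\<And>j. 0 \<le> j \<and> j < i \<or> i \<le> j \<and> j < 0 \<Longrightarrow> c j = c' j"
  shows "height c i = height c' i"
  unfolding height_def using assms by (auto intro!: sum.cong)

lemma continuous_on_height: "continuous_on UNIV (\<lambda>c. height c i)"
proof (cases "0 \<le> i")
  case True
  then show ?thesis unfolding height_def by (auto intro!: continuous_intros)
next
  case False
  then show ?thesis unfolding height_def by (auto intro!: continuous_intros)
qed

text \<open>
  For \<open>Z = {}\<close> these are all two-sided sequences. For \<open>Z = {..<0}\<close> the past is frozen, which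
  represents one-sided sequences within the same type.
\<close>

definition codes :: "int set \<Rightarrow> (int \<Rightarrow> real) set" where
  "codes Z = {c. \<forall>i. c i \<in> steps \<and> (i \<in> Z \<longrightarrow> c i = sqrt 2)}"

text \<open>
  The largest initial value \<open>t\<close> for which all \<open>t * exp (height c i)\<close> stay at most \<open>1\<close>. It can be \<open>0\<close>.
\<close>

definition roof :: "(int \<Rightarrow> real) \<Rightarrow> real" where
  "roof c = (INF i. exp (- height c i))"

lemma le_roof_iff: "t \<le> roof c \<longleftrightarrow> (\<forall>i. t \<le> exp (- height c i))"
proof -
  have "bdd_below (range (\<lambda>i. exp (- height c i)))" by (rule bdd_belowI[of _ 0]) auto
  then show ?thesis unfolding roof_def by (subst le_cINF_iff) auto
qed

lemma le_roof_iff_ln: "0 < t \<Longrightarrow> t \<le> roof c \<longleftrightarrow> (\<forall>i. ln t + height c i \<le> 0)"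
proof -
  assume t: "0 < t"
  have "t \<le> exp (- h) \<longleftrightarrow> ln t + h \<le> 0" for h
    using t by (subst ln_le_cancel_iff[symmetric]) auto
  then show ?thesis by (simp add: le_roof_iff)
qed

lemma roof_le: "roof c \<le> exp (- height c i)"
  using le_roof_iff by blast

lemma roof_nonneg: "0 \<le> roof c"
  by (simp add: le_roof_iff)

lemma compact_codes: "compact (codes Z)"
proof -
  have "codes Z = {c. \<forall>i. c i \<in> (if i \<in> Z then {sqrt 2} else steps)}"
    by (auto simp: codes_def steps_def)
  then show ?thesis using finite_steps by (simp add: compact_finite_products)
qed

lemma compact_hypograph_codes: "compact (hypograph (codes Z) roof)"
proof -
  have "hypograph (codes Z) roof = (codes Z \<times> {0..1}) \<inter> (\<Inter>i. {p. snd p \<le> exp (- height (fst p) i)})"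
  proof
    show "hypograph (codes Z) roof \<subseteq> (codes Z \<times> {0..1}) \<inter> (\<Inter>i. {p. snd p \<le> exp (- height (fst p) i)})"
    proof
      fix p assume "p \<in> hypograph (codes Z) roof"
      then have p: "fst p \<in> codes Z" "0 \<le> snd p" "\<forall>i. snd p \<le> exp (- height (fst p) i)"
        by (auto simp: hypograph_def le_roof_iff)
      then have "snd p \<le> 1" using p(3) by (metis height_0 exp_zero minus_zero)
      then show "p \<in> (codes Z \<times> {0..1}) \<inter> (\<Inter>i. {p. snd p \<le> exp (- height (fst p) i)})"
        using p by (cases p) auto
    qed
  qed (auto simp: hypograph_def le_roof_iff)
  moreover have "closed {p::(int \<Rightarrow> real) \<times> real. snd p \<le> exp (- height (fst p) i)}" for i
    by (intro closed_Collect_le continuous_intros continuous_on_compose2[OF continuous_on_height]) auto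
  ultimately show ?thesis
    using compact_Times[OF compact_codes compact_Icc] by (auto intro!: compact_Int_closed closed_INT)
qed

lemma codes_near:
  fixes e :: real
  assumes "e > 0"
  obtains m :: int where "0 \<le> m" "\<And>c c'::int \<Rightarrow> real. (\<And>i. - m \<le> i \<Longrightarrow> i \<le> m \<Longrightarrow> c i = c' i) \<Longrightarrow> dist c c' < e"
proof -
  obtain N where N: "(1/2::real)^N < e" using assms real_arch_pow_inv[of e "1/2"] by auto
  define m where "m = Max ((\<lambda>n. \<bar>from_nat n :: int\<bar>) ` {..N})"
  have m: "\<bar>from_nat n :: int\<bar> \<le> m" if "n \<le> N" for n
    unfolding m_def using that by (intro Max_ge) auto
  show ?thesis
  proof (rule that[of m])
    show "0 \<le> m" using m[of 0] by linarith
    fix c c' :: "int \<Rightarrow> real" assume eq: "\<And>i. - m \<le> i \<Longrightarrow> i \<le> m \<Longrightarrow> c i = c' i"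
    have "c (from_nat n) = c' (from_nat n)" if "n \<le> N" for n
      using eq m[OF that] by (simp add: abs_le_iff)
    then have "{dist (c (from_nat n)) (c' (from_nat n)) |n. n \<le> N} = (\<lambda>n. 0) ` {..N}" by force
    then have "{dist (c (from_nat n)) (c' (from_nat n)) |n. n \<le> N} = {0}" by auto
    then have "dist c c' \<le> (1/2)^N"
      using dist_fun_le_dist_first_terms[of c c' N] by simp
    then show "dist c c' < e" using N by simp
  qed
qed

text \<open>
  A word \<open>u\<close> at position \<open>p\<close>, extended by the largest step on the left and by \<open>-1\<close> on the right. Away from the
  word the heights therefore fall in both directions, and only the heights along the word need attention.
\<close>

definition glue :: "int \<Rightarrow> real list \<Rightarrow> int \<Rightarrow> real" where
  "glue p u i = (if i < p then sqrt 2 else if i < p + int (length u) then u ! nat (i - p) else -1)"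

lemma heights_glue_word:
  assumes z: "\<And>i. z (i + 1) = z i + glue p u i" and k: "k \<le> length u"
  shows "z (p + int k) = z p + sum_list (take k u)"
  using k
proof (induction k)
  case 0
  show ?case by simp
next
  case (Suc k)
  have "z (p + int (Suc k)) = z (p + int k + 1)" by (simp add: algebra_simps)
  also have "\<dots> = z p + sum_list (take k u) + u ! k"
    using z Suc by (simp add: glue_def)
  also have "\<dots> = z p + sum_list (take (Suc k) u)"
    using Suc.prems by (simp add: take_Suc_conv_app_nth)
  finally show ?case .
qed

lemma heights_glue_nonpos:
  assumes z: "\<And>i. z (i + 1) = z i + glue p u i"
    and word: "\<And>k. k \<le> length u \<Longrightarrow> z p + sum_list (take k u) \<le> 0"
  shows "z i \<le> 0"
proof -
  have left: "z (p - int n) \<le> 0" for n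
  proof (induction n)
    case 0
    show ?case using word[of 0] by simp
  next
    case (Suc n)
    have "z (p - int n) = z (p - int (Suc n)) + sqrt 2"
      using z[of "p - int (Suc n)"] by (simp add: glue_def algebra_simps)
    moreover have "0 \<le> sqrt (2::real)" by simp
    ultimately show ?case using Suc by linarith
  qed
  have right: "z (p + int (length u) + int n) \<le> 0" for n
  proof (induction n)
    case 0
    show ?case using heights_glue_word[OF z, where k = "length u"] word[of "length u"] by simp
  next
    case (Suc n)
    have "z (p + int (length u) + int (Suc n)) = z (p + int (length u) + int n) - 1"
      using z[of "p + int (length u) + int n"] by (simp add: glue_def algebra_simps)
    then show ?case using Suc by linarith
  qed
  consider "i < p" | "p \<le> i" "i \<le> p + int (length u)" | "p + int (length u) < i" by linarith
  then show ?thesis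
  proof cases
    case 1
    then show ?thesis using left[of "nat (p - i)"] by simp
  next
    case 2
    then have "nat (i - p) \<le> length u" by simp
    then show ?thesis using heights_glue_word[OF z, of "nat (i - p)"] word[of "nat (i - p)"] 2 by simp
  next
    case 3
    then show ?thesis using right[of "nat (i - p - int (length u))"] by simp
  qed
qed

text \<open>
  Kronecker's theorem provides multiples of \<open>sqrt 2\<close> and \<open>1\<close> whose difference is close to the required change of height.
  Taking the downward steps first, the heights along the word never exceed the larger one of
  its initial and final heights. Trailing zeros give every larger length.
\<close>

lemma exists_word:
  assumes a: "a \<le> 0" and xy: "x < y" "y \<le> (0::real)"
  obtains N0 where "\<And>N. N0 \<le> N \<Longrightarrow> \<exists>w. length w = N \<and> set w \<subseteq> steps \<and>
    (\<forall>k\<le>N. a + sum_list (take k w) \<le> 0) \<and> x < a + sum_list w \<and> a + sum_list w < y"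
proof -
  have "0 < (y - x)/2" using xy by simp
  then obtain h k :: int where k: "k > 0" and hk: "\<bar>of_int k * sqrt 2 - of_int h - ((x + y)/2 - a)\<bar> < (y - x)/2"
    by (rule sequence_of_fractional_parts_is_dense[OF sqrt_2_irrational])
  define v where "v = (\<lambda>r. replicate (nat k) (sqrt 2) @ replicate (nat (- h)) 1 @ replicate r (0::real))"
  define w where "w = (\<lambda>r. replicate (nat h) (-1) @ v r)"
  have sv: "sum_list (w r) = of_int k * sqrt 2 - of_int h" for r
    using k by (cases "0 \<le> h") (auto simp: w_def v_def sum_list_replicate)
  have vpos: "0 \<le> sum_list (drop j (v r))" for j r
    by (intro sum_list_nonneg) (auto simp: v_def dest!: in_set_dropD)
  have pre: "sum_list (take j (w r)) \<le> max 0 (sum_list (w r))" for j r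
  proof (cases "j \<le> nat h")
    case True
    then have "sum_list (take j (w r)) = - real j" by (simp add: w_def sum_list_replicate min_def)
    then show ?thesis by simp
  next
    case False
    have "sum_list (w r) = sum_list (take j (w r)) + sum_list (drop j (w r))"
      by (metis append_take_drop_id sum_list_append)
    moreover have "drop j (w r) = drop (j - nat h) (v r)" using False by (simp add: w_def)
    ultimately show ?thesis using vpos[of "j - nat h" r] by simp
  qed
  have tot: "x < a + sum_list (w r)" "a + sum_list (w r) < y" for r
    using hk unfolding sv by (auto simp: abs_less_iff field_simps)
  show ?thesis
  proof (rule that[of "nat h + nat k + nat (- h)"])
    fix N assume N: "nat h + nat k + nat (- h) \<le> N"
    let ?w = "w (N - (nat h + nat k + nat (- h)))"
    have "length ?w = N" using N by (simp add: w_def v_def)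
    moreover have "set ?w \<subseteq> steps" by (auto simp: w_def v_def steps_def)
    moreover have "a + sum_list (take j ?w) \<le> 0" for j
      using pre[of j "N - (nat h + nat k + nat (- h))"] a tot(2) xy(2) by (smt (verit))
    ultimately show "\<exists>w. length w = N \<and> set w \<subseteq> steps \<and>
      (\<forall>k\<le>N. a + sum_list (take k w) \<le> 0) \<and> x < a + sum_list w \<and> a + sum_list w < y"
      using tot by blast
  qed
qed

definition window :: "int \<Rightarrow> (int \<Rightarrow> real) \<Rightarrow> real list" where
  "window m c = map c [- m..m]"

lemma length_window: "0 \<le> m \<Longrightarrow> length (window m c) = nat (2 * m + 1)"
  by (simp add: window_def)

lemma window_nth: "0 \<le> m \<Longrightarrow> int j \<le> 2 * m \<Longrightarrow> window m c ! j = c (int j - m)"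
  by (simp add: window_def nth_upto)

lemma sum_take_window:
  assumes m: "0 \<le> m" and k: "int k \<le> 2 * m + 1"
  shows "sum_list (take k (window m c)) = height c (int k - m) - height c (- m)"
  using k
proof (induction k)
  case 0
  show ?case by simp
next
  case (Suc k)
  have "sum_list (take (Suc k) (window m c)) = sum_list (take k (window m c)) + c (int k - m)"
    using Suc.prems m by (subst take_Suc_conv_app_nth) (auto simp: length_window window_nth)
  also have "\<dots> = height c (int k - m + 1) - height c (- m)"
    using Suc height_step[of c "int k - m"] by simp
  finally show ?case by (simp add: algebra_simps)
qed

lemma sum_window: "0 \<le> m \<Longrightarrow> sum_list (window m c) = height c (m + 1) - height c (- m)"
  using sum_take_window[of m "nat (2 * m + 1)" c] length_window[of m c] by simp

lemma glue_window:
  assumes "0 \<le> m" "- m \<le> i" "i \<le> m"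
  shows "glue (- m) (window m c @ u) i = c i"
  using assms by (simp add: glue_def length_window nth_append window_nth)

lemma glue_in_codes:
  assumes Z: "Z \<subseteq> {..<0}" and c: "c \<in> codes Z" and m: "0 \<le> m" and u: "set u \<subseteq> steps"
  shows "glue (- m) (window m c @ u) \<in> codes Z"
proof -
  have "set (window m c @ u) \<subseteq> steps"
    using c u by (auto simp: window_def codes_def)
  then have "(window m c @ u) ! j \<in> steps" if "j < length (window m c @ u)" for j
    using that nth_mem by blast
  moreover have "sqrt 2 \<in> steps" "-1 \<in> steps" by (auto simp: steps_def)
  ultimately have "glue (- m) (window m c @ u) i \<in> steps" for i
    unfolding glue_def by (auto simp del: length_append)
  moreover have "glue (- m) (window m c @ u) i = sqrt 2" if "i \<in> Z" for i
  proof (cases "i < - m")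
    case True
    then show ?thesis by (simp add: glue_def)
  next
    case False
    then have "glue (- m) (window m c @ u) i = c i"
      using that Z m by (intro glue_window) auto
    then show ?thesis using c that by (simp add: codes_def)
  qed
  ultimately show ?thesis by (simp add: codes_def)
qed

lemma heights_splice:
  assumes m: "0 \<le> m" and low: "\<And>i. - m \<le> i \<Longrightarrow> i \<le> m + 1 \<Longrightarrow> h + height c i \<le> 0"
    and word: "\<And>k. k \<le> length u \<Longrightarrow> h + height c (m + 1) + sum_list (take k u) \<le> 0"
  defines "c' \<equiv> glue (- m) (window m c @ u)"
  shows "h + height c' i \<le> 0"
    and "k \<le> length u \<Longrightarrow> h + height c' (m + 1 + int k) = h + height c (m + 1) + sum_list (take k u)"
proof -
  define z where "z = (\<lambda>i. h + height c' i)"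
  have z: "z (i + 1) = z i + glue (- m) (window m c @ u) i" for i
    by (simp add: z_def height_step c'_def)
  have "height c' (- m) = height c (- m)"
    unfolding c'_def using m by (intro height_cong glue_window) auto
  then have z0: "z (- m) = h + height c (- m)" by (simp add: z_def)
  have len: "length (window m c) = nat (2 * m + 1)" using length_window m by simp
  have "z (- m) + sum_list (take k (window m c @ u)) \<le> 0" if k: "k \<le> length (window m c @ u)" for k
  proof (cases "k \<le> length (window m c)")
    case True
    then have k': "int k \<le> 2 * m + 1" using len m by simp
    then have "z (- m) + sum_list (take k (window m c @ u)) = h + height c (int k - m)"
      using True z0 sum_take_window[OF m k', of c] by simp
    then show ?thesis using low[of "int k - m"] k' by simp
  next
    case False
    then show ?thesis
      using word[of "k - length (window m c)"] k z0 sum_window[OF m, of c] by (simp add: add.assoc)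
  qed
  from heights_glue_nonpos[OF z this] show "h + height c' i \<le> 0" by (simp add: z_def)
  show "h + height c' (m + 1 + int k) = h + height c (m + 1) + sum_list (take k u)" if k: "k \<le> length u"
  proof -
    have "z (- m + int (length (window m c) + k)) = z (- m) + sum_list (take (length (window m c) + k) (window m c @ u))"
      using k by (intro heights_glue_word[OF z]) simp
    moreover have "- m + int (length (window m c) + k) = m + 1 + int k" using len m by simp
    ultimately show ?thesis using z0 sum_window[OF m, of c] by (simp add: z_def add.assoc)
  qed
qed

text \<open>
  The roof of \<open>c\<close> may be \<open>0\<close>, in which case no positive initial value is admissible. But only finitely many heights
  matter if \<open>c\<close> is going to be changed outside a window, and these admit a small positive value.
\<close>

lemma positive_level:
  assumes t: "0 \<le> t" "t \<le> roof c" and e: "0 < e"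
  obtains t' where "0 < t'" "\<bar>t' - t\<bar> < e" "\<And>i. i \<in> {- m..m + 1} \<Longrightarrow> ln t' + height c i \<le> 0"
proof (cases "t = 0")
  case False
  then show ?thesis using that[of t] le_roof_iff_ln t e by auto
next
  case True
  define B where "B = (\<Sum>i\<in>{- m..m + 1}. \<bar>height c i\<bar>)"
  have B: "height c i \<le> B" if "i \<in> {- m..m + 1}" for i
  proof -
    have "\<bar>height c i\<bar> \<le> B" unfolding B_def using that by (intro member_le_sum) auto
    then show ?thesis by simp
  qed
  define t' where "t' = min (e/2) (exp (- B))"
  have t': "0 < t'" "\<bar>t' - t\<bar> < e" using e True by (auto simp: t'_def)
  have "t' \<le> exp (- B)" by (simp add: t'_def)
  then have "ln t' \<le> - B" using t'(1) ln_le_cancel_iff[of t' "exp (- B)"] by simp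
  then show ?thesis using that[OF t'] B by fastforce
qed

text \<open>
  For the density of the tips, keep \<open>c\<close> on a large window, then climb with a word to a height just below
  \<open>0\<close>, and descend for ever. The orbit of \<open>t\<close> comes close to \<open>1\<close> but stays below, which means that the roof of
  the new code is close to \<open>t\<close>.
\<close>

lemma lelek_function_codes:
  assumes Z: "Z \<subseteq> {..<0}"
  shows "lelek_function (codes Z) roof"
  unfolding lelek_function_def
proof (intro conjI ballI allI impI)
  show "compact (codes Z)" by (rule compact_codes)
  have "(\<lambda>i. sqrt 2) \<in> codes Z" by (simp add: codes_def steps_def)
  then show "codes Z \<noteq> {}" by blast
  show "totally_disconnected (codes Z)"
    using finite_steps by (intro totally_disconnected_finite_products[of "\<lambda>_. steps"]) (auto simp: codes_def)
  show "0 \<le> roof c" for c by (rule roof_nonneg)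
  show "compact (hypograph (codes Z) roof)" by (rule compact_hypograph_codes)
  fix c :: "int \<Rightarrow> real" and t e :: real
  assume c: "c \<in> codes Z" and te: "0 \<le> t \<and> t \<le> roof c \<and> 0 < e"
  then have te: "0 \<le> t" "t \<le> roof c" "0 < e" by auto
  obtain m where m: "0 \<le> m" "\<And>c c'::int \<Rightarrow> real. (\<And>i. - m \<le> i \<Longrightarrow> i \<le> m \<Longrightarrow> c i = c' i) \<Longrightarrow> dist c c' < e"
    using codes_near[OF te(3)] by metis
  have "0 < e/2" using te by simp
  then obtain t' where t': "0 < t'" "\<bar>t' - t\<bar> < e/2" "\<And>i. i \<in> {- m..m + 1} \<Longrightarrow> ln t' + height c i \<le> 0"
    using positive_level[OF te(1,2)] by metis
  define \<eta> where "\<eta> = ln (1 + e / (2 * t'))"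
  have "0 < e / (2 * t')" using te(3) t'(1) by simp
  then have \<eta>: "0 < \<eta>" unfolding \<eta>_def by (intro ln_gt_zero) simp
  have t'\<eta>: "t' * exp \<eta> = t' + e/2" using te t'(1) by (simp add: \<eta>_def field_simps add_pos_pos)
  have "ln t' + height c (m + 1) \<le> 0" using t'(3) m(1) by simp
  moreover have "- \<eta> < 0" using \<eta> by simp
  ultimately obtain N where "\<And>n. N \<le> n \<Longrightarrow> \<exists>w. length w = n \<and> set w \<subseteq> steps \<and>
    (\<forall>k\<le>n. ln t' + height c (m + 1) + sum_list (take k w) \<le> 0) \<and>
    - \<eta> < ln t' + height c (m + 1) + sum_list w \<and> ln t' + height c (m + 1) + sum_list w < 0"
    using exists_word[of "ln t' + height c (m + 1)" "- \<eta>" 0] by (metis order_refl)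
  from this[OF order_refl] obtain w where w: "length w = N" "set w \<subseteq> steps"
    "\<And>k. k \<le> N \<Longrightarrow> ln t' + height c (m + 1) + sum_list (take k w) \<le> 0"
    "- \<eta> < ln t' + height c (m + 1) + sum_list w" by metis
  define c' where "c' = glue (- m) (window m c @ w)"
  have c': "c' \<in> codes Z" unfolding c'_def by (rule glue_in_codes[OF Z c m(1) w(2)])
  have low: "ln t' + height c i \<le> 0" if "- m \<le> i" "i \<le> m + 1" for i using t'(3) that by auto
  have wd: "ln t' + height c (m + 1) + sum_list (take k w) \<le> 0" if "k \<le> length w" for k
    using w(1,3) that by simp
  have "ln t' + height c' i \<le> 0" for i
    unfolding c'_def by (rule heights_splice(1)[OF m(1) low wd])
  then have lo: "t' \<le> roof c'" using le_roof_iff_ln[OF t'(1)] by simp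
  have "ln t' + height c' (m + 1 + int N) > - \<eta>"
    unfolding c'_def using heights_splice(2)[OF m(1) low wd, of N] w(1,4) by simp
  then have "exp (- height c' (m + 1 + int N)) < exp (ln t' + \<eta>)" by simp
  also have "\<dots> = t' + e/2" using t'(1) t'\<eta> by (simp add: exp_add)
  finally have "roof c' < t' + e/2"
    using roof_le[of c' "m + 1 + int N"] by simp
  then have "\<bar>roof c' - t\<bar> < e" "0 < roof c'" using lo t'(1,2) by linarith+
  moreover have "dist c' c < e"
    by (rule m(2)) (simp add: c'_def glue_window[OF m(1)])
  ultimately show "\<exists>c'\<in>codes Z. dist c' c < e \<and> 0 < roof c' \<and> \<bar>roof c' - t\<bar> < e"
    using c' by blast
qed

definition reset :: "int set \<Rightarrow> (int \<Rightarrow> real) \<Rightarrow> int \<Rightarrow> real" where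
  "reset Z c i = (if i \<in> Z then sqrt 2 else c i)"

text \<open>
  A skew product over the shift. For \<open>Z = {}\<close> it is invertible; for \<open>Z = {..<0}\<close> it forgets the step that it
  moves into the past.
\<close>

definition step_map :: "int set \<Rightarrow> (int \<Rightarrow> real) \<times> real \<Rightarrow> (int \<Rightarrow> real) \<times> real" where
  "step_map Z p = (reset Z (\<lambda>i. fst p (i + 1)), snd p * exp (fst p 0))"

text \<open>
  In the past the heights are the negatives of sums of steps, so enlarging the steps there lowers them. This
  is the reason for freezing the past at the largest step: resetting never leaves the hypograph.
\<close>

lemma height_reset_le:
  assumes Z: "Z \<subseteq> {..<0}" and c: "\<And>i. c i \<in> steps"
  shows "height (reset Z c) i \<le> height c i"
proof (cases "0 \<le> i")
  case True
  then have "height (reset Z c) i = height c i"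
    using Z by (intro height_cong) (auto simp: reset_def)
  then show ?thesis by simp
next
  case False
  have "(\<Sum>j\<in>{i..<0}. c j) \<le> (\<Sum>j\<in>{i..<0}. reset Z c j)"
    using c steps_le by (intro sum_mono) (auto simp: reset_def)
  then show ?thesis using False by (simp add: height_def)
qed

lemma step_map_in_hypograph:
  assumes Z: "Z \<subseteq> {..<0}" and p: "p \<in> hypograph (codes Z) roof"
  shows "step_map Z p \<in> hypograph (codes Z) roof"
proof -
  obtain c t where ct: "p = (c, t)" "c \<in> codes Z" "0 \<le> t" "t \<le> roof c"
    using p by (cases p) auto
  have c: "c i \<in> steps" for i using ct by (simp add: codes_def)
  have "reset Z (\<lambda>i. c (i + 1)) \<in> codes Z"
    using c by (auto simp: codes_def reset_def steps_def)
  moreover have "t * exp (c 0) \<le> exp (- height (reset Z (\<lambda>i. c (i + 1))) i)" for i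
  proof -
    have h1: "height c 1 = c 0" using height_step[of c 0] by simp
    have "t * exp (c 0) \<le> exp (- height c (i + 1)) * exp (c 0)"
      using ct(4) le_roof_iff by (intro mult_right_mono) auto
    also have "\<dots> = exp (- height (\<lambda>i. c (i + 1)) i)"
      using height_shift[of c 1 i] h1 by (simp add: exp_add[symmetric])
    also have "\<dots> \<le> exp (- height (reset Z (\<lambda>i. c (i + 1))) i)"
      using height_reset_le[OF Z, of "\<lambda>i. c (i + 1)" i] c by simp
    finally show ?thesis .
  qed
  ultimately show ?thesis using ct by (simp add: step_map_def le_roof_iff)
qed

lemma continuous_on_step_map: "continuous_on A (step_map Z)"
  unfolding step_map_def
proof (intro continuous_intros)
  have coord: "continuous_on A (\<lambda>p::(int \<Rightarrow> real) \<times> real. fst p i)" for i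
    by (rule continuous_on_compose2[OF continuous_on_product_coordinates[of i]]) (auto intro: continuous_intros)
  show "continuous_on A (\<lambda>p. reset Z (\<lambda>i. fst p (i + 1)) i)" for i
    unfolding reset_def using coord by (cases "i \<in> Z") auto
  show "continuous_on A (\<lambda>p::(int \<Rightarrow> real) \<times> real. fst p 0)" by (rule coord)
qed

lemma step_map_funpow:
  assumes Z: "Z \<subseteq> {..<0}" "\<And>i. i \<notin> Z \<Longrightarrow> i + 1 \<notin> Z" and c: "c \<in> codes Z"
  shows "(step_map Z ^^ n) (c, t) = (reset Z (\<lambda>i. c (i + int n)), t * exp (height c (int n)))"
proof (induction n)
  case 0
  have "reset Z c = c" using c by (auto simp: reset_def codes_def)
  then show ?case by simp
next
  case (Suc n)
  have "0 \<notin> Z" using Z(1) by auto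
  have "reset Z (\<lambda>i. reset Z (\<lambda>i. c (i + int n)) (i + 1)) = reset Z (\<lambda>i. c (i + int (Suc n)))"
    using Z(2) by (auto simp: reset_def fun_eq_iff algebra_simps)
  moreover have "height c (int (Suc n)) = height c (int n) + c (int n)"
    using height_step[of c "int n"] by (simp add: add.commute)
  ultimately show ?case
    using Suc \<open>0 \<notin> Z\<close> by (simp add: step_map_def reset_def[of Z _ 0] exp_add)
qed

text \<open>
  Take a window of a code from \<open>U\<close> and a window of a code from \<open>V\<close>, and put between them a word that carries the
  height at the end of the first to a little below the one at the start of the second. Such words exist in
  all large lengths, hence the glued code starts in \<open>U\<close> and is in \<open>V\<close> at any prescribed late time.
\<close>

lemma step_map_mixing:
  assumes Z: "Z \<subseteq> {..<0}" "\<And>i. i \<notin> Z \<Longrightarrow> i + 1 \<notin> Z"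
    and H: "H = hypograph (codes Z) roof"
    and U: "openin (top_of_set H) U" "U \<noteq> {}" and V: "openin (top_of_set H) V" "V \<noteq> {}"
  shows "\<exists>n0. \<forall>n\<ge>n0. (step_map Z ^^ n) ` U \<inter> V \<noteq> {}"
proof -
  obtain c t where ct: "(c, t) \<in> U" using U(2) by (metis ex_in_conv surj_pair)
  obtain d s where ds: "(d, s) \<in> V" using V(2) by (metis ex_in_conv surj_pair)
  have ctH: "c \<in> codes Z" "0 \<le> t" "t \<le> roof c" and dsH: "d \<in> codes Z" "0 \<le> s" "s \<le> roof d"
    using ct ds openin_imp_subset[OF U(1)] openin_imp_subset[OF V(1)] H by auto
  obtain e1 where e1: "e1 > 0" "\<And>q. q \<in> H \<Longrightarrow> dist q (c, t) < e1 \<Longrightarrow> q \<in> U"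
    using U(1) ct unfolding openin_euclidean_subtopology_iff by metis
  obtain e2 where e2: "e2 > 0" "\<And>q. q \<in> H \<Longrightarrow> dist q (d, s) < e2 \<Longrightarrow> q \<in> V"
    using V(1) ds unfolding openin_euclidean_subtopology_iff by metis
  define e where "e = min e1 e2 / 2"
  have e: "0 < e" using e1 e2 by (simp add: e_def)
  have pair: "dist (x, a) (y, b) < min e1 e2" if "dist x y < e" "\<bar>a - b\<bar> < e" for x y :: "int \<Rightarrow> real" and a b :: real
  proof -
    have "dist (x, a) (y, b) \<le> dist (x, a) (y, a) + dist (y, a) (y, b)" by (rule dist_triangle)
    also have "\<dots> = dist x y + \<bar>a - b\<bar>" by (simp add: dist_Pair_Pair dist_real_def)
    finally show ?thesis using that by (simp add: e_def)
  qed
  obtain m where m: "0 \<le> m" "\<And>c c'::int \<Rightarrow> real. (\<And>i. - m \<le> i \<Longrightarrow> i \<le> m \<Longrightarrow> c i = c' i) \<Longrightarrow> dist c c' < e"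
    using codes_near[OF e] by metis
  obtain t' where t': "0 < t'" "\<bar>t' - t\<bar> < e" "\<And>i. i \<in> {- m..m + 1} \<Longrightarrow> ln t' + height c i \<le> 0"
    using positive_level[OF ctH(2,3) e] by metis
  have "0 < e/2" using e by simp
  then obtain s' where s': "0 < s'" "\<bar>s' - s\<bar> < e/2" "\<And>i. i \<in> {- m..m + 1} \<Longrightarrow> ln s' + height d i \<le> 0"
    using positive_level[OF dsH(2,3)] by metis
  \<comment> \<open>the word has to end a little below the height at which the second window starts\<close>
  define \<eta> where "\<eta> = ln (1 + e / (2 * s'))"
  have "0 < e / (2 * s')" using e s'(1) by simp
  then have \<eta>: "0 < \<eta>" unfolding \<eta>_def by (intro ln_gt_zero) simp
  have s'\<eta>: "s' - e/2 < s' * exp (- \<eta>)"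
  proof -
    have "s' * exp (- \<eta>) = s' * s' / (s' + e/2)"
      using e s'(1) by (simp add: \<eta>_def exp_minus field_simps add_pos_pos)
    moreover have "(s' - e/2) * (s' + e/2) < s' * s'" using e by (simp add: algebra_simps)
    ultimately show ?thesis using e s'(1) by (simp add: pos_less_divide_eq add_pos_pos)
  qed
  define a where "a = ln t' + height c (m + 1)"
  define b where "b = ln s' + height d (- m)"
  have ab: "a \<le> 0" "b \<le> 0" using t'(3) s'(3) m(1) by (auto simp: a_def b_def)
  obtain N0 where N0: "\<And>N. N0 \<le> N \<Longrightarrow> \<exists>w. length w = N \<and> set w \<subseteq> steps \<and>
    (\<forall>k\<le>N. a + sum_list (take k w) \<le> 0) \<and> b - \<eta> < a + sum_list w \<and> a + sum_list w < b"
    using exists_word[of a "b - \<eta>" b] ab \<eta> by (metis diff_less_eq less_add_same_cancel1)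
  show ?thesis
  proof (intro exI allI impI)
    fix n assume n: "nat (2 * m + 1) + N0 \<le> n"
    define N where "N = n - nat (2 * m + 1)"
    have nN: "int n = 2 * m + 1 + int N" "N0 \<le> N" using n m(1) by (auto simp: N_def)
    obtain w where w: "length w = N" "set w \<subseteq> steps" "\<forall>k\<le>N. a + sum_list (take k w) \<le> 0"
      "b - \<eta> < a + sum_list w" "a + sum_list w < b"
      using N0[OF nN(2)] by blast
    define u where "u = w @ window m d"
    define c' where "c' = glue (- m) (window m c @ u)"
    have "set (window m d) \<subseteq> steps" using dsH(1) by (auto simp: window_def codes_def)
    then have c': "c' \<in> codes Z" unfolding c'_def u_def using w(2) by (intro glue_in_codes[OF Z(1) ctH(1) m(1)]) auto
    have low: "ln t' + height c i \<le> 0" if "- m \<le> i" "i \<le> m + 1" for i using t'(3) that by auto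
    have sumu: "sum_list (take (N + j) u) = sum_list w + (height d (int j - m) - height d (- m))" if "int j \<le> 2 * m + 1" for j
      using sum_take_window[OF m(1) that, of d] w(1) by (simp add: u_def)
    have wd: "ln t' + height c (m + 1) + sum_list (take k u) \<le> 0" if k: "k \<le> length u" for k
    proof (cases "k \<le> N")
      case True
      then show ?thesis using w(1,3) by (simp add: u_def a_def)
    next
      case False
      define j where "j = k - N"
      have j: "k = N + j" "int j \<le> 2 * m + 1"
        using False k m(1) w(1) length_window[OF m(1), of d] by (auto simp: j_def u_def)
      have "ln s' + height d (int j - m) \<le> 0" using s'(3) j(2) by auto
      then show ?thesis using sumu[OF j(2)] w(5) j(1) by (simp add: a_def b_def)
    qed
    have all: "ln t' + height c' i \<le> 0" for i
      unfolding c'_def by (rule heights_splice(1)[OF m(1) low wd])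
    then have "(c', t') \<in> H" using H c' t'(1) le_roof_iff_ln[OF t'(1)] by simp
    moreover have "dist c' c < e" by (rule m(2)) (simp add: c'_def glue_window[OF m(1)])
    ultimately have inU: "(c', t') \<in> U" using e1(2) pair[of c' c t' t] t'(2) by simp
    define r where "r = t' * exp (height c' (int n))"
    have it: "(step_map Z ^^ n) (c', t') = (reset Z (\<lambda>i. c' (i + int n)), r)"
      unfolding r_def by (rule step_map_funpow[OF Z c'])
    have "int (nat m) = m" using m(1) by simp
    then have "ln t' + height c' (m + 1 + int (N + nat m)) = a + sum_list (take (N + nat m) u)"
      unfolding c'_def a_def using m(1) w(1) length_window[OF m(1), of d]
      by (intro heights_splice(2)[OF m(1) low wd]) (auto simp: u_def)
    then have "ln t' + height c' (int n) = a + sum_list w - height d (- m)"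
      using sumu[of "nat m"] m(1) nN(1) by (simp add: algebra_simps)
    then have lnr: "ln s' - \<eta> < ln t' + height c' (int n)" "ln t' + height c' (int n) < ln s'"
      using w(4,5) by (auto simp: b_def)
    have r: "r = exp (ln t' + height c' (int n))" using t'(1) by (simp add: r_def exp_add)
    have "s' * exp (- \<eta>) = exp (ln s' - \<eta>)" using s'(1) by (simp add: exp_diff exp_minus field_simps)
    then have "s' * exp (- \<eta>) < r" using lnr(1) by (simp add: r)
    moreover have "r < s'" using lnr(2) s'(1) by (metis r exp_less_mono exp_ln)
    ultimately have rs: "\<bar>r - s\<bar> < e" using s'\<eta> s'(2) by linarith
    have "dist (reset Z (\<lambda>i. c' (i + int n))) d < e"
    proof (rule m(2))
      fix i assume i: "- m \<le> i" "i \<le> m"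
      define j where "j = length (window m c @ w) + nat (i + m)"
      have len: "int (length (window m c)) = 2 * m + 1" "int (length (window m d)) = 2 * m + 1"
        using length_window[OF m(1)] m(1) by auto
      have j: "i + int n - (- m) = int j" using i nN(1) w(1) len by (simp add: j_def)
      have "int j < int (length (window m c @ u))" using i len by (simp add: j_def u_def)
      then have "c' (i + int n) = (window m c @ u) ! nat (i + int n - (- m))"
        unfolding c'_def glue_def using j by auto
      also have "\<dots> = ((window m c @ w) @ window m d) ! j" unfolding j by (simp add: u_def)
      also have "\<dots> = window m d ! nat (i + m)" unfolding j_def by (rule nth_append_length_plus)
      also have "\<dots> = d i" using window_nth[OF m(1), of "nat (i + m)" d] i by simp
      finally have "c' (i + int n) = d i" .
      then show "reset Z (\<lambda>i. c' (i + int n)) i = d i" using dsH(1) by (simp add: reset_def codes_def)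
    qed
    then have near: "dist ((step_map Z ^^ n) (c', t')) (d, s) < e2" using pair rs by (simp add: it)
    have "(step_map Z ^^ j) p \<in> H" if "p \<in> H" for j p
      using that step_map_in_hypograph[OF Z(1)] H by (induction j) auto
    then have "(step_map Z ^^ n) (c', t') \<in> V" using e2(2) near \<open>(c', t') \<in> H\<close> by blast
    then show "(step_map Z ^^ n) ` U \<inter> V \<noteq> {}" using inU by blast
  qed
qed

section \<open>Arcs in smooth fans\<close>

lemma arc_betweenI:
  fixes g :: "real \<Rightarrow> 'a::metric_space"
  assumes ab: "a < b" and g: "continuous_on {a..b} g" "inj_on g {a..b}"
  shows "arc_between (g ` {a..b}) (g a) (g b)"
proof -
  define k where "k = (\<lambda>s. g (a + (b - a) * s))"
  have im: "(\<lambda>s. a + (b - a) * s) ` {0..1} = {a..b}"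
    using ab image_affinity_atLeastAtMost[of "b - a" a 0 1] by (simp add: add.commute)
  have "continuous_on {0..1} k"
    unfolding k_def by (rule continuous_on_compose2[OF g(1)]) (use im in \<open>auto intro!: continuous_intros\<close>)
  moreover have "inj_on k {0..1}"
  proof (rule inj_onI)
    fix s t assume st: "s \<in> {0..1}" "t \<in> {0..1}" "k s = k t"
    then have "a + (b - a) * s = a + (b - a) * t"
      using inj_onD[OF g(2)] im unfolding k_def by blast
    then show "s = t" using ab by simp
  qed
  moreover have "k ` {0..1} = g ` {a..b}" unfolding k_def using im by (metis image_image)
  ultimately obtain g' where "homeomorphism {0..1} (g ` {a..b}) k g'"
    using homeomorphism_compact[of "{0..1}" k "g ` {a..b}"] by blast
  moreover have "k 0 = g a" "k 1 = g b" by (simp_all add: k_def)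
  ultimately show ?thesis unfolding arc_between_def by blast
qed

lemma arc_betweenE:
  fixes A :: "'a::metric_space set"
  assumes "arc_between A x y"
  obtains g where "continuous_on {0..1::real} g" "inj_on g {0..1}" "g ` {0..1} = A" "g 0 = x" "g 1 = y"
proof -
  obtain g g' where g: "homeomorphism {0..1::real} A g g'" "g 0 = x" "g 1 = y"
    using assms unfolding arc_between_def by blast
  have "inj_on g {0..1}"
    using g(1) by (intro inj_on_inverseI[of _ g']) (auto simp: homeomorphism_def)
  then show ?thesis using that[of g] g unfolding homeomorphism_def by blast
qed

lemma arc_between_sym:
  fixes A :: "'a::metric_space set"
  assumes "arc_between A x y" shows "arc_between A y x"
proof -
  obtain g where g: "continuous_on {0..1::real} g" "inj_on g {0..1}" "g ` {0..1} = A" "g 0 = x" "g 1 = y"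
    using assms by (rule arc_betweenE)
  define k where "k = (\<lambda>s. g (1 - s))"
  have im: "(\<lambda>s. 1 - s) ` {0..1::real} = {0..1}" by simp
  have "continuous_on {0..1} k"
    unfolding k_def by (rule continuous_on_compose2[OF g(1)]) (auto intro!: continuous_intros)
  moreover have "inj_on k {0..1}"
  proof (rule inj_onI)
    fix s t :: real assume "s \<in> {0..1}" "t \<in> {0..1}" "k s = k t"
    then have "1 - s = 1 - t" unfolding k_def by (intro inj_onD[OF g(2)]) auto
    then show "s = t" by simp
  qed
  moreover have "k ` {0..1} = A" unfolding k_def using g(3) im by (metis image_image)
  ultimately show ?thesis
    using arc_betweenI[of 0 1 k] g(4,5) by (simp add: k_def)
qed

lemma arc_between_distinct:
  fixes A :: "'a::metric_space set"
  assumes "arc_between A x y" shows "x \<noteq> y"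
proof -
  obtain g where g: "inj_on g {0..1::real}" "g 0 = x" "g 1 = y"
    using assms by (rule arc_betweenE)
  then show ?thesis using inj_onD[OF g(1), of 0 1] by auto
qed

lemma arc_between_props:
  fixes A :: "'a::metric_space set"
  assumes "arc_between A x y"
  shows "compact A" "connected A" "x \<in> A" "y \<in> A"
proof -
  obtain g where g: "continuous_on {0..1::real} g" "inj_on g {0..1}" "g ` {0..1} = A" "g 0 = x" "g 1 = y"
    using assms by (rule arc_betweenE)
  show "compact A" using compact_continuous_image[OF g(1)] g(3) by simp
  show "connected A" using connected_continuous_image[OF g(1)] g(3) by simp
  show "x \<in> A" "y \<in> A" using g(3-5) by (metis atLeastAtMost_iff imageI order_refl zero_le_one)+
qed

text \<open>
  Pulled back to the parameter interval, \<open>B\<close> becomes a connected set containing \<open>0\<close> and \<open>1\<close>.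
\<close>

lemma arc_connected_subset:
  fixes A :: "'a::metric_space set"
  assumes A: "arc_between A x y" and B: "B \<subseteq> A" "connected B" "x \<in> B" "y \<in> B"
  shows "B = A"
proof -
  obtain g g' where g: "homeomorphism {0..1::real} A g g'" "g 0 = x" "g 1 = y"
    using A unfolding arc_between_def by blast
  have g'': "continuous_on A g'" "\<And>t. t \<in> {0..1} \<Longrightarrow> g' (g t) = t" "\<And>a. a \<in> A \<Longrightarrow> g (g' a) = a" "g ` {0..1} = A"
    using g(1) by (auto simp: homeomorphism_def)
  have "connected (g' ` B)" using connected_continuous_image continuous_on_subset g''(1) B by blast
  moreover have "0 \<in> g' ` B" "1 \<in> g' ` B"
    using g''(2)[of 0] g''(2)[of 1] g(2,3) B(3,4) by force+
  ultimately have sub: "{0..1} \<subseteq> g' ` B" by (rule connected_contains_Icc)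
  have "A \<subseteq> B"
  proof
    fix a assume "a \<in> A"
    then obtain t where t: "t \<in> {0..1}" "a = g t" using g''(4) by blast
    then obtain b where "b \<in> B" "t = g' b" using sub by blast
    then show "a \<in> B" using t g''(3) B(1) by auto
  qed
  then show ?thesis using B(1) by blast
qed

text \<open>
  The union of the two arcs is a continuum. By unicoherence their intersection is connected, and
  it contains both ends, so it exhausts either arc.
\<close>

lemma dendroid_arc_unique:
  assumes X: "dendroid X" and A: "A \<subseteq> X" "arc_between A x y" and B: "B \<subseteq> X" "arc_between B x y"
  shows "A = B"
proof -
  note pA = arc_between_props[OF A(2)] and pB = arc_between_props[OF B(2)]
  have "continuum (A \<union> B)"
    unfolding continuum_def using pA pB by (auto intro!: compact_Un connected_Un)
  then have "unicoherent (A \<union> B)"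
    using X A B unfolding dendroid_def hereditarily_unicoherent_def by blast
  moreover have "closedin (top_of_set (A \<union> B)) A" "closedin (top_of_set (A \<union> B)) B"
    using pA(1) pB(1) by (auto intro!: closed_subset compact_imp_closed)
  ultimately have "connected (A \<inter> B)"
    using pA pB unfolding unicoherent_def by blast
  then have "A \<inter> B = A" "A \<inter> B = B"
    using arc_connected_subset[OF A(2), of "A \<inter> B"] arc_connected_subset[OF B(2), of "A \<inter> B"] pA pB by auto
  then show ?thesis by blast
qed

text \<open>
  The three arms of the triod differ only in the coordinate \<open>\<pi>\<close> that parametrizes them.
\<close>

lemma triod_arm:
  fixes f :: "real \<Rightarrow> 'a::metric_space" and \<pi> :: "real \<times> real \<Rightarrow> real"
  assumes f: "continuous_on {0..1} f" "inj_on f {0..1}" "f ` {0..1} = A" "f 0 = z"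
    and \<pi>: "continuous_on S \<pi>" "\<pi> ` S \<subseteq> {0..1}" "inj_on \<pi> S" "(0, 0) \<in> S" "\<pi> (0, 0) = 0"
    and G: "\<And>p. p \<in> S \<Longrightarrow> G p = f (\<pi> p)"
  shows "continuous_on S G" "inj_on G S" "\<And>p. p \<in> S \<Longrightarrow> G p \<in> A" "\<And>p. p \<in> S \<Longrightarrow> p \<noteq> (0, 0) \<Longrightarrow> G p \<noteq> z"
proof -
  have "continuous_on S (\<lambda>p. f (\<pi> p))" using \<pi>(2) by (rule continuous_on_compose2[OF f(1) \<pi>(1)])
  then show "continuous_on S G" by (rule continuous_on_eq) (simp add: G)
  have "inj_on (f \<circ> \<pi>) S" using \<pi>(3) inj_on_subset[OF f(2) \<pi>(2)] by (rule comp_inj_on)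
  then show inj: "inj_on G S" using inj_on_cong[of S G "f \<circ> \<pi>"] G by simp
  show "G p \<in> A" if "p \<in> S" for p using G[OF that] \<pi>(2) f(3) that by auto
  show "G p \<noteq> z" if "p \<in> S" "p \<noteq> (0, 0)" for p
    using inj_onD[OF inj, of p "(0, 0)"] that \<pi>(4,5) G[OF \<pi>(4)] f(4) by auto
qed

lemma ramification_pointI:
  fixes A :: "'a::metric_space set"
  assumes A: "arc_between A z a" "A \<subseteq> X" and B: "arc_between B z b" "B \<subseteq> X" and C: "arc_between C z c" "C \<subseteq> X"
    and AB: "A \<inter> B \<subseteq> {z}" and AC: "A \<inter> C \<subseteq> {z}" and BC: "B \<inter> C \<subseteq> {z}"
  shows "ramification_point X z"
proof -
  obtain f where f: "continuous_on {0..1::real} f" "inj_on f {0..1}" "f ` {0..1} = A" "f 0 = z" "f 1 = a"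
    using A(1) by (rule arc_betweenE)
  obtain g where g: "continuous_on {0..1::real} g" "inj_on g {0..1}" "g ` {0..1} = B" "g 0 = z" "g 1 = b"
    using B(1) by (rule arc_betweenE)
  obtain k where k: "continuous_on {0..1::real} k" "inj_on k {0..1}" "k ` {0..1} = C" "k 0 = z" "k 1 = c"
    using C(1) by (rule arc_betweenE)
  define G where "G = (\<lambda>p::real \<times> real. if 0 < snd p then k (snd p) else if 0 \<le> fst p then g (fst p) else f (- fst p))"
  have tri: "standard_triod = ({-1..0} \<times> {0} \<union> {0..1} \<times> {0}) \<union> {0} \<times> {0..1}"
    unfolding standard_triod_def by auto
  note arm1 = triod_arm[OF f(1-4), of "{-1..0} \<times> {0}" "\<lambda>p. - fst p" G]
  have a1: "continuous_on ({-1..0} \<times> {0}) G" "inj_on G ({-1..0} \<times> {0})"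
    "\<And>p. p \<in> {-1..0} \<times> {0} \<Longrightarrow> G p \<in> A" "\<And>p. p \<in> {-1..0} \<times> {0} \<Longrightarrow> p \<noteq> (0, 0) \<Longrightarrow> G p \<noteq> z"
    by (rule arm1; auto intro!: continuous_intros inj_onI simp: G_def f(4) g(4))+
  note arm2 = triod_arm[OF g(1-4), of "{0..1} \<times> {0}" fst G]
  have a2: "continuous_on ({0..1} \<times> {0}) G" "inj_on G ({0..1} \<times> {0})"
    "\<And>p. p \<in> {0..1} \<times> {0} \<Longrightarrow> G p \<in> B" "\<And>p. p \<in> {0..1} \<times> {0} \<Longrightarrow> p \<noteq> (0, 0) \<Longrightarrow> G p \<noteq> z"
    by (rule arm2; auto intro!: continuous_intros inj_onI simp: G_def)+
  note arm3 = triod_arm[OF k(1-4), of "{0} \<times> {0..1}" snd G]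
  have a3: "continuous_on ({0} \<times> {0..1}) G" "inj_on G ({0} \<times> {0..1})"
    "\<And>p. p \<in> {0} \<times> {0..1} \<Longrightarrow> G p \<in> C" "\<And>p. p \<in> {0} \<times> {0..1} \<Longrightarrow> p \<noteq> (0, 0) \<Longrightarrow> G p \<noteq> z"
    by (rule arm3; auto intro!: continuous_intros inj_onI simp: G_def k(4) g(4))+
  have cont: "continuous_on standard_triod G"
    unfolding tri by (intro continuous_on_closed_Un closed_Un closed_Times a1(1) a2(1) a3(1)) auto
  have comp: "compact standard_triod"
    unfolding tri by (intro compact_Un compact_Times) auto
  have G0: "G (0, 0) = z" by (simp add: G_def g(4))
  have i12: "inj_on G ({-1..0} \<times> {0} \<union> {0..1} \<times> {0})"
    unfolding inj_on_Un
  proof (intro conjI a1(2) a2(2))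
    have "G ` ({-1..0} \<times> {0} - {0..1} \<times> {0}) \<subseteq> A - {z}"
    proof (rule image_subsetI)
      fix p :: "real \<times> real" assume "p \<in> {-1..0} \<times> {0} - {0..1} \<times> {0}"
      then have "p \<in> {-1..0} \<times> {0}" "p \<noteq> (0, 0)" by auto
      then show "G p \<in> A - {z}" using a1(3,4) by blast
    qed
    moreover have "G ` ({0..1} \<times> {0} - {-1..0} \<times> {0}) \<subseteq> B - {z}"
    proof (rule image_subsetI)
      fix p :: "real \<times> real" assume "p \<in> {0..1} \<times> {0} - {-1..0} \<times> {0}"
      then have "p \<in> {0..1} \<times> {0}" "p \<noteq> (0, 0)" by auto
      then show "G p \<in> B - {z}" using a2(3,4) by blast
    qed
    ultimately show "G ` ({-1..0} \<times> {0} - {0..1} \<times> {0}) \<inter> G ` ({0..1} \<times> {0} - {-1..0} \<times> {0}) = {}"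
      using AB by blast
  qed
  have inj: "inj_on G standard_triod"
    unfolding tri inj_on_Un[of G "{-1..0} \<times> {0} \<union> {0..1} \<times> {0}"]
  proof (intro conjI i12 a3(2))
    have "G ` ({-1..0} \<times> {0} \<union> {0..1} \<times> {0} - {0} \<times> {0..1}) \<subseteq> (A \<union> B) - {z}"
    proof (rule image_subsetI)
      fix p assume p: "p \<in> {-1..0} \<times> {0} \<union> {0..1} \<times> {0::real} - {0::real} \<times> {0..1}"
      then have "p \<noteq> (0, 0)" by auto
      then show "G p \<in> (A \<union> B) - {z}" using a1(3,4)[of p] a2(3,4)[of p] p by blast
    qed
    moreover have "G ` ({0} \<times> {0..1} - ({-1..0} \<times> {0} \<union> {0..1} \<times> {0})) \<subseteq> C - {z}"
    proof (rule image_subsetI)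
      fix p assume "p \<in> {0::real} \<times> {0..1} - ({-1..0} \<times> {0} \<union> {0..1} \<times> {0::real})"
      then have "p \<in> {0} \<times> {0..1}" "p \<noteq> (0, 0)" by auto
      then show "G p \<in> C - {z}" using a3(3,4) by blast
    qed
    ultimately show "G ` ({-1..0} \<times> {0} \<union> {0..1} \<times> {0} - {0} \<times> {0..1}) \<inter>
       G ` ({0} \<times> {0..1} - ({-1..0} \<times> {0} \<union> {0..1} \<times> {0})) = {}"
      using AC BC by blast
  qed
  obtain G' where "homeomorphism standard_triod (G ` standard_triod) G G'"
    using homeomorphism_compact[OF comp cont refl inj] by blast
  moreover have "G ` standard_triod \<subseteq> X"
  proof
    fix y assume "y \<in> G ` standard_triod"
    then obtain p where "p \<in> {-1..0} \<times> {0} \<union> {0..1} \<times> {0} \<union> {0} \<times> {0..1}" "y = G p" unfolding tri by blast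
    then have "y \<in> A \<union> B \<union> C"
      using a1(3)[of p] a2(3)[of p] a3(3)[of p] by blast
    then show "y \<in> X" using A(2) B(2) C(2) by blast
  qed
  ultimately show ?thesis using G0 unfolding ramification_point_def by blast
qed

locale pointed_smooth_fan =
  fixes X :: "'a::metric_space set" and v :: 'a
  assumes fan: "fan X" and ram: "ramification_point X v"
    and smooth: "\<And>x s. x \<in> X \<Longrightarrow> (\<And>n::nat. s n \<in> X) \<Longrightarrow> s \<longlonglongrightarrow> x \<Longrightarrow>
       (\<lambda>n. hausdorff_dist (arc_in X v (s n)) (arc_in X v x)) \<longlonglongrightarrow> 0"
begin

abbreviation seg :: "'a \<Rightarrow> 'a set" where "seg \<equiv> arc_in X v"

lemma dend: "dendroid X" using fan by (simp add: fan_def)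

lemma X_props: "compact X" "connected X" "v \<in> X"
proof -
  show "compact X" "connected X" using dend by (auto simp: dendroid_def continuum_def)
  obtain T g g' where "T \<subseteq> X" "homeomorphism standard_triod T g g'" "g (0, 0) = v"
    using ram unfolding ramification_point_def by blast
  then show "v \<in> X" unfolding homeomorphism_def standard_triod_def by force
qed

lemma seg_v [simp]: "seg v = {v}" by (simp add: arc_in_def)

lemma seg_eq:
  assumes "A \<subseteq> X" "arc_between A v x" shows "seg x = A"
proof -
  have "v \<noteq> x" using arc_between_distinct assms(2) by blast
  moreover have "(THE A. A \<subseteq> X \<and> arc_between A v x) = A"
  proof (rule the_equality)
    show "A \<subseteq> X \<and> arc_between A v x" using assms by simp
    show "B = A" if "B \<subseteq> X \<and> arc_between B v x" for B
      using that dendroid_arc_unique[OF dend _ _ assms] by simp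
  qed
  ultimately show ?thesis by (simp add: arc_in_def)
qed

lemma seg_arc:
  assumes "x \<in> X" "x \<noteq> v" shows "seg x \<subseteq> X" "arc_between (seg x) v x"
proof -
  obtain A where A: "A \<subseteq> X" "arc_between A v x"
    using dend X_props(3) assms unfolding dendroid_def arcwise_connected_def by metis
  then show "seg x \<subseteq> X" "arc_between (seg x) v x" using seg_eq[OF A] by auto
qed

lemma seg_param:
  assumes "x \<in> X" "x \<noteq> v"
  shows "\<exists>g. continuous_on {0..1::real} g \<and> inj_on g {0..1} \<and> g ` {0..1} = seg x \<and> g 0 = v \<and> g 1 = x \<and>
    (\<forall>s\<in>{0..1}. seg (g s) = g ` {0..s})"
proof -
  obtain g where g: "continuous_on {0..1::real} g" "inj_on g {0..1}" "g ` {0..1} = seg x" "g 0 = v" "g 1 = x"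
    using seg_arc(2)[OF assms] by (rule arc_betweenE)
  have "seg (g s) = g ` {0..s}" if "s \<in> {0..1}" for s
  proof (cases "s = 0")
    case True
    then show ?thesis using g(4) by simp
  next
    case False
    have s: "0 \<le> s" "s \<le> 1" using that by auto
    then have "0 < s" using False by simp
    moreover have "continuous_on {0..s} g" by (rule continuous_on_subset[OF g(1)]) (use s in auto)
    moreover have "inj_on g {0..s}" by (rule inj_on_subset[OF g(2)]) (use s in auto)
    ultimately have "arc_between (g ` {0..s}) (g 0) (g s)" by (rule arc_betweenI)
    moreover have "g ` {0..s} \<subseteq> X" using g(3) seg_arc(1)[OF assms] s by force
    ultimately show ?thesis using seg_eq g(4) by simp
  qed
  then show ?thesis using g by blast
qed

lemma seg_props:
  assumes "x \<in> X"
  shows "seg x \<subseteq> X" "compact (seg x)" "connected (seg x)" "v \<in> seg x" "x \<in> seg x"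
  using assms X_props(3) seg_arc[of x] arc_between_props[of "seg x" v x] by (cases "x = v"; simp)+

lemma seg_trans:
  assumes "x \<in> X" "y \<in> seg x" shows "seg y \<subseteq> seg x"
proof (cases "x = v")
  case True
  then show ?thesis using assms by simp
next
  case False
  obtain g where g: "g ` {0..1} = seg x" "\<forall>s\<in>{0..1}. seg (g s) = g ` {0..s::real}"
    using seg_param[OF assms(1) False] by fast
  obtain s where s: "s \<in> {0..1}" "y = g s" using assms(2) g(1) by blast
  then have "seg y = g ` {0..s}" using g(2) by simp
  also have "\<dots> \<subseteq> g ` {0..1}" using s(1) by (intro image_mono) auto
  finally show ?thesis using g(1) by simp
qed

lemma seg_linear:
  assumes "x \<in> X" "y \<in> seg x" "z \<in> seg x" shows "y \<in> seg z \<or> z \<in> seg y"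
proof (cases "x = v")
  case True
  then show ?thesis using assms by simp
next
  case False
  obtain g where g: "g ` {0..1} = seg x" "\<forall>s\<in>{0..1}. seg (g s) = g ` {0..s::real}"
    using seg_param[OF assms(1) False] by fast
  obtain s where s: "s \<in> {0..1}" "y = g s" using assms(2) g(1) by blast
  obtain t where t: "t \<in> {0..1}" "z = g t" using assms(3) g(1) by blast
  have "seg y = g ` {0..s}" "seg z = g ` {0..t}" using g(2) s t by auto
  then show ?thesis using s t by (cases "s \<le> t") auto
qed

lemma seg_antisym:
  assumes "x \<in> X" "y \<in> seg x" "x \<in> seg y" shows "x = y"
proof (cases "x = v")
  case True
  then show ?thesis using assms by simp
next
  case False
  obtain g where g: "inj_on g {0..1}" "g ` {0..1} = seg x" "g 1 = x" "\<forall>s\<in>{0..1}. seg (g s) = g ` {0..s::real}"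
    using seg_param[OF assms(1) False] by fast
  obtain s where s: "s \<in> {0..1}" "y = g s" using assms(2) g(2) by blast
  then have "g 1 \<in> g ` {0..s}" using g(3,4) s assms(3) by auto
  then obtain t where t: "t \<in> {0..s}" "g 1 = g t" by blast
  then have "1 = t" using inj_onD[OF g(1) t(2)] s by auto
  then show ?thesis using s t g(3) by auto
qed

text \<open>
  Let \<open>z\<close> be the last point of the arc to \<open>x\<close> that lies on the arc to \<open>y\<close>. If \<open>z\<close> is neither \<open>x\<close> nor \<open>y\<close>, the arcs
  from \<open>z\<close> to \<open>v\<close>, \<open>x\<close> and \<open>y\<close> form a triod. As \<open>w\<close> comes no later than \<open>z\<close>, this is a ramification point other than \<open>v\<close>.
\<close>

lemma legs_disjoint:
  assumes x: "x \<in> X" and y: "y \<in> X" and w: "w \<in> seg x" "w \<in> seg y" "w \<noteq> v"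
  shows "x \<in> seg y \<or> y \<in> seg x"
proof (rule ccontr)
  assume neg: "\<not> (x \<in> seg y \<or> y \<in> seg x)"
  have "x \<noteq> v" "y \<noteq> v" using w by auto
  obtain g where g: "continuous_on {0..1::real} g" "inj_on g {0..1}" "g ` {0..1} = seg x" "g 0 = v" "g 1 = x"
    "\<forall>s\<in>{0..1}. seg (g s) = g ` {0..s}" using seg_param[OF x \<open>x \<noteq> v\<close>] by (elim exE conjE)
  obtain k where k: "continuous_on {0..1::real} k" "inj_on k {0..1}" "k ` {0..1} = seg y" "k 0 = v" "k 1 = y"
    "\<forall>s\<in>{0..1}. seg (k s) = k ` {0..s}" using seg_param[OF y \<open>y \<noteq> v\<close>] by (elim exE conjE)
  let ?S = "{0..1} \<inter> g -` seg y"
  have "closed (seg y)" using seg_props(2)[OF y] compact_imp_closed by blast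
  then have "closed ?S" using continuous_closed_preimage[OF g(1)] by simp
  then have "compact ?S" using compact_Int_closed[of "{0..1::real}" ?S] by simp
  moreover obtain s1 where s1: "s1 \<in> {0..1}" "w = g s1" using g(3) w(1) by blast
  then have "s1 \<in> ?S" using w(2) by simp
  ultimately obtain s0 where s0: "s0 \<in> ?S" "\<And>s. s \<in> ?S \<Longrightarrow> s \<le> s0"
    using compact_attains_sup[of ?S] by blast
  have "s1 \<noteq> 0" using s1 w(3) g(4) by metis
  then have s0pos: "0 < s0" using s0(2)[OF \<open>s1 \<in> ?S\<close>] s1(1) by auto
  have s0lt: "s0 < 1" using s0(1) neg g(5) by (cases "s0 = 1") auto
  let ?z = "g s0"
  have zy: "?z \<in> seg y" using s0(1) by simp
  then obtain t0 where t0: "t0 \<in> {0..1}" "?z = k t0" using k(3) by blast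
  have t0lt: "t0 < 1"
  proof (rule ccontr)
    assume "\<not> t0 < 1"
    then have "t0 = 1" using t0 by simp
    then have "y = g s0" using t0 k(5) by simp
    then show False using neg g(3) s0(1) by auto
  qed
  have zv: "?z \<noteq> v"
    using inj_onD[OF g(2), of s0 0] g(4) s0pos s0lt by auto
  have zX: "?z \<in> X" using zy seg_props(1)[OF y] by blast
  have A: "arc_between (seg ?z) ?z v" "seg ?z \<subseteq> X"
    using arc_between_sym[OF seg_arc(2)[OF zX zv]] seg_arc(1)[OF zX zv] by auto
  have B: "arc_between (g ` {s0..1}) ?z (g 1)"
  proof (rule arc_betweenI[OF s0lt])
    show "continuous_on {s0..1} g" by (rule continuous_on_subset[OF g(1)]) (use s0pos in auto)
    show "inj_on g {s0..1}" by (rule inj_on_subset[OF g(2)]) (use s0pos in auto)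
  qed
  have C: "arc_between (k ` {t0..1}) (k t0) (k 1)"
  proof (rule arc_betweenI[OF t0lt])
    show "continuous_on {t0..1} k" by (rule continuous_on_subset[OF k(1)]) (use t0 in auto)
    show "inj_on k {t0..1}" by (rule inj_on_subset[OF k(2)]) (use t0 in auto)
  qed
  have "ramification_point X ?z"
  proof (rule ramification_pointI[OF A B _ C[folded t0(2)]])
    show "g ` {s0..1} \<subseteq> X" using g(3) seg_props(1)[OF x] s0pos by force
    show "k ` {t0..1} \<subseteq> X" using k(3) seg_props(1)[OF y] t0(1) by force
    have I1: "seg ?z = g ` {0..s0}" using g(6) s0pos s0lt by simp
    have I2: "seg ?z = k ` {0..t0}" using k(6) t0 by simp
    show "seg ?z \<inter> g ` {s0..1} \<subseteq> {?z}"
    proof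
      fix p assume p: "p \<in> seg ?z \<inter> g ` {s0..1}"
      then obtain s t where st: "s \<in> {0..s0}" "p = g s" "t \<in> {s0..1}" "p = g t" using I1 by blast
      then have "s = t" using s0pos s0lt by (intro inj_onD[OF g(2)]) auto
      then show "p \<in> {?z}" using st by auto
    qed
    show "seg ?z \<inter> k ` {t0..1} \<subseteq> {?z}"
    proof
      fix p assume p: "p \<in> seg ?z \<inter> k ` {t0..1}"
      then obtain s t where st: "s \<in> {0..t0}" "p = k s" "t \<in> {t0..1}" "p = k t" using I2 by blast
      then have "s = t" using t0 by (intro inj_onD[OF k(2)]) auto
      then show "p \<in> {?z}" using st t0(2) by auto
    qed
    show "g ` {s0..1} \<inter> k ` {t0..1} \<subseteq> {?z}"
    proof
      fix p assume p: "p \<in> g ` {s0..1} \<inter> k ` {t0..1}"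
      then obtain s where s: "s \<in> {s0..1}" "p = g s" by blast
      have "k ` {t0..1} \<subseteq> seg y" using k(3) t0(1) by force
      then have "s \<in> ?S" using p s s0pos by auto
      then have "s = s0" using s0(2) s(1) by force
      then show "p \<in> {?z}" using s by simp
    qed
  qed
  then show False using fan ram zv unfolding fan_def by blast
qed

end

section \<open>Heights and level sets\<close>

lemma hausdorff_dist_upper:
  fixes A B :: "'a::metric_space set"
  assumes "compact A" "compact B"
  shows "a \<in> A \<Longrightarrow> infdist a B \<le> hausdorff_dist A B" "b \<in> B \<Longrightarrow> infdist b A \<le> hausdorff_dist A B"
proof -
  have bdd: "bdd_above ((\<lambda>a. infdist a C) ` D)" if "compact D" for C D :: "'a set"
    using that by (intro bounded_imp_bdd_above compact_imp_bounded compact_continuous_image continuous_intros)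
  show "a \<in> A \<Longrightarrow> infdist a B \<le> hausdorff_dist A B"
    unfolding hausdorff_dist_def using cSUP_upper[OF _ bdd[OF assms(1)], of a B] by linarith
  show "b \<in> B \<Longrightarrow> infdist b A \<le> hausdorff_dist A B"
    unfolding hausdorff_dist_def using cSUP_upper[OF _ bdd[OF assms(2)], of b A] by linarith
qed

lemma infdist_hausdorff_dist:
  fixes A B :: "'a::metric_space set"
  assumes "compact A" "compact B" "A \<noteq> {}" "B \<noteq> {}"
  shows "\<bar>infdist q A - infdist q B\<bar> \<le> hausdorff_dist A B"
proof -
  have "infdist q A - hausdorff_dist A B \<le> dist q b" if "b \<in> B" for b
    using infdist_triangle[of q A b] hausdorff_dist_upper(2)[OF assms(1,2) that] by linarith
  then have "infdist q A - hausdorff_dist A B \<le> infdist q B"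
    unfolding infdist_notempty[OF assms(4)] by (intro cINF_greatest assms(4))
  moreover have "infdist q B - hausdorff_dist A B \<le> dist q a" if "a \<in> A" for a
    using infdist_triangle[of q B a] hausdorff_dist_upper(1)[OF assms(1,2) that] by linarith
  then have "infdist q B - hausdorff_dist A B \<le> infdist q A"
    unfolding infdist_notempty[OF assms(3)] by (intro cINF_greatest assms(3))
  ultimately show ?thesis by linarith
qed

lemma compact_dense_sequence:
  fixes X :: "'a::metric_space set"
  assumes "compact X" "X \<noteq> {}"
  obtains q :: "nat \<Rightarrow> 'a" where "\<And>k. q k \<in> X" "\<And>x e. x \<in> X \<Longrightarrow> 0 < e \<Longrightarrow> \<exists>k. dist (q k) x < e"
proof -
  have tb: "\<exists>k. finite k \<and> k \<subseteq> X \<and> X \<subseteq> (\<Union>x\<in>k. ball x e)" if "e > 0" for e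
    using seq_compact_imp_totally_bounded[OF compact_imp_seq_compact[OF assms(1)]] that by simp
  have "\<forall>n. \<exists>k. finite k \<and> k \<subseteq> X \<and> X \<subseteq> (\<Union>x\<in>k. ball x (inverse (real (Suc n))))"
    by (intro allI tb) simp
  from choice[OF this] obtain K
    where K: "\<forall>n. finite (K n) \<and> K n \<subseteq> X \<and> X \<subseteq> (\<Union>x\<in>K n. ball x (inverse (real (Suc n))))"
    by (elim exE)
  define D where "D = (\<Union>n. K n)"
  have D: "countable D" "D \<subseteq> X" using K by (auto simp: D_def countable_finite)
  have "K 0 \<noteq> {}" using K assms(2) by fastforce
  then have "D \<noteq> {}" by (auto simp: D_def)
  show ?thesis
  proof (rule that[of "from_nat_into D"])
    show "from_nat_into D k \<in> X" for k using from_nat_into[OF \<open>D \<noteq> {}\<close>] D(2) by blast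
    fix x :: 'a and e :: real assume x: "x \<in> X" "0 < e"
    obtain n where n: "inverse (real (Suc n)) < e" using reals_Archimedean[OF x(2)] by blast
    have "x \<in> (\<Union>y\<in>K n. ball y (inverse (real (Suc n))))" using K x(1) by blast
    then obtain y where y: "y \<in> K n" "dist y x < inverse (real (Suc n))" by auto
    then have "y \<in> D" by (auto simp: D_def)
    then obtain k where "from_nat_into D k = y" using from_nat_into_surj[OF D(1)] by blast
    moreover have "dist y x < e" using y(2) n by linarith
    ultimately show "\<exists>k. dist (from_nat_into D k) x < e" by blast
  qed
qed

context pointed_smooth_fan
begin

text \<open>
  The order along the legs is closed: the distance of \<open>y n\<close> from the arc to \<open>x\<close> is at most the Hausdorff distance
  of the two arcs, which tends to \<open>0\<close> by smoothness.
\<close>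

lemma seg_closed:
  assumes s: "\<And>n::nat. s n \<in> X" "x \<in> X" "s \<longlonglongrightarrow> x" and y: "\<And>n. y n \<in> seg (s n)" "y \<longlonglongrightarrow> z"
  shows "z \<in> seg x"
proof -
  have "infdist (y n) (seg x) \<le> hausdorff_dist (seg (s n)) (seg x)" for n
    using hausdorff_dist_upper(1)[OF seg_props(2)[OF s(1)] seg_props(2)[OF s(2)] y(1)] .
  moreover have "(\<lambda>n. hausdorff_dist (seg (s n)) (seg x)) \<longlonglongrightarrow> 0" using smooth[OF s(2,1,3)] .
  moreover have lim: "(\<lambda>n. infdist (y n) (seg x)) \<longlonglongrightarrow> infdist z (seg x)" using y(2) by (intro tendsto_intros)
  ultimately have "infdist z (seg x) \<le> 0" using LIMSEQ_le by blast
  then have "infdist z (seg x) = 0" using infdist_nonneg[of z "seg x"] by linarith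
  moreover have "closed (seg x)" "seg x \<noteq> {}" using seg_props[OF s(2)] compact_imp_closed by auto
  ultimately show ?thesis using in_closed_iff_infdist_zero by blast
qed

text \<open>
  Whitney's construction. For a dense sequence of points \<open>q k\<close>, measure how much closer the arc to \<open>x\<close> comes to
  \<open>q k\<close> than \<open>v\<close> is, and add up with weights. A longer arc contains a point at positive distance from the shorter one, and
  some \<open>q k\<close> near that point tells the two apart.
\<close>

lemma exists_height:
  "\<exists>h::'a \<Rightarrow> real. continuous_on X h \<and> h v = 0 \<and> (\<forall>x\<in>X. \<forall>y\<in>seg x. h y \<le> h x \<and> (h y = h x \<longrightarrow> y = x))"
proof -
  have "X \<noteq> {}" using X_props(3) by blast
  with X_props(1) obtain q :: "nat \<Rightarrow> 'a"
    where q: "\<And>k. q k \<in> X" "\<And>x e. x \<in> X \<Longrightarrow> 0 < e \<Longrightarrow> \<exists>k. dist (q k) x < e"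
    using compact_dense_sequence by metis
  define w where "w = (\<lambda>k x. (1/2)^k * (dist (q k) v - infdist (q k) (seg x)))"
  obtain B where B: "\<And>x y. x \<in> X \<Longrightarrow> y \<in> X \<Longrightarrow> dist x y \<le> B"
    using compact_imp_bounded[OF X_props(1)] by (metis bounded_two_points)
  have ne: "seg x \<noteq> {}" if "x \<in> X" for x using seg_props(4)[OF that] by blast
  have w0: "0 \<le> w k x" if "x \<in> X" for k x
    unfolding w_def using infdist_le[OF seg_props(4)[OF that], of "q k"] by simp
  have wB: "w k x \<le> (1/2)^k * B" for k x
    unfolding w_def using infdist_nonneg[of "q k" "seg x"] B[OF q(1) X_props(3), of k]
    by (intro mult_left_mono) auto
  have sumB: "summable (\<lambda>k. (1/2::real)^k * B)" by (intro summable_mult2 summable_geometric) auto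
  have sumw: "summable (\<lambda>k. w k x)" if "x \<in> X" for x
    using w0[OF that] wB by (intro summable_comparison_test'[OF sumB, of 0]) auto
  define h where "h = (\<lambda>x. \<Sum>k. w k x)"
  have wcont: "continuous_on X (w k)" for k
  proof (rule continuous_on_sequentiallyI)
    fix s x assume s: "\<forall>n. s n \<in> X" "x \<in> X" "s \<longlonglongrightarrow> x"
    have "(\<lambda>n. infdist (q k) (seg (s n)) - infdist (q k) (seg x)) \<longlonglongrightarrow> 0"
    proof (rule Lim_null_comparison)
      show "(\<lambda>n. hausdorff_dist (seg (s n)) (seg x)) \<longlonglongrightarrow> 0" using smooth[OF s(2) _ s(3)] s(1) by blast
      show "\<forall>\<^sub>F n in sequentially. norm (infdist (q k) (seg (s n)) - infdist (q k) (seg x)) \<le> hausdorff_dist (seg (s n)) (seg x)"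
      proof (rule always_eventually, rule allI)
        fix n
        have "s n \<in> X" using s(1) by blast
        then show "norm (infdist (q k) (seg (s n)) - infdist (q k) (seg x)) \<le> hausdorff_dist (seg (s n)) (seg x)"
          unfolding real_norm_def using s(2) by (intro infdist_hausdorff_dist seg_props(2) ne)
      qed
    qed
    then have "(\<lambda>n. infdist (q k) (seg (s n))) \<longlonglongrightarrow> infdist (q k) (seg x)" by (simp add: LIM_zero_iff)
    then show "(\<lambda>n. w k (s n)) \<longlonglongrightarrow> w k x" unfolding w_def by (intro tendsto_intros)
  qed
  have "uniform_limit X (\<lambda>n x. \<Sum>k<n. w k x) h sequentially"
    unfolding h_def by (rule Weierstrass_m_test[OF _ sumB]) (use w0 wB in auto)
  then have "continuous_on X h"
    by (rule uniform_limit_theorem[rotated]) (auto intro!: always_eventually continuous_intros wcont)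
  moreover have "h v = 0" by (simp add: h_def w_def)
  moreover have "h y \<le> h x \<and> (h y = h x \<longrightarrow> y = x)" if x: "x \<in> X" and y: "y \<in> seg x" for x y
  proof -
    have yX: "y \<in> X" using seg_props(1)[OF x] y by blast
    have mono: "w k y \<le> w k x" for k
      unfolding w_def using infdist_mono[OF seg_trans[OF x y] ne[OF yX], of "q k"] by (intro mult_left_mono) auto
    have "h y < h x" if "y \<noteq> x"
    proof -
      have "x \<notin> seg y" using seg_antisym[OF x y] that by blast
      then have d: "0 < infdist x (seg y)"
        using infdist_pos_not_in_closed[of "seg y" x] compact_imp_closed[OF seg_props(2)[OF yX]] ne[OF yX] by blast
      then obtain k where k: "dist (q k) x < infdist x (seg y) / 2" using q(2)[OF x, of "infdist x (seg y) / 2"] by auto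
      have "infdist (q k) (seg x) \<le> dist (q k) x" using infdist_le[OF seg_props(5)[OF x]] .
      moreover have "infdist x (seg y) \<le> infdist (q k) (seg y) + dist (q k) x"
        using infdist_triangle[of x "seg y" "q k"] by (simp add: dist_commute)
      ultimately have "infdist (q k) (seg x) < infdist (q k) (seg y)" using k by linarith
      then have "0 < w k x - w k y" unfolding w_def by (simp add: algebra_simps)
      then have "0 < (\<Sum>k. w k x - w k y)"
        using mono sumw[OF x] sumw[OF yX] by (intro suminf_pos2[where i = k] summable_diff) auto
      also have "\<dots> = h x - h y" unfolding h_def by (rule suminf_diff[symmetric, OF sumw[OF x] sumw[OF yX]])
      finally show ?thesis by simp
    qed
    then show ?thesis by (cases "y = x") auto
  qed
  ultimately show ?thesis by blast
qed

end

locale measured_smooth_fan = pointed_smooth_fan X v for X :: "'a::metric_space set" and v +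
  fixes h :: "'a \<Rightarrow> real"
  assumes h_cont: "continuous_on X h" and h_v [simp]: "h v = 0"
    and h_mono: "\<And>x y. x \<in> X \<Longrightarrow> y \<in> seg x \<Longrightarrow> h y \<le> h x"
    and h_strict: "\<And>x y. x \<in> X \<Longrightarrow> y \<in> seg x \<Longrightarrow> h y = h x \<Longrightarrow> y = x"
begin

lemma h_nonneg: "x \<in> X \<Longrightarrow> 0 \<le> h x"
  using h_mono[of x v] seg_props(4)[of x] by simp

lemma h_pos: "x \<in> X \<Longrightarrow> x \<noteq> v \<Longrightarrow> 0 < h x"
  using h_nonneg[of x] h_strict[of x v] seg_props(4)[of x] by force

lemma h_eq_0: "x \<in> X \<Longrightarrow> h x = 0 \<longleftrightarrow> x = v"
  using h_pos by force

lemma seg_mem_X: "x \<in> X \<Longrightarrow> y \<in> seg x \<Longrightarrow> y \<in> X"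
  using seg_props(1) by blast

lemma same_height_eq: "x \<in> X \<Longrightarrow> y \<in> X \<Longrightarrow> x \<in> seg y \<or> y \<in> seg x \<Longrightarrow> h x = h y \<Longrightarrow> x = y"
  using h_strict[of x y] h_strict[of y x] by auto

text \<open>
  The retraction onto the level \<open>t\<close> along the legs.
\<close>

definition ret :: "real \<Rightarrow> 'a \<Rightarrow> 'a" where
  "ret t x = (THE y. y \<in> seg x \<and> h y = t)"

lemma ret_eq:
  assumes "x \<in> X" "y \<in> seg x" "h y = t" shows "ret t x = y"
  unfolding ret_def
proof (rule the_equality)
  fix z assume z: "z \<in> seg x \<and> h z = t"
  then show "z = y"
    using seg_linear[OF assms(1), of z y] assms seg_mem_X[OF assms(1)] by (intro same_height_eq) auto
qed (use assms in simp)

lemma ret: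
  assumes x: "x \<in> X" and t: "0 \<le> t" "t \<le> h x"
  shows "ret t x \<in> seg x" "h (ret t x) = t" "ret t x \<in> X"
proof -
  have "connected (h ` seg x)"
    using seg_props[OF x] h_cont continuous_on_subset by (intro connected_continuous_image) blast+
  moreover have "0 \<in> h ` seg x" "h x \<in> h ` seg x" using seg_props(4,5)[OF x] h_v by force+
  ultimately have "{0..h x} \<subseteq> h ` seg x" by (rule connected_contains_Icc)
  then obtain y where y: "y \<in> seg x" "h y = t" using t by auto
  then show "ret t x \<in> seg x" "h (ret t x) = t" using ret_eq[OF x y] by auto
  then show "ret t x \<in> X" using seg_mem_X x by blast
qed

lemma ret_self: "x \<in> X \<Longrightarrow> ret (h x) x = x"
  using ret_eq seg_props(5) by blast

lemma ret_below:
  assumes "x \<in> X" "y \<in> seg x" "0 \<le> t" "t \<le> h y" shows "ret t y = ret t x"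
proof -
  have y: "y \<in> X" using seg_mem_X assms by blast
  have "ret t y \<in> seg x" using ret(1)[OF y assms(3,4)] seg_trans[OF assms(1,2)] by blast
  then show ?thesis using ret_eq[OF assms(1)] ret(2)[OF y assms(3,4)] by simp
qed

lemma continuous_on_ret:
  assumes "0 \<le> t" shows "continuous_on {x \<in> X. t \<le> h x} (ret t)"
proof (rule continuous_on_compact_closed_graph[OF X_props(1)])
  show "ret t x \<in> X" if "x \<in> {x \<in> X. t \<le> h x}" for x using ret(3) that assms by blast
  fix s x y assume s: "\<And>n::nat. s n \<in> {x \<in> X. t \<le> h x}" "x \<in> {x \<in> X. t \<le> h x}" "s \<longlonglongrightarrow> x"
    "(\<lambda>n. ret t (s n)) \<longlonglongrightarrow> y"
  have sn: "s n \<in> X" "t \<le> h (s n)" for n using s(1)[of n] by auto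
  have x: "x \<in> X" using s(2) by simp
  have r: "ret t (s n) \<in> seg (s n)" "h (ret t (s n)) = t" "ret t (s n) \<in> X" for n
    using ret[OF sn(1) assms sn(2)] by auto
  have y: "y \<in> seg x" using seg_closed[OF sn(1) x s(3) r(1) s(4)] .
  have "(\<lambda>n. h (ret t (s n))) \<longlonglongrightarrow> h y"
    using h_cont seg_mem_X[OF x y] r(3) s(4) by (auto intro: continuous_on_tendsto_compose)
  then have "h y = t" using r(2) by (simp add: LIMSEQ_const_iff)
  then show "y = ret t x" using ret_eq[OF x y] by simp
qed

definition level :: "real \<Rightarrow> 'a set" where "level t = {x \<in> X. h x = t}"

lemma compact_level: "compact (level t)"
proof -
  have "closedin (top_of_set X) {x \<in> X. h x = t}"
    using continuous_closedin_preimage_constant[OF h_cont] by simp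
  then show ?thesis unfolding level_def using closedin_compact X_props(1) by blast
qed

text \<open>
  A connected subset of a level with two points \<open>x\<close> and \<open>y\<close> has a closure \<open>K\<close> inside the level. The arcs from \<open>v\<close> to \<open>x\<close> and
  \<open>y\<close> form a continuum that meets \<open>K\<close> in \<open>x\<close> and \<open>y\<close> only, contrary to unicoherence.
\<close>

lemma totally_disconnected_level: "totally_disconnected (level t)"
  unfolding totally_disconnected_def
proof (intro allI impI ballI)
  fix T x y assume T: "T \<subseteq> level t" "connected T" "x \<in> T" "y \<in> T"
  show "x = y"
  proof (rule ccontr)
    assume "x \<noteq> y"
    have xy: "x \<in> X" "y \<in> X" "h x = t" "h y = t" using T by (auto simp: level_def)
    let ?K = "closure T" and ?A = "seg x \<union> seg y"
    have K: "?K \<subseteq> level t" using T(1) compact_imp_closed[OF compact_level] by (rule closure_minimal)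
    have cK: "compact ?K" using compact_level K by (metis closed_closure compact_Int_closed inf.absorb_iff2)
    have conK: "connected ?K" using T(2) by (rule connected_imp_connected_closure)
    have A: "compact ?A" "connected ?A" "?A \<subseteq> X"
      using seg_props[OF xy(1)] seg_props[OF xy(2)] by (auto intro!: compact_Un connected_Un)
    have AK: "?A \<inter> ?K = {x, y}"
    proof
      show "?A \<inter> ?K \<subseteq> {x, y}"
      proof
        fix p assume p: "p \<in> ?A \<inter> ?K"
        then have "h p = t" using K by (auto simp: level_def)
        then show "p \<in> {x, y}" using p h_strict xy by auto
      qed
      have "x \<in> ?K" "y \<in> ?K" using T(3,4) closure_subset by blast+
      moreover have "x \<in> ?A" "y \<in> ?A" using seg_props(5)[OF xy(1)] seg_props(5)[OF xy(2)] by blast+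
      ultimately show "{x, y} \<subseteq> ?A \<inter> ?K" by blast
    qed
    have "continuum (?A \<union> ?K)"
      unfolding continuum_def using A cK conK AK by (auto intro!: compact_Un connected_Un)
    moreover have "?A \<union> ?K \<subseteq> X" using A(3) K by (auto simp: level_def)
    ultimately have "unicoherent (?A \<union> ?K)"
      using dend unfolding dendroid_def hereditarily_unicoherent_def by blast
    moreover have "closedin (top_of_set (?A \<union> ?K)) ?A" "closedin (top_of_set (?A \<union> ?K)) ?K"
      using A(1) cK compact_imp_closed by (blast intro: closed_subset)+
    ultimately have "connected (?A \<inter> ?K)"
      using A(2) conK unfolding unicoherent_def by blast
    then have "connected {x, y}" by (simp only: AK)
    then show False using \<open>x \<noteq> y\<close> connected_finite_iff_sing[of "{x, y}"] by auto
  qed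
qed

end

section \<open>Clopen sets of legs\<close>

context measured_smooth_fan
begin

text \<open>
  A union of legs, each without the point \<open>v\<close>, that is clopen in \<open>X - {v}\<close>.
\<close>

definition leg_clopen :: "'a set \<Rightarrow> bool" where
  "leg_clopen P \<longleftrightarrow> P \<subseteq> X - {v} \<and> openin (top_of_set X) P \<and> openin (top_of_set X) (X - {v} - P) \<and>
     (\<forall>x\<in>X. \<forall>y\<in>seg x. y \<noteq> v \<longrightarrow> (x \<in> P \<longleftrightarrow> y \<in> P))"

lemma openin_minus_v: "openin (top_of_set X) (X - {v})"
  by (metis openin_delete openin_subtopology_self)

lemma leg_clopen_empty: "leg_clopen {}"
  using openin_minus_v by (simp add: leg_clopen_def)

lemma ret_inj_level:
  assumes x: "x \<in> level t" and y: "y \<in> level t" and s: "0 < s" "s \<le> t" and eq: "ret s x = ret s y"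
  shows "x = y"
proof -
  have xy: "x \<in> X" "y \<in> X" "h x = t" "h y = t" using x y by (auto simp: level_def)
  have "ret s x \<in> seg x" "ret s x \<in> seg y" "h (ret s x) = s"
    using ret[OF xy(1), of s] ret[OF xy(2), of s] s xy eq by auto
  moreover have "ret s x \<noteq> v" using \<open>h (ret s x) = s\<close> s by auto
  ultimately have "x \<in> seg y \<or> y \<in> seg x" using legs_disjoint xy by blast
  then show ?thesis using same_height_eq xy by simp
qed

text \<open>
  The retraction embeds the higher level into the lower one, so the images of \<open>Q\<close> and of its complement are disjoint
  compact sets, which a clopen set separates.
\<close>

lemma clopen_in_lower_level:
  assumes s: "0 < s" "s \<le> t" and Q: "clopen_in (level t) Q"
  shows "\<exists>Q'. clopen_in (level s) Q' \<and> (\<forall>x\<in>level t. ret s x \<in> Q' \<longleftrightarrow> x \<in> Q)"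
proof -
  have sub: "level t \<subseteq> {x \<in> X. s \<le> h x}" using s by (auto simp: level_def)
  have cont: "continuous_on (level t) (ret s)"
    by (rule continuous_on_subset[OF continuous_on_ret sub]) (use s in simp)
  have low: "ret s x \<in> level s" if "x \<in> level t" for x
    using that ret[of x s] s by (auto simp: level_def)
  have Qt: "Q \<subseteq> level t" using Q clopen_in_subset by blast
  have cQ: "compact (ret s ` Q)"
    using clopen_in_compact[OF compact_level Q] continuous_on_subset[OF cont Qt] by (rule compact_continuous_image[rotated])
  have cQ': "compact (ret s ` (level t - Q))"
    using clopen_in_compact[OF compact_level clopen_in_Diff[OF clopen_in_self Q]]
      continuous_on_subset[OF cont Diff_subset] by (rule compact_continuous_image[rotated])
  have "ret s ` Q \<inter> ret s ` (level t - Q) = {}"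
    using ret_inj_level[OF _ _ s] Qt by blast
  moreover have "ret s ` Q \<subseteq> level s" "ret s ` (level t - Q) \<subseteq> level s" using low Qt by blast+
  ultimately obtain Q' where Q': "clopen_in (level s) Q'" "ret s ` Q \<subseteq> Q'" "Q' \<inter> ret s ` (level t - Q) = {}"
    using clopen_separation[OF compact_level totally_disconnected_level cQ cQ'] by metis
  have "\<forall>x\<in>level t. ret s x \<in> Q' \<longleftrightarrow> x \<in> Q"
    using Q'(2,3) by blast
  with Q'(1) show ?thesis by blast
qed

text \<open>
  Near a point of height above \<open>\<tau> k\<close>, membership in \<open>R\<close> is decided by the continuous retraction onto the level
  \<open>\<tau> k\<close> and by a clopen set there.
\<close>

lemma openin_union_of_levels:
  assumes \<tau>: "\<And>e. 0 < e \<Longrightarrow> \<exists>k::nat. \<tau> k < e" "\<And>k. 0 < \<tau> k" and R: "R \<subseteq> X - {v}"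
    and Q: "\<And>k. clopen_in (level (\<tau> k)) (Q k)" "\<And>k x. x \<in> X \<Longrightarrow> \<tau> k \<le> h x \<Longrightarrow> x \<in> R \<longleftrightarrow> ret (\<tau> k) x \<in> Q k"
  shows "openin (top_of_set X) R"
  unfolding openin_euclidean_subtopology_iff
proof (intro conjI ballI)
  show "R \<subseteq> X" using R by blast
  fix x assume x: "x \<in> R"
  then have xX: "x \<in> X" "0 < h x" using R h_pos by auto
  then obtain k where k: "\<tau> k < h x" using \<tau>(1) by blast
  let ?t = "\<tau> k"
  have t0: "0 \<le> ?t" using \<tau>(2)[of k] by simp
  have xQ: "ret ?t x \<in> Q k" using Q(2)[OF xX(1)] k x by simp
  obtain e where e: "e > 0" "\<And>y. y \<in> level ?t \<Longrightarrow> dist y (ret ?t x) < e \<Longrightarrow> y \<in> Q k"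
    using clopen_in_near[OF Q(1) xQ] by metis
  have xt: "x \<in> {x \<in> X. ?t \<le> h x}" using xX k by simp
  obtain d1 where d1: "d1 > 0" "\<forall>y\<in>{x \<in> X. ?t \<le> h x}. dist y x < d1 \<longrightarrow> dist (ret ?t y) (ret ?t x) < e"
    using continuous_on_near[OF continuous_on_ret[OF t0] xt e(1)] by blast
  have gap: "h x - ?t > 0" using k by simp
  obtain d2 where d2: "d2 > 0" "\<forall>y\<in>X. dist y x < d2 \<longrightarrow> dist (h y) (h x) < h x - ?t"
    using continuous_on_near[OF h_cont xX(1) gap] by blast
  have "y \<in> R" if y: "y \<in> X" "dist y x < min d1 d2" for y
  proof -
    have "dist (h y) (h x) < h x - ?t" using d2(2) y by simp
    then have hy: "?t \<le> h y" by (simp add: dist_real_def)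
    then have "dist (ret ?t y) (ret ?t x) < e" using d1(2) y by simp
    moreover have "ret ?t y \<in> level ?t" using ret[OF y(1) t0 hy] by (simp add: level_def)
    ultimately show ?thesis using e(2) Q(2)[OF y(1) hy] by blast
  qed
  then show "\<exists>d>0. \<forall>x'\<in>X. dist x' x < d \<longrightarrow> x' \<in> R"
    using d1(1) d2(1) by (intro exI[of _ "min d1 d2"]) auto
qed

text \<open>
  The difficulty is with the legs that end below the level \<open>t\<close> and can be arbitrarily short. They are assigned by descending
  through the levels \<open>t / Suc k\<close>; each of these extends the decisions already made and settles the legs that end
  before the preceding level.
\<close>

lemma leg_clopen_extension:
  assumes t: "0 < t" and Q: "clopen_in (level t) Q"
  shows "\<exists>P. leg_clopen P \<and> (\<forall>x\<in>level t. x \<in> P \<longleftrightarrow> x \<in> Q)"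
proof -
  define \<tau> where "\<tau> = (\<lambda>k. t / real (Suc k))"
  have \<tau>: "0 < \<tau> k" "\<tau> (Suc k) \<le> \<tau> k" for k using t by (auto simp: \<tau>_def field_simps)
  have \<tau>0: "\<exists>k. \<tau> k < e" if e: "0 < e" for e
  proof -
    have "0 < e / t" using e t by simp
    then obtain k where "inverse (real (Suc k)) < e / t" using reals_Archimedean by blast
    then have "\<tau> k < e" using t by (simp add: \<tau>_def field_simps)
    then show ?thesis by blast
  qed
  have "\<exists>q. \<forall>k. (clopen_in (level (\<tau> k)) (q k) \<and> (k = 0 \<longrightarrow> q k = Q)) \<and>
     (\<forall>x\<in>level (\<tau> k). ret (\<tau> (Suc k)) x \<in> q (Suc k) \<longleftrightarrow> x \<in> q k)"
  proof (rule dependent_nat_choice[where P = "\<lambda>k A. clopen_in (level (\<tau> k)) A \<and> (k = 0 \<longrightarrow> A = Q)"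
        and Q = "\<lambda>k A B. \<forall>x\<in>level (\<tau> k). ret (\<tau> (Suc k)) x \<in> B \<longleftrightarrow> x \<in> A"])
    show "\<exists>A. clopen_in (level (\<tau> 0)) A \<and> (0 = (0::nat) \<longrightarrow> A = Q)" using Q by (simp add: \<tau>_def)
  next
    fix A k assume "clopen_in (level (\<tau> k)) A \<and> (k = 0 \<longrightarrow> A = Q)"
    then show "\<exists>B. (clopen_in (level (\<tau> (Suc k))) B \<and> (Suc k = 0 \<longrightarrow> B = Q)) \<and>
        (\<forall>x\<in>level (\<tau> k). ret (\<tau> (Suc k)) x \<in> B \<longleftrightarrow> x \<in> A)"
      using clopen_in_lower_level[OF \<tau>(1) \<tau>(2)] by simp
  qed
  then obtain q where q0: "\<forall>k. (clopen_in (level (\<tau> k)) (q k) \<and> (k = 0 \<longrightarrow> q k = Q)) \<and>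
     (\<forall>x\<in>level (\<tau> k). ret (\<tau> (Suc k)) x \<in> q (Suc k) \<longleftrightarrow> x \<in> q k)"
    by (elim exE)
  have q: "clopen_in (level (\<tau> k)) (q k)" "q 0 = Q"
    "x \<in> level (\<tau> k) \<Longrightarrow> ret (\<tau> (Suc k)) x \<in> q (Suc k) \<longleftrightarrow> x \<in> q k" for k x
    using q0 by simp_all
  have dec: "\<tau> j \<le> \<tau> k" if "k \<le> j" for j k using lift_Suc_antimono_le[of \<tau>, OF \<tau>(2) that] .
  have step: "ret (\<tau> j) x \<in> q j \<longleftrightarrow> ret (\<tau> k) x \<in> q k" if "x \<in> X" "\<tau> k \<le> h x" "k \<le> j" for x j k
    using that(3)
  proof (induction j rule: dec_induct)
    case base
    show ?case ..
  next
    case (step i)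
    have i: "0 \<le> \<tau> i" "\<tau> i \<le> h x" using dec[of k i] step.hyps(1) \<tau>(1)[of i] that(2) by auto
    have r: "ret (\<tau> i) x \<in> level (\<tau> i)" "ret (\<tau> i) x \<in> seg x" "h (ret (\<tau> i) x) = \<tau> i"
      using ret[OF that(1) i] by (auto simp: level_def)
    have "ret (\<tau> (Suc i)) (ret (\<tau> i) x) = ret (\<tau> (Suc i)) x"
      using ret_below[OF that(1) r(2)] \<tau>(1)[of "Suc i"] \<tau>(2)[of i] r(3) by simp
    then show ?case using q(3)[OF r(1)] step.IH by simp
  qed
  have same: "ret (\<tau> j) x \<in> q j \<longleftrightarrow> ret (\<tau> k) x \<in> q k" if "x \<in> X" "\<tau> k \<le> h x" "\<tau> j \<le> h x" for x j k
    using step[OF that(1,2), of "max j k"] step[OF that(1,3), of "max j k"] by simp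
  define P where "P = {x \<in> X. \<exists>k. \<tau> k \<le> h x \<and> ret (\<tau> k) x \<in> q k}"
  have P_iff: "x \<in> P \<longleftrightarrow> ret (\<tau> k) x \<in> q k" if "x \<in> X" "\<tau> k \<le> h x" for x k
    using same that unfolding P_def by blast
  have Pv: "P \<subseteq> X - {v}"
    unfolding P_def using \<tau>(1) h_v by (auto simp: not_le[symmetric])
  have o1: "openin (top_of_set X) P"
    by (rule openin_union_of_levels[OF \<tau>0 \<tau>(1) Pv q(1) P_iff])
  have o2: "openin (top_of_set X) (X - {v} - P)"
  proof (rule openin_union_of_levels[OF \<tau>0 \<tau>(1), where Q = "\<lambda>k. level (\<tau> k) - q k"])
    show "clopen_in (level (\<tau> k)) (level (\<tau> k) - q k)" for k
      using clopen_in_Diff[OF clopen_in_self q(1)] .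
    fix k x assume x: "x \<in> X" "\<tau> k \<le> h x"
    have "x \<noteq> v" using x \<tau>(1)[of k] by auto
    moreover have "ret (\<tau> k) x \<in> level (\<tau> k)" using ret[OF x(1) _ x(2)] \<tau>(1)[of k] by (simp add: level_def)
    ultimately show "x \<in> X - {v} - P \<longleftrightarrow> ret (\<tau> k) x \<in> level (\<tau> k) - q k" using P_iff[OF x] x by simp
  qed auto
  have "x \<in> P \<longleftrightarrow> y \<in> P" if xy: "x \<in> X" "y \<in> seg x" "y \<noteq> v" for x y
  proof -
    have y: "y \<in> X" using seg_mem_X xy by blast
    obtain k where k: "\<tau> k < h y" using \<tau>0 h_pos[OF y xy(3)] by blast
    then have "ret (\<tau> k) y = ret (\<tau> k) x" using ret_below[OF xy(1,2)] \<tau>(1)[of k] by simp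
    moreover have "\<tau> k \<le> h x" using k h_mono[OF xy(1,2)] by simp
    ultimately show ?thesis using P_iff[OF y, of k] P_iff[OF xy(1), of k] k by simp
  qed
  then have "leg_clopen P" using Pv o1 o2 unfolding leg_clopen_def by blast
  moreover have "x \<in> P \<longleftrightarrow> x \<in> Q" if "x \<in> level t" for x
  proof -
    have x: "x \<in> X" "h x = t" "\<tau> 0 = t" using that by (auto simp: level_def \<tau>_def)
    then have "ret (\<tau> 0) x = x" using ret_self[OF x(1)] by simp
    then show ?thesis using P_iff[OF x(1), of 0] x q(2) by simp
  qed
  ultimately show ?thesis by blast
qed

text \<open>
  Partition each of the levels \<open>inverse (Suc n)\<close> into cells of diameter less than \<open>inverse (Suc j)\<close>, and extend the
  cells to sets of legs. Two legs pass through distinct points of some low level, and a partition with \<open>j\<close>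
  large enough separates these.
\<close>

lemma separating_leg_clopens:
  "\<exists>P::nat \<Rightarrow> 'a set. (\<forall>k. leg_clopen (P k)) \<and>
     (\<forall>x\<in>X - {v}. \<forall>y\<in>X - {v}. x \<notin> seg y \<and> y \<notin> seg x \<longrightarrow> (\<exists>k. x \<in> P k \<and> y \<notin> P k))"
proof -
  define r where "r = (\<lambda>n::nat. inverse (real (Suc n)))"
  have r: "0 < r n" for n by (simp add: r_def)
  have "\<exists>\<P>. finite \<P> \<and> (\<forall>P\<in>\<P>. leg_clopen P) \<and>
    (\<forall>x\<in>level (r n). \<forall>y\<in>level (r n). r j \<le> dist x y \<longrightarrow> (\<exists>P\<in>\<P>. x \<in> P \<and> y \<notin> P))" for n j
  proof -
    obtain \<A> where \<A>: "finite \<A>" "disjoint \<A>" "\<Union>\<A> = level (r n)"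
      "\<And>A. A \<in> \<A> \<Longrightarrow> clopen_in (level (r n)) A \<and> A \<noteq> {}"
      "\<And>A x y. A \<in> \<A> \<Longrightarrow> x \<in> A \<Longrightarrow> y \<in> A \<Longrightarrow> dist x y < r j"
      using clopen_partition[OF compact_level totally_disconnected_level r] by metis
    have "\<forall>A\<in>\<A>. \<exists>P. leg_clopen P \<and> (\<forall>x\<in>level (r n). x \<in> P \<longleftrightarrow> x \<in> A)"
      using leg_clopen_extension[OF r] \<A>(4) by blast
    from bchoice[OF this] obtain f where f: "\<forall>A\<in>\<A>. leg_clopen (f A) \<and> (\<forall>x\<in>level (r n). x \<in> f A \<longleftrightarrow> x \<in> A)"
      by (elim exE)
    have "\<exists>P\<in>f ` \<A>. x \<in> P \<and> y \<notin> P" if xy: "x \<in> level (r n)" "y \<in> level (r n)" "r j \<le> dist x y" for x y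
    proof -
      obtain A where A: "A \<in> \<A>" "x \<in> A" using \<A>(3) xy(1) by blast
      have "y \<notin> A" using \<A>(5)[OF A] xy(3) by fastforce
      then show ?thesis using f A xy by blast
    qed
    then show ?thesis using f \<A>(1) by (intro exI[of _ "f ` \<A>"]) blast
  qed
  then have "\<forall>z. \<exists>\<P>. finite \<P> \<and> (\<forall>P\<in>\<P>. leg_clopen P) \<and>
    (\<forall>x\<in>level (r (fst z)). \<forall>y\<in>level (r (fst z)). r (snd z) \<le> dist x y \<longrightarrow> (\<exists>P\<in>\<P>. x \<in> P \<and> y \<notin> P))"
    by blast
  from choice[OF this] obtain F where F: "\<forall>z. finite (F z) \<and> (\<forall>P\<in>F z. leg_clopen P) \<and>
    (\<forall>x\<in>level (r (fst z)). \<forall>y\<in>level (r (fst z)). r (snd z) \<le> dist x y \<longrightarrow> (\<exists>P\<in>F z. x \<in> P \<and> y \<notin> P))"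
    by (elim exE)
  define \<F> where "\<F> = insert {} (\<Union>z. F z)"
  have "countable (\<Union>z. F z)" using F by (intro countable_UN) (auto simp: countable_finite)
  then have cF: "countable \<F>" by (simp add: \<F>_def)
  have neF: "\<F> \<noteq> {}" by (simp add: \<F>_def)
  have legF: "leg_clopen P" if "P \<in> \<F>" for P
    using that F leg_clopen_empty by (auto simp: \<F>_def)
  have "\<exists>k. x \<in> from_nat_into \<F> k \<and> y \<notin> from_nat_into \<F> k"
    if xy: "x \<in> X - {v}" "y \<in> X - {v}" "x \<notin> seg y" "y \<notin> seg x" for x y
  proof -
    have x: "x \<in> X" and y: "y \<in> X" using xy by auto
    have "0 < min (h x) (h y)" using h_pos xy by simp
    then obtain n where n: "r n < min (h x) (h y)" unfolding r_def using reals_Archimedean by blast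
    define a where "a = ret (r n) x"
    define b where "b = ret (r n) y"
    have a: "a \<in> seg x" "h a = r n" "a \<in> X" using ret[OF x, of "r n"] n r[of n] by (auto simp: a_def)
    have b: "b \<in> seg y" "h b = r n" "b \<in> X" using ret[OF y, of "r n"] n r[of n] by (auto simp: b_def)
    have av: "a \<noteq> v" "b \<noteq> v" using a(2) b(2) r[of n] by auto
    have "a \<noteq> b" using legs_disjoint[OF x y a(1)] b(1) av(1) xy(3,4) by auto
    then have "0 < dist a b" by simp
    then obtain j where j: "r j < dist a b" unfolding r_def using reals_Archimedean by blast
    have "a \<in> level (r n)" "b \<in> level (r n)" using a b by (auto simp: level_def)
    moreover have "\<forall>x\<in>level (r n). \<forall>y\<in>level (r n). r j \<le> dist x y \<longrightarrow> (\<exists>P\<in>F (n, j). x \<in> P \<and> y \<notin> P)"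
      using spec[OF F, of "(n, j)"] by simp
    ultimately have "\<exists>P\<in>F (n, j). a \<in> P \<and> b \<notin> P" using j by (meson less_imp_le)
    then obtain P where P: "P \<in> F (n, j)" "a \<in> P" "b \<notin> P" by blast
    have leg: "leg_clopen P" using F P(1) by blast
    have "x \<in> P" "y \<notin> P" using leg P(2,3) a b av x y unfolding leg_clopen_def by blast+
    moreover have "P \<in> \<F>" using P(1) by (auto simp: \<F>_def)
    then obtain k where "from_nat_into \<F> k = P" using from_nat_into_surj[OF cF] by blast
    ultimately show ?thesis by blast
  qed
  then show ?thesis
    using legF from_nat_into[OF neF] by (intro exI[of _ "from_nat_into \<F>"]) blast
qed

end

section \<open>A smooth fan as a collapsed hypograph\<close>

text \<open>
  The map \<open>q\<close> exhibits \<open>L\<close> as the hypograph with its zero level collapsed.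
\<close>

definition fan_chart :: "'a::metric_space set \<Rightarrow> 'c::metric_space set \<Rightarrow> ('c \<Rightarrow> real) \<Rightarrow> ('c \<times> real \<Rightarrow> 'a) \<Rightarrow> bool" where
  "fan_chart L C \<phi> q \<longleftrightarrow> continuous_on (hypograph C \<phi>) q \<and> q ` hypograph C \<phi> = L \<and>
     (\<forall>p\<in>hypograph C \<phi>. \<forall>p'\<in>hypograph C \<phi>. q p = q p' \<longleftrightarrow> p = p' \<or> snd p = 0 \<and> snd p' = 0)"

locale coded_smooth_fan = measured_smooth_fan X v h for X :: "'a::metric_space set" and v h +
  fixes P :: "nat \<Rightarrow> 'a set"
  assumes leg: "\<And>k. leg_clopen (P k)"
    and sep: "\<And>x y. x \<in> X - {v} \<Longrightarrow> y \<in> X - {v} \<Longrightarrow> x \<notin> seg y \<Longrightarrow> y \<notin> seg x \<Longrightarrow> \<exists>k. x \<in> P k \<and> y \<notin> P k"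
begin

definition code :: "'a \<Rightarrow> nat \<Rightarrow> real" where
  "code x k = (if x \<in> P k then 1 else 0)"

text \<open>
  Codes in the closure that belong to no leg are assigned the length \<open>0\<close>; in the fan they all become \<open>v\<close>.
\<close>

definition codeset :: "(nat \<Rightarrow> real) set" where
  "codeset = closure (code ` (X - {v}))"

definition length_fn :: "(nat \<Rightarrow> real) \<Rightarrow> real" where
  "length_fn c = Sup (insert 0 (h ` {x \<in> X - {v}. code x = c}))"

definition point :: "(nat \<Rightarrow> real) \<times> real \<Rightarrow> 'a" where
  "point p = (if snd p = 0 then v else THE x. x \<in> X - {v} \<and> code x = fst p \<and> h x = snd p)"

lemma code_comparable:
  assumes "x \<in> X - {v}" "y \<in> X - {v}" "code x = code y"
  shows "x \<in> seg y \<or> y \<in> seg x"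
proof -
  have "x \<in> P k \<longleftrightarrow> y \<in> P k" for k
    using fun_cong[OF assms(3), of k] by (auto simp: code_def split: if_splits)
  then show ?thesis using sep[OF assms(1,2)] by blast
qed

lemma code_inj:
  assumes "x \<in> X - {v}" "y \<in> X - {v}" "code x = code y" "h x = h y"
  shows "x = y"
  using code_comparable[OF assms(1-3)] same_height_eq assms by blast

lemma code_leg: "x \<in> X \<Longrightarrow> y \<in> seg x \<Longrightarrow> y \<noteq> v \<Longrightarrow> code y = code x"
  using leg unfolding leg_clopen_def code_def fun_eq_iff by auto

lemma continuous_on_code: "continuous_on (X - {v}) code"
proof (rule continuous_on_coordinatewise_then_product)
  fix k
  show "continuous_on (X - {v}) (\<lambda>x. code x k)"
    unfolding continuous_on_iff
  proof (intro ballI allI impI)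
    fix x and e :: real assume x: "x \<in> X - {v}" and e: "0 < e"
    have op: "openin (top_of_set X) (P k)" "openin (top_of_set X) (X - {v} - P k)"
      using leg[of k] by (auto simp: leg_clopen_def)
    have "\<exists>d>0. \<forall>y\<in>X. dist y x < d \<longrightarrow> (y \<in> P k \<longleftrightarrow> x \<in> P k)"
    proof (cases "x \<in> P k")
      case True
      then show ?thesis using op(1) unfolding openin_euclidean_subtopology_iff by blast
    next
      case False
      then have "x \<in> X - {v} - P k" using x by simp
      then show ?thesis using op(2) False unfolding openin_euclidean_subtopology_iff by blast
    qed
    then obtain d where "d > 0" "\<forall>y\<in>X. dist y x < d \<longrightarrow> (y \<in> P k \<longleftrightarrow> x \<in> P k)" by blast
    then show "\<exists>d>0. \<forall>y\<in>X - {v}. dist y x < d \<longrightarrow> dist (code y k) (code x k) < e"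
      using e by (intro exI[of _ d]) (simp add: code_def)
  qed
qed

lemma codeset_sub: "codeset \<subseteq> {c. \<forall>i. c i \<in> {0, 1}}"
proof -
  have "closed {c::nat \<Rightarrow> real. \<forall>i. c i \<in> {0, 1}}"
    by (intro compact_imp_closed compact_finite_products) simp
  then show ?thesis unfolding codeset_def by (intro closure_minimal) (auto simp: code_def)
qed

lemma compact_codeset: "compact codeset"
proof -
  have "compact {c::nat \<Rightarrow> real. \<forall>i. c i \<in> {0, 1}}" by (intro compact_finite_products) simp
  then have "compact ({c. \<forall>i. c i \<in> {0, 1}} \<inter> codeset)"
    by (rule compact_Int_closed) (simp add: codeset_def)
  then show ?thesis using codeset_sub by (simp add: Int_absorb1)
qed

lemma h_bounded: "\<exists>M. \<forall>x\<in>X. h x \<le> M"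
proof -
  have "compact (h ` X)" using h_cont X_props(1) by (rule compact_continuous_image)
  then have "bdd_above (h ` X)" by (intro bounded_imp_bdd_above compact_imp_bounded)
  then show ?thesis by (auto simp: bdd_above_def)
qed

lemma limit_in_fan:
  assumes s: "\<And>n::nat. s n \<in> X" and y: "s \<longlonglongrightarrow> y"
  shows "y \<in> X" "(\<lambda>n. h (s n)) \<longlonglongrightarrow> h y"
    "y \<noteq> v \<Longrightarrow> (\<lambda>n. code (s n)) \<longlonglongrightarrow> code y"
proof -
  show yX: "y \<in> X" using closed_sequentially[OF compact_imp_closed[OF X_props(1)] s y] .
  show "(\<lambda>n. h (s n)) \<longlonglongrightarrow> h y"
    using continuous_on_tendsto_compose[OF h_cont y yX] s by simp
  assume yv: "y \<noteq> v"
  have "open (- {v})" "y \<in> - {v}" using yv by auto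
  then have "eventually (\<lambda>n. s n \<in> - {v}) sequentially" using y by (rule topological_tendstoD[rotated])
  then have "eventually (\<lambda>n. s n \<in> X - {v}) sequentially" by eventually_elim (use s in auto)
  then show "(\<lambda>n. code (s n)) \<longlonglongrightarrow> code y"
    using continuous_on_tendsto_compose[OF continuous_on_code y] yX yv by simp
qed

lemma bdd_length: "bdd_above (insert 0 (h ` {x \<in> X - {v}. code x = c}))"
proof -
  obtain M where "\<forall>x\<in>X. h x \<le> M" using h_bounded by blast
  then show ?thesis by (intro bdd_aboveI[of _ "max 0 M"]) auto
qed

lemma length_upper: "x \<in> X - {v} \<Longrightarrow> h x \<le> length_fn (code x)"
  unfolding length_fn_def using bdd_length by (intro cSup_upper) auto

lemma length_nonneg: "0 \<le> length_fn c"
  unfolding length_fn_def using bdd_length by (intro cSup_upper) auto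

text \<open>
  Points of the leg whose heights approach the supremum accumulate at a point of the fan. It is not \<open>v\<close>, since its height is
  positive; so its code is the common code.
\<close>

lemma leg_top:
  assumes pos: "0 < length_fn c"
  obtains x where "x \<in> X - {v}" "code x = c" "h x = length_fn c"
proof -
  define S where "S = insert 0 (h ` {x \<in> X - {v}. code x = c})"
  have L: "length_fn c = Sup S" by (simp add: length_fn_def S_def)
  have "\<exists>x. x \<in> X - {v} \<and> code x = c \<and> length_fn c - inverse (real (Suc n)) < h x" for n
  proof -
    have "max 0 (length_fn c - inverse (real (Suc n))) < Sup S" using pos L by simp
    moreover have "S \<noteq> {}" by (simp add: S_def)
    ultimately obtain t where t: "t \<in> S" "max 0 (length_fn c - inverse (real (Suc n))) < t"
      using less_cSupD by blast
    then have "t \<in> h ` {x \<in> X - {v}. code x = c}" unfolding S_def by auto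
    then show ?thesis using t(2) by auto
  qed
  then have "\<forall>n. \<exists>x. x \<in> X - {v} \<and> code x = c \<and> length_fn c - inverse (real (Suc n)) < h x" by blast
  from choice[OF this] obtain s where s: "\<forall>n. s n \<in> X - {v} \<and> code (s n) = c \<and> length_fn c - inverse (real (Suc n)) < h (s n)"
    by (elim exE)
  have "\<forall>n. s n \<in> X" using s by blast
  from seq_compactE[OF compact_imp_seq_compact[OF X_props(1)] this]
  obtain y r where y: "y \<in> X" "strict_mono r" "(s \<circ> r) \<longlonglongrightarrow> y" by metis
  have sr: "(s \<circ> r) n \<in> X" for n using s by simp
  have hy: "(\<lambda>n. h ((s \<circ> r) n)) \<longlonglongrightarrow> h y" using limit_in_fan(2)[OF sr y(3)] .
  have "(\<lambda>n. h ((s \<circ> r) n)) \<longlonglongrightarrow> length_fn c"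
  proof (rule tendsto_sandwich)
    show "\<forall>\<^sub>F n in sequentially. length_fn c - inverse (real (Suc n)) \<le> h ((s \<circ> r) n)"
    proof (rule always_eventually, rule allI)
      fix n
      have "inverse (real (Suc (r n))) \<le> inverse (real (Suc n))"
        using seq_suble[OF y(2), of n] by (intro le_imp_inverse_le) auto
      moreover have "length_fn c - inverse (real (Suc (r n))) < h (s (r n))" using s by blast
      ultimately show "length_fn c - inverse (real (Suc n)) \<le> h ((s \<circ> r) n)"
        unfolding o_def by linarith
    qed
    show "\<forall>\<^sub>F n in sequentially. h ((s \<circ> r) n) \<le> length_fn c"
      using s length_upper by (intro always_eventually allI) fastforce
    show "(\<lambda>n. length_fn c - inverse (real (Suc n))) \<longlonglongrightarrow> length_fn c"
      using tendsto_diff[OF tendsto_const LIMSEQ_inverse_real_of_nat] by simp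
  qed auto
  then have h: "h y = length_fn c" using hy LIMSEQ_unique by blast
  then have yv: "y \<noteq> v" using pos by auto
  have "(\<lambda>n. code ((s \<circ> r) n)) \<longlonglongrightarrow> code y" using limit_in_fan(3)[OF sr y(3) yv] .
  moreover have "code ((s \<circ> r) n) = c" for n using s by simp
  ultimately have "code y = c" by (simp add: LIMSEQ_const_iff)
  then show ?thesis using that[of y] y(1) yv h by simp
qed

lemma le_length_iff:
  assumes "0 < t"
  shows "t \<le> length_fn c \<longleftrightarrow> (\<exists>x\<in>X - {v}. code x = c \<and> h x = t)"
proof
  assume t: "t \<le> length_fn c"
  then have "0 < length_fn c" using assms by simp
  then obtain x where x: "x \<in> X - {v}" "code x = c" "h x = length_fn c" by (rule leg_top)
  then have r: "ret t x \<in> seg x" "h (ret t x) = t" "ret t x \<in> X" using ret[of x t] assms t by auto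
  then have "ret t x \<noteq> v" using assms by auto
  then show "\<exists>x\<in>X - {v}. code x = c \<and> h x = t" using r code_leg[of x "ret t x"] x by blast
next
  assume "\<exists>x\<in>X - {v}. code x = c \<and> h x = t"
  then show "t \<le> length_fn c" using length_upper by blast
qed

lemma point_code: "x \<in> X - {v} \<Longrightarrow> point (code x, h x) = x"
  unfolding point_def using code_inj h_pos[of x] by (auto intro!: the_equality)

lemma point_props:
  assumes "p \<in> hypograph codeset length_fn"
  shows "point p \<in> X" "h (point p) = snd p" "snd p \<noteq> 0 \<Longrightarrow> point p \<noteq> v \<and> code (point p) = fst p"
proof -
  have "point p \<in> X \<and> h (point p) = snd p \<and> (snd p \<noteq> 0 \<longrightarrow> point p \<noteq> v \<and> code (point p) = fst p)"
  proof (cases "snd p = 0")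
    case True
    then show ?thesis using X_props(3) by (simp add: point_def)
  next
    case False
    then have "0 < snd p" "snd p \<le> length_fn (fst p)" using assms by (auto simp: hypograph_def)
    then obtain x where x: "x \<in> X - {v}" "code x = fst p" "h x = snd p" using le_length_iff by blast
    then have "point p = x" using point_code[OF x(1)] by (metis prod.collapse)
    then show ?thesis using x by simp
  qed
  then show "point p \<in> X" "h (point p) = snd p" "snd p \<noteq> 0 \<Longrightarrow> point p \<noteq> v \<and> code (point p) = fst p" by auto
qed

lemma code_in_hypograph: "x \<in> X - {v} \<Longrightarrow> (code x, h x) \<in> hypograph codeset length_fn"
  using length_upper h_nonneg closure_subset[of "code ` (X - {v})"] by (auto simp: codeset_def)

text \<open>
  Over the zero level only the height matters, since \<open>v\<close> is the only point of height \<open>0\<close>. Elsewhere the limit is not \<open>v\<close>,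
  and the code is continuous there.
\<close>

lemma point_limit:
  assumes s: "\<And>n::nat. s n \<in> hypograph codeset length_fn" "s \<longlonglongrightarrow> p" and y: "(\<lambda>n. point (s n)) \<longlonglongrightarrow> y"
  shows "p \<in> hypograph codeset length_fn" "y = point p"
proof -
  have sX: "point (s n) \<in> X" for n using point_props(1)[OF s(1)] .
  have yX: "y \<in> X" using limit_in_fan(1)[OF sX y] .
  have "(\<lambda>n. h (point (s n))) \<longlonglongrightarrow> h y" using limit_in_fan(2)[OF sX y] .
  then have "(\<lambda>n. snd (s n)) \<longlonglongrightarrow> h y" using point_props(2)[OF s(1)] by simp
  moreover have "(\<lambda>n. snd (s n)) \<longlonglongrightarrow> snd p" using s(2) by (rule tendsto_snd)
  ultimately have h: "h y = snd p" using LIMSEQ_unique by blast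
  have "closed codeset" by (simp add: codeset_def)
  moreover have "fst (s n) \<in> codeset" for n using s(1)[of n] by (auto simp: hypograph_def)
  ultimately have fC: "fst p \<in> codeset" using tendsto_fst[OF s(2)] by (rule closed_sequentially)
  have "p \<in> hypograph codeset length_fn \<and> y = point p"
  proof (cases "snd p = 0")
    case True
    then have "y = v" using h h_eq_0 yX by simp
    then show ?thesis using True fC length_nonneg by (auto simp: hypograph_def point_def)
  next
    case False
    then have yv: "y \<noteq> v" using h by auto
    then have pos: "0 < snd p" using h h_pos[OF yX] by simp
    have lim: "(\<lambda>n. code (point (s n))) \<longlonglongrightarrow> code y" using limit_in_fan(3)[OF sX y yv] .
    have "eventually (\<lambda>n. 0 < snd (s n)) sequentially"
      using order_tendstoD(1)[OF tendsto_snd[OF s(2)] pos] .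
    then have "eventually (\<lambda>n. code (point (s n)) = fst (s n)) sequentially"
      by eventually_elim (use point_props(3)[OF s(1)] in auto)
    then have "(\<lambda>n. fst (s n)) \<longlonglongrightarrow> code y" using lim by (rule Lim_transform_eventually[rotated])
    then have c: "code y = fst p" using tendsto_fst[OF s(2)] LIMSEQ_unique by blast
    have "p = (code y, h y)" using c h by (simp add: prod_eq_iff)
    then show ?thesis using code_in_hypograph[of y] point_code[of y] yX yv by simp
  qed
  then show "p \<in> hypograph codeset length_fn" "y = point p" by auto
qed

lemma X_minus_v: "X - {v} \<noteq> {}"
proof -
  obtain T g g' where T: "T \<subseteq> X" "homeomorphism standard_triod T g g'" "g (0, 0) = v"
    using ram unfolding ramification_point_def by blast
  have p: "(1, 0) \<in> standard_triod" "(0, 0) \<in> standard_triod" by (auto simp: standard_triod_def)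
  then have "g' (g (1, 0)) = (1, 0)" "g' (g (0, 0)) = (0, 0)" "g (1, 0) \<in> T"
    using T(2) unfolding homeomorphism_def by blast+
  then have "g (1, 0) \<in> X - {v}" using T by auto
  then show ?thesis by blast
qed

lemma fan_chart_point: "fan_chart X codeset length_fn point"
  unfolding fan_chart_def
proof (intro conjI ballI)
  show "continuous_on (hypograph codeset length_fn) point"
    using point_props(1) point_limit(2) by (intro continuous_on_compact_closed_graph[OF X_props(1)]) blast+
  show "point ` hypograph codeset length_fn = X"
  proof
    show "point ` hypograph codeset length_fn \<subseteq> X" using point_props(1) by blast
    show "X \<subseteq> point ` hypograph codeset length_fn"
    proof
      fix x assume x: "x \<in> X"
      show "x \<in> point ` hypograph codeset length_fn"
      proof (cases "x = v")
        case False
        then have "x \<in> X - {v}" using x by simp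
        then have "(code x, h x) \<in> hypograph codeset length_fn" "x = point (code x, h x)"
          using code_in_hypograph point_code by simp_all
        then show ?thesis by (rule rev_image_eqI)
      next
        case True
        obtain y where "y \<in> X - {v}" using X_minus_v by blast
        then have "(code y, 0) \<in> hypograph codeset length_fn"
          using code_in_hypograph[of y] length_nonneg by simp
        moreover have "point (code y, 0) = v" by (simp add: point_def)
        ultimately show ?thesis using True by (metis imageI)
      qed
    qed
  qed
  fix p p' assume p: "p \<in> hypograph codeset length_fn" "p' \<in> hypograph codeset length_fn"
  show "point p = point p' \<longleftrightarrow> p = p' \<or> snd p = 0 \<and> snd p' = 0"
  proof
    assume eq: "point p = point p'"
    then have "snd p = snd p'" using point_props(2) p by metis
    moreover have "fst p = fst p'" if "snd p \<noteq> 0" using point_props(3)[OF p(1)] point_props(3)[OF p(2)] eq that calculation by simp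
    ultimately show "p = p' \<or> snd p = 0 \<and> snd p' = 0" by (auto simp: prod_eq_iff)
  qed (auto simp: point_def)
qed

text \<open>
  As an end of the arc from \<open>v\<close> to \<open>z\<close>, the point \<open>x\<close> does not disconnect it. But a connected subset that contains \<open>v\<close>
  and \<open>z\<close> is the whole arc.
\<close>

lemma endpoint_maximal:
  assumes x: "x \<in> end_points X" "x \<noteq> v" and z: "z \<in> X" "x \<in> seg z"
  shows "x = z"
proof (rule ccontr)
  assume xz: "x \<noteq> z"
  have zv: "z \<noteq> v" using z(2) x(2) by auto
  have arc: "arc_between (seg z) v z" using seg_arc(2)[OF z(1) zv] .
  then have "seg z homeomorphic {0..1::real}"
    unfolding arc_between_def homeomorphic_def using homeomorphism_symD by blast
  then obtain y where "arc_between (seg z) x y"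
    using x(1) z seg_props(1)[OF z(1)] unfolding end_points_def by blast
  then obtain g where g: "continuous_on {0..1::real} g" "inj_on g {0..1}" "g ` {0..1} = seg z" "g 0 = x" "g 1 = y"
    by (rule arc_betweenE)
  have eq: "seg z - {x} = g ` {0<..1}"
  proof -
    have "{0..1::real} = insert 0 {0<..1}" by auto
    then have "seg z = insert x (g ` {0<..1})" using g(3,4) by (metis image_insert)
    moreover have "x \<notin> g ` {0<..1}"
    proof
      assume "x \<in> g ` {0<..1}"
      then obtain s where "s \<in> {0<..1}" "g 0 = g s" using g(4) by auto
      then show False using inj_onD[OF g(2), of 0 s] by auto
    qed
    ultimately show ?thesis by auto
  qed
  have "continuous_on {0<..1} g" by (rule continuous_on_subset[OF g(1)]) auto
  then have "connected (seg z - {x})" unfolding eq by (rule connected_continuous_image) simp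
  then have "seg z - {x} = seg z"
    using arc_connected_subset[OF arc, of "seg z - {x}"] seg_props(4,5)[OF z(1)] x(2) xz by auto
  then show False using z(2) by blast
qed

lemma endpoint_length:
  assumes x: "x \<in> end_points X" "x \<noteq> v"
  shows "length_fn (code x) = h x"
proof -
  have xX: "x \<in> X - {v}" using x by (auto simp: end_points_def)
  then have "0 < length_fn (code x)" using length_upper[of x] h_pos[of x] by auto
  then obtain z where z: "z \<in> X - {v}" "code z = code x" "h z = length_fn (code x)" by (rule leg_top)
  have "x \<in> seg z"
  proof (rule ccontr)
    assume "x \<notin> seg z"
    then have "z \<in> seg x" using code_comparable[OF xX z(1)] z(2) by simp
    moreover have "h x \<le> h z" using length_upper[OF xX] z(3) by simp
    ultimately have "z = x" using h_mono[of x z] h_strict[of x z] xX by force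
    then show False using \<open>x \<notin> seg z\<close> seg_props(5) xX by auto
  qed
  then have "x = z" using endpoint_maximal[OF x] z(1) by blast
  then show ?thesis using z(3) by simp
qed

lemma lelek_function_length:
  assumes dense: "closure (end_points X) = X"
  shows "lelek_function codeset length_fn"
  unfolding lelek_function_def
proof (intro conjI ballI allI impI)
  show "compact codeset" by (rule compact_codeset)
  show "totally_disconnected codeset"
    using codeset_sub by (intro totally_disconnected_finite_products[of "\<lambda>_. {0, 1}"]) auto
  show "0 \<le> length_fn c" for c by (rule length_nonneg)
  have "point ` hypograph codeset length_fn = X"
    using fan_chart_point by (simp add: fan_chart_def)
  then have "hypograph codeset length_fn \<noteq> {}" using X_props(3) by auto
  then show "codeset \<noteq> {}" by (auto simp: hypograph_def)
  show "compact (hypograph codeset length_fn)"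
    unfolding compact_eq_seq_compact_metric
  proof (rule seq_compactI)
    fix s assume s: "\<forall>n::nat. s n \<in> hypograph codeset length_fn"
    obtain M where M: "\<forall>x\<in>X. h x \<le> M" using h_bounded by blast
    have "s n \<in> codeset \<times> {0..M}" for n
    proof -
      have "h (point (s n)) \<le> M" using M point_props(1) s by blast
      then have "snd (s n) \<le> M" using point_props(2) s by simp
      moreover have "fst (s n) \<in> codeset" "0 \<le> snd (s n)" using s by (auto simp: hypograph_def)
      ultimately show ?thesis by (simp add: mem_Times_iff)
    qed
    then have s1: "\<forall>n. s n \<in> codeset \<times> {0..M}" by blast
    have "compact (codeset \<times> {0..M})" by (intro compact_Times compact_codeset compact_Icc)
    from seq_compactE[OF compact_imp_seq_compact[OF this] s1]
    obtain p r where p: "strict_mono r" "(s \<circ> r) \<longlonglongrightarrow> p" by metis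
    have "\<forall>n. point ((s \<circ> r) n) \<in> X" using point_props(1) s by simp
    from seq_compactE[OF compact_imp_seq_compact[OF X_props(1)] this]
    obtain y r' where y: "strict_mono r'" "((\<lambda>n. point ((s \<circ> r) n)) \<circ> r') \<longlonglongrightarrow> y" by metis
    have "(\<lambda>n. (s \<circ> r) (r' n)) \<longlonglongrightarrow> p"
      using LIMSEQ_subseq_LIMSEQ[OF p(2) y(1)] by (simp add: o_def)
    moreover have "(\<lambda>n. point ((s \<circ> r) (r' n))) \<longlonglongrightarrow> y" using y(2) by (simp add: o_def)
    moreover have "(s \<circ> r) (r' n) \<in> hypograph codeset length_fn" for n using s by simp
    ultimately have "p \<in> hypograph codeset length_fn" using point_limit(1)[of "\<lambda>n. (s \<circ> r) (r' n)"] by blast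
    then show "\<exists>l\<in>hypograph codeset length_fn. \<exists>r. strict_mono r \<and> (s \<circ> r) \<longlonglongrightarrow> l" using p by blast
  qed
  \<comment> \<open>near a point of positive height there is an end-point, and its code and height are close\<close>
  have pos: "\<exists>c'\<in>codeset. dist c' c < e \<and> 0 < length_fn c' \<and> \<bar>length_fn c' - t\<bar> < e"
    if t: "0 < t" "t \<le> length_fn c" and e: "0 < e" for c t e
  proof -
    obtain x where x: "x \<in> X - {v}" "code x = c" "h x = t" using le_length_iff[OF t(1)] t(2) by blast
    obtain d1 where d1: "d1 > 0" "\<forall>y\<in>X - {v}. dist y x < d1 \<longrightarrow> dist (code y) (code x) < e"
      using continuous_on_near[OF continuous_on_code x(1) e] by blast
    obtain d2 where d2: "d2 > 0" "\<forall>y\<in>X. dist y x < d2 \<longrightarrow> dist (h y) (h x) < e"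
      using continuous_on_near[OF h_cont _ e, of x] x(1) by blast
    have d: "0 < min (min d1 d2) (dist x v)" using d1(1) d2(1) x(1) by simp
    have "x \<in> closure (end_points X)" using dense x(1) by simp
    then obtain y where y: "y \<in> end_points X" "dist y x < min (min d1 d2) (dist x v)"
      using d unfolding closure_approachable by blast
    have yv: "y \<noteq> v" using y(2) by (auto simp: dist_commute)
    have yX: "y \<in> X - {v}" using y(1) yv by (auto simp: end_points_def)
    have len: "length_fn (code y) = h y" using endpoint_length[OF y(1) yv] .
    have "code y \<in> codeset" using code_in_hypograph[OF yX] by simp
    moreover have "dist (code y) c < e" using d1(2) yX y(2) x(2) by auto
    moreover have "0 < length_fn (code y)" using len h_pos yX by simp
    moreover have "\<bar>length_fn (code y) - t\<bar> < e" using d2(2) yX y(2) x(3) len by (simp add: dist_real_def)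
    ultimately show ?thesis by blast
  qed
  fix c t e assume c: "c \<in> codeset" and te: "0 \<le> t \<and> t \<le> length_fn c \<and> (0::real) < e"
  show "\<exists>c'\<in>codeset. dist c' c < e \<and> 0 < length_fn c' \<and> \<bar>length_fn c' - t\<bar> < e"
  proof (cases "t = 0")
    case False
    then show ?thesis using pos te by simp
  next
    case True
    have "0 < e/2" using te by simp
    then obtain c1 where c1: "c1 \<in> code ` (X - {v})" "dist c1 c < e/2"
      using c unfolding codeset_def closure_approachable by blast
    then obtain x where x: "x \<in> X - {v}" "c1 = code x" by blast
    have lp: "0 < length_fn c1" using length_upper[OF x(1)] h_pos[of x] x by auto
    obtain c' where c': "c' \<in> codeset" "dist c' c1 < e/2" "0 < length_fn c'" "\<bar>length_fn c' - min (e/2) (length_fn c1)\<bar> < e/2"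
      using pos[of "min (e/2) (length_fn c1)" c1 "e/2"] lp te by auto
    have "dist c' c \<le> dist c' c1 + dist c1 c" by (rule dist_triangle)
    then have "dist c' c < e" using c'(2) c1(2) by simp
    moreover have "min (e/2) (length_fn c1) \<le> e/2" by simp
    then have "\<bar>length_fn c' - t\<bar> < e" using c'(3,4) True by linarith
    ultimately show ?thesis using c' by blast
  qed
qed

end

theorem lelek_fan_chart:
  fixes L :: "'a::metric_space set"
  assumes "lelek_fan L"
  shows "\<exists>(C::(nat \<Rightarrow> real) set) \<phi> q. lelek_function C \<phi> \<and> fan_chart L C \<phi> q"
proof -
  obtain v where v: "fan L" "ramification_point L v"
    "\<forall>x\<in>L. \<forall>s::nat \<Rightarrow> 'a. (\<forall>n. s n \<in> L) \<and> s \<longlonglongrightarrow> x \<longrightarrow>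
          (\<lambda>n. hausdorff_dist (arc_in L v (s n)) (arc_in L v x)) \<longlonglongrightarrow> 0"
    and dense: "closure (end_points L) = L"
    using assms unfolding lelek_fan_def smooth_fan_def by blast
  interpret A: pointed_smooth_fan L v
    by unfold_locales (use v in auto)
  obtain h where h: "continuous_on L h" "h v = 0" "\<forall>x\<in>L. \<forall>y\<in>arc_in L v x. h y \<le> h x \<and> (h y = (h x :: real) \<longrightarrow> y = x)"
    using A.exists_height by blast
  interpret B: measured_smooth_fan L v h
    by unfold_locales (use h in auto)
  obtain P where P: "\<forall>k. B.leg_clopen (P k)"
    "\<forall>x\<in>L - {v}. \<forall>y\<in>L - {v}. x \<notin> arc_in L v y \<and> y \<notin> arc_in L v x \<longrightarrow> (\<exists>k::nat. x \<in> P k \<and> y \<notin> P k)"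
    using B.separating_leg_clopens by blast
  interpret D: coded_smooth_fan L v h P
    by unfold_locales (use P in auto)
  show ?thesis
    using D.lelek_function_length[OF dense] D.fan_chart_point by blast
qed

section \<open>Transport to an arbitrary Lelek fan\<close>

lemma fan_chart_transfer:
  assumes q: "fan_chart L C \<phi> q" and LC: "lelek_function C \<phi>" and LD: "lelek_function D \<psi>"
  shows "\<exists>q'. fan_chart L D \<psi> q'"
proof -
  obtain H \<alpha> where H: "continuous_on D H" "bij_betw H D C" and \<alpha>: "continuous_on D \<alpha>"
    "\<And>d. d \<in> D \<Longrightarrow> 0 < \<alpha> d" "\<And>d. d \<in> D \<Longrightarrow> \<phi> (H d) = \<alpha> d * \<psi> d"
    using lelek_functions_equivalent[OF LD LC] by metis
  define \<Phi> where "\<Phi> = (\<lambda>p. (H (fst p), \<alpha> (fst p) * snd p))"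
  have HC: "H d \<in> C" if "d \<in> D" for d using H(2) that bij_betwE by blast
  have zero: "snd (\<Phi> p) = 0 \<longleftrightarrow> snd p = 0" if "p \<in> hypograph D \<psi>" for p
    using \<alpha>(2)[of "fst p"] that by (auto simp: \<Phi>_def hypograph_def)
  have into: "\<Phi> p \<in> hypograph C \<phi>" if p: "p \<in> hypograph D \<psi>" for p
  proof -
    have d: "fst p \<in> D" "0 \<le> snd p" "snd p \<le> \<psi> (fst p)" using p by (auto simp: hypograph_def)
    then have "\<alpha> (fst p) * snd p \<le> \<phi> (H (fst p))" "0 \<le> \<alpha> (fst p) * snd p"
      using \<alpha>(2,3)[OF d(1)] by simp_all
    then show ?thesis using HC[OF d(1)] by (simp add: \<Phi>_def)
  qed
  have onto: "\<exists>p\<in>hypograph D \<psi>. \<Phi> p = p'" if p': "p' \<in> hypograph C \<phi>" for p'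
  proof -
    have c: "fst p' \<in> C" "0 \<le> snd p'" "snd p' \<le> \<phi> (fst p')" using p' by (auto simp: hypograph_def)
    have "fst p' \<in> H ` D" using c(1) bij_betw_imp_surj_on[OF H(2)] by simp
    then obtain d where d: "d \<in> D" "H d = fst p'" by auto
    have "snd p' / \<alpha> d \<le> \<psi> d" "0 \<le> snd p' / \<alpha> d"
      using c \<alpha>(2,3)[OF d(1)] d(2) by (simp_all add: pos_divide_le_eq mult.commute)
    then have "(d, snd p' / \<alpha> d) \<in> hypograph D \<psi>" using d(1) by simp
    moreover have "\<Phi> (d, snd p' / \<alpha> d) = p'" using d \<alpha>(2)[OF d(1)] by (simp add: \<Phi>_def)
    ultimately show ?thesis by blast
  qed
  have inj: "p = p'" if "p \<in> hypograph D \<psi>" "p' \<in> hypograph D \<psi>" "\<Phi> p = \<Phi> p'" for p p'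
  proof -
    have d: "fst p \<in> D" "fst p' \<in> D" using that by (auto simp: hypograph_def)
    have "H (fst p) = H (fst p')" using that(3) by (simp add: \<Phi>_def)
    then have "fst p = fst p'" by (rule inj_onD[OF bij_betw_imp_inj_on[OF H(2)] _ d])
    moreover have "snd p = snd p'" using that(3) calculation \<alpha>(2)[OF d(1)] by (simp add: \<Phi>_def)
    ultimately show ?thesis by (simp add: prod_eq_iff)
  qed
  have "continuous_on (hypograph D \<psi>) \<Phi>"
    unfolding \<Phi>_def
    by (intro continuous_intros continuous_on_compose2[OF H(1)] continuous_on_compose2[OF \<alpha>(1)])
      (auto simp: hypograph_def)
  moreover have "continuous_on (hypograph C \<phi>) q" using q by (simp add: fan_chart_def)
  ultimately have "continuous_on (hypograph D \<psi>) (\<lambda>p. q (\<Phi> p))"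
    using into by (intro continuous_on_compose2[of _ q _ \<Phi>]) auto
  moreover have "(\<lambda>p. q (\<Phi> p)) ` hypograph D \<psi> = L"
  proof -
    have "\<Phi> ` hypograph D \<psi> = hypograph C \<phi>" using into onto by blast
    then show ?thesis using q by (metis fan_chart_def image_image)
  qed
  moreover have "q (\<Phi> p) = q (\<Phi> p') \<longleftrightarrow> p = p' \<or> snd p = 0 \<and> snd p' = 0"
    if p: "p \<in> hypograph D \<psi>" "p' \<in> hypograph D \<psi>" for p p'
  proof -
    have "q (\<Phi> p) = q (\<Phi> p') \<longleftrightarrow> \<Phi> p = \<Phi> p' \<or> snd (\<Phi> p) = 0 \<and> snd (\<Phi> p') = 0"
      using q into[OF p(1)] into[OF p(2)] by (simp add: fan_chart_def)
    then show ?thesis using inj[OF p] zero[OF p(1)] zero[OF p(2)] by blast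
  qed
  ultimately show ?thesis unfolding fan_chart_def by blast
qed

text \<open>
  The continuous map descends because the zero level is the only set on which \<open>q\<close> fails to be injective.
  Its continuity is that of a factor of a map on a compact space.
\<close>

lemma fan_chart_push:
  assumes q: "fan_chart L C \<phi> q" and comp: "compact (hypograph C \<phi>)"
    and F: "continuous_on (hypograph C \<phi>) F" "\<And>p. p \<in> hypograph C \<phi> \<Longrightarrow> F p \<in> hypograph C \<phi>"
    and zero: "\<And>p. p \<in> hypograph C \<phi> \<Longrightarrow> snd p = 0 \<Longrightarrow> snd (F p) = 0"
  shows "\<exists>f. continuous_on L f \<and> f ` L \<subseteq> L \<and> (\<forall>p\<in>hypograph C \<phi>. f (q p) = q (F p))"
proof -
  let ?H = "hypograph C \<phi>"
  have qc: "continuous_on ?H q" and qL: "q ` ?H = L"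
    and qq: "\<And>p p'. p \<in> ?H \<Longrightarrow> p' \<in> ?H \<Longrightarrow> q p = q p' \<longleftrightarrow> p = p' \<or> snd p = 0 \<and> snd p' = 0"
    using q by (simp_all add: fan_chart_def)
  have "\<forall>x\<in>L. \<exists>p. p \<in> ?H \<and> q p = x" using qL by blast
  from bchoice[OF this] obtain s where s: "\<forall>x\<in>L. s x \<in> ?H \<and> q (s x) = x" by (elim exE)
  define f where "f = (\<lambda>x. q (F (s x)))"
  have fq: "f (q p) = q (F p)" if p: "p \<in> ?H" for p
  proof -
    have sq: "s (q p) \<in> ?H" "q (s (q p)) = q p" using s p qL by blast+
    then have "s (q p) = p \<or> snd (s (q p)) = 0 \<and> snd p = 0" using qq[OF sq(1) p] by simp
    then show ?thesis
    proof
      assume "snd (s (q p)) = 0 \<and> snd p = 0"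
      then have "snd (F (s (q p))) = 0 \<and> snd (F p) = 0" using zero sq(1) p by simp
      then show ?thesis unfolding f_def using qq[OF F(2)[OF sq(1)] F(2)[OF p]] by simp
    qed (simp add: f_def)
  qed
  have fL: "f x \<in> L" if "x \<in> L" for x using s F(2) qL that unfolding f_def by blast
  have "compact L" using compact_continuous_image[OF qc comp] qL by simp
  then have "continuous_on L f"
  proof (rule continuous_on_compact_closed_graph)
    show "f x \<in> L" if "x \<in> L" for x using fL that .
    fix u x y assume u: "\<And>n::nat. u n \<in> L" "x \<in> L" "u \<longlonglongrightarrow> x" "(\<lambda>n. f (u n)) \<longlonglongrightarrow> y"
    have su: "s (u n) \<in> ?H" "q (s (u n)) = u n" for n using s u(1) by blast+
    then have "\<forall>n. s (u n) \<in> ?H" by blast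
    from seq_compactE[OF compact_imp_seq_compact[OF comp] this]
    obtain p r where p: "p \<in> ?H" "strict_mono r" "((\<lambda>n. s (u n)) \<circ> r) \<longlonglongrightarrow> p" by metis
    have pr: "(\<lambda>n. s (u (r n))) \<longlonglongrightarrow> p" using p(3) by (simp add: o_def)
    have "(\<lambda>n. q (s (u (r n)))) \<longlonglongrightarrow> q p"
      using continuous_on_tendsto_compose[OF qc pr p(1)] su(1) by simp
    moreover have "(\<lambda>n. q (s (u (r n)))) \<longlonglongrightarrow> x"
      using LIMSEQ_subseq_LIMSEQ[OF u(3) p(2)] su(2) by (simp add: o_def)
    ultimately have x: "x = q p" using LIMSEQ_unique by blast
    have "(\<lambda>n. F (s (u (r n)))) \<longlonglongrightarrow> F p"
      using continuous_on_tendsto_compose[OF F(1) pr p(1)] su(1) by simp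
    then have "(\<lambda>n. q (F (s (u (r n))))) \<longlonglongrightarrow> q (F p)"
      by (rule continuous_on_tendsto_compose[OF qc _ F(2)[OF p(1)]]) (use su(1) F(2) in simp)
    moreover have "(\<lambda>n. q (F (s (u (r n))))) \<longlonglongrightarrow> y"
      using LIMSEQ_subseq_LIMSEQ[OF u(4) p(2)] by (simp add: o_def f_def)
    ultimately show "y = f x" using x fq[OF p(1)] LIMSEQ_unique by metis
  qed
  then show ?thesis using fL fq by blast
qed

lemma mixing_push:
  assumes Z: "Z \<subseteq> {..<0}" "\<And>i. i \<notin> Z \<Longrightarrow> i + 1 \<notin> Z"
    and q: "fan_chart L (codes Z) roof q"
    and f: "continuous_on L f" "f ` L \<subseteq> L" "\<forall>p\<in>hypograph (codes Z) roof. f (q p) = q (step_map Z p)"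
  shows "mixing L f"
proof -
  let ?H = "hypograph (codes Z) roof"
  have qc: "continuous_on ?H q" and qL: "q ` ?H = L" using q by (simp_all add: fan_chart_def)
  have FH: "step_map Z p \<in> ?H" if "p \<in> ?H" for p using step_map_in_hypograph[OF Z(1) that] .
  have cL: "compact L" using compact_continuous_image[OF qc compact_hypograph_codes] qL by simp
  have "(\<lambda>i. sqrt 2, 0) \<in> ?H" using roof_nonneg by (simp add: codes_def steps_def)
  then have neL: "L \<noteq> {}" using qL by blast
  have it: "(f ^^ n) (q p) = q ((step_map Z ^^ n) p) \<and> (step_map Z ^^ n) p \<in> ?H" if "p \<in> ?H" for n p
    using that f(3) FH by (induction n) auto
  have "\<exists>n0. \<forall>n. 0 < n \<and> n0 \<le> n \<longrightarrow> (f ^^ n) ` U \<inter> V \<noteq> {}"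
    if U: "openin (top_of_set L) U" "U \<noteq> {}" and V: "openin (top_of_set L) V" "V \<noteq> {}" for U V
  proof -
    have pre: "openin (top_of_set ?H) (?H \<inter> q -` W)" "?H \<inter> q -` W \<noteq> {}" if W: "openin (top_of_set L) W" "W \<noteq> {}" for W
    proof -
      show "openin (top_of_set ?H) (?H \<inter> q -` W)"
        using qL by (intro continuous_openin_preimage[OF qc _ W(1)]) auto
      obtain y where y: "y \<in> W" using W(2) by blast
      then have "y \<in> L" using openin_imp_subset[OF W(1)] by blast
      then show "?H \<inter> q -` W \<noteq> {}" using qL y by blast
    qed
    obtain n0 where n0: "\<forall>n\<ge>n0. (step_map Z ^^ n) ` (?H \<inter> q -` U) \<inter> (?H \<inter> q -` V) \<noteq> {}"
      using step_map_mixing[OF Z refl pre[OF U] pre[OF V]] by blast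
    have "(f ^^ n) ` U \<inter> V \<noteq> {}" if n: "n0 \<le> n" for n
    proof -
      obtain p where p: "p \<in> ?H" "q p \<in> U" "q ((step_map Z ^^ n) p) \<in> V" using n0 n by blast
      then have "(f ^^ n) (q p) \<in> V" using it by simp
      then show ?thesis using p(2) by blast
    qed
    then show ?thesis by blast
  qed
  then show ?thesis using cL neL f(1,2) unfolding mixing_def dynamical_system_def by blast
qed

definition step_back :: "(int \<Rightarrow> real) \<times> real \<Rightarrow> (int \<Rightarrow> real) \<times> real" where
  "step_back p = (\<lambda>i. fst p (i + (-1)), snd p * exp (- fst p (-1)))"

lemma step_back_step_map: "step_back (step_map {} p) = p"
  by (simp add: step_map_def step_back_def reset_def prod_eq_iff exp_minus)

lemma step_map_step_back: "step_map {} (step_back p) = p"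
  by (simp add: step_map_def step_back_def reset_def prod_eq_iff fun_eq_iff exp_minus)

lemma step_back_in_hypograph:
  assumes "p \<in> hypograph (codes {}) roof"
  shows "step_back p \<in> hypograph (codes {}) roof"
proof -
  obtain c t where ct: "p = (c, t)" "c \<in> codes {}" "0 \<le> t" "t \<le> roof c"
    using assms by (cases p) auto
  have "t * exp (- c (-1)) \<le> exp (- height (\<lambda>i. c (i + (-1))) i)" for i
  proof -
    have h1: "height c (-1) = - c (-1)" using height_step[of c "-1"] by simp
    have "t * exp (- c (-1)) \<le> exp (- height c (i + (-1))) * exp (- c (-1))"
      using ct(4) le_roof_iff by (intro mult_right_mono) auto
    also have "\<dots> = exp (- height (\<lambda>i. c (i + (-1))) i)"
      using height_shift[of c "-1" i] h1 by (simp add: exp_add[symmetric])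
    finally show ?thesis .
  qed
  moreover have "(\<lambda>i. c (i + (-1))) \<in> codes {}" using ct(2) by (simp add: codes_def)
  ultimately show ?thesis using ct by (simp add: step_back_def le_roof_iff)
qed

lemma continuous_on_step_back: "continuous_on A step_back"
  unfolding step_back_def
proof (intro continuous_intros)
  have coord: "continuous_on A (\<lambda>p::(int \<Rightarrow> real) \<times> real. fst p i)" for i
    by (rule continuous_on_compose2[OF continuous_on_product_coordinates[of i]]) (auto intro: continuous_intros)
  show "continuous_on A (\<lambda>p::(int \<Rightarrow> real) \<times> real. fst p (i + (-1)))" for i by (rule coord)
  show "continuous_on A (\<lambda>p::(int \<Rightarrow> real) \<times> real. fst p (-1))" by (rule coord)
qed

text \<open>
  Two codes that differ only at time \<open>0\<close>, with steps \<open>-1\<close> and \<open>0\<close> there. The initial values \<open>1\<close> and \<open>exp (-1)\<close> are chosen so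
  that the values at time \<open>1\<close> agree.
\<close>

lemma step_map_not_injective:
  obtains p p' where "p \<in> hypograph (codes {..<0}) roof" "p' \<in> hypograph (codes {..<0}) roof"
    "snd p \<noteq> 0" "p \<noteq> p'" "step_map {..<0} p = step_map {..<0} p'"
proof -
  have in_codes: "glue 0 u \<in> codes {..<0}" if "set u \<subseteq> steps" for u
  proof -
    have "glue 0 u i \<in> steps" for i
    proof (cases "0 \<le> i \<and> i < int (length u)")
      case True
      then have "u ! nat i \<in> steps" using that nth_mem[of "nat i" u] by auto
      then show ?thesis using True by (simp add: glue_def)
    qed (auto simp: glue_def steps_def)
    then show ?thesis by (simp add: codes_def glue_def)
  qed
  have low: "height (glue 0 u) i \<le> 0" if "\<And>k. k \<le> length u \<Longrightarrow> sum_list (take k u) \<le> 0" for u i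
    by (rule heights_glue_nonpos[OF height_step]) (use that in simp)
  have p1: "(glue 0 [], 1) \<in> hypograph (codes {..<0}) roof"
    using in_codes[of "[]"] low[of "[]"] by (simp add: le_roof_iff)
  have "height (glue 0 [0]) i \<le> 0" for i
  proof (rule low)
    show "sum_list (take k [0::real]) \<le> 0" for k by (cases k) auto
  qed
  then have "exp (-1) \<le> roof (glue 0 [0])"
    unfolding le_roof_iff by (auto intro: order_trans[of _ 0])
  then have p2: "(glue 0 [0], exp (-1)) \<in> hypograph (codes {..<0}) roof"
    using in_codes[of "[0]"] by (simp add: steps_def)
  have "reset {..<0} (\<lambda>i. glue 0 [] (i + 1)) = reset {..<0} (\<lambda>i. glue 0 [0] (i + 1))"
    by (auto simp: reset_def glue_def fun_eq_iff)
  moreover have "glue 0 [] 0 = -1" "glue 0 [0] 0 = 0" by (simp_all add: glue_def)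
  ultimately have "step_map {..<0} (glue 0 [], 1) = step_map {..<0} (glue 0 [0], exp (-1))"
    by (simp add: step_map_def)
  then show ?thesis using that[OF p1 p2] by simp
qed

text \<open>
  Both maps are images of the step map, for one-sided and for two-sided sequences respectively.
\<close>

theorem theorem4p7:
  fixes L :: "'a::metric_space set"
  assumes "lelek_fan L"
  shows "(\<exists>f. continuous_on L f \<and> f ` L \<subseteq> L \<and> \<not> (\<exists>g. homeomorphism L L f g) \<and> mixing L f) \<and>
         (\<exists>h. (\<exists>g. homeomorphism L L h g) \<and> mixing L h)"
proof
  obtain C :: "(nat \<Rightarrow> real) set" and \<phi> q0 where C: "lelek_function C \<phi>" "fan_chart L C \<phi> q0"
    using lelek_fan_chart[OF assms] by blast
  have chart: "\<exists>q. fan_chart L (codes Z) roof q" if "Z \<subseteq> {..<0}" for Z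
    using fan_chart_transfer[OF C(2,1) lelek_function_codes[OF that]] .
  have push: "\<exists>f. continuous_on L f \<and> f ` L \<subseteq> L \<and> (\<forall>p\<in>hypograph (codes Z) roof. f (q p) = q (step_map Z p))"
    if "Z \<subseteq> {..<0}" "fan_chart L (codes Z) roof q" for Z q
    using fan_chart_push[OF that(2) compact_hypograph_codes continuous_on_step_map step_map_in_hypograph[OF that(1)]]
    by (simp add: step_map_def)
  show "\<exists>f. continuous_on L f \<and> f ` L \<subseteq> L \<and> \<not> (\<exists>g. homeomorphism L L f g) \<and> mixing L f"
  proof -
    let ?Z = "{..<0::int}"
    obtain q where q: "fan_chart L (codes ?Z) roof q" using chart by blast
    obtain f where f: "continuous_on L f" "f ` L \<subseteq> L"
      "\<forall>p\<in>hypograph (codes ?Z) roof. f (q p) = q (step_map ?Z p)"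
      using push[OF order_refl q] by blast
    have "mixing L f" by (rule mixing_push[OF _ _ q f]) auto
    moreover have "\<not> (\<exists>g. homeomorphism L L f g)"
    proof
      assume "\<exists>g. homeomorphism L L f g"
      then obtain g where g: "homeomorphism L L f g" by blast
      obtain p p' where p: "p \<in> hypograph (codes ?Z) roof" "p' \<in> hypograph (codes ?Z) roof"
        "snd p \<noteq> 0" "p \<noteq> p'" "step_map ?Z p = step_map ?Z p'"
        by (rule step_map_not_injective)
      have "q p \<in> L" "q p' \<in> L" using q p(1,2) by (auto simp: fan_chart_def)
      moreover have "f (q p) = f (q p')" using f(3) p by simp
      ultimately have "q p = q p'" using g unfolding homeomorphism_def by metis
      then show False using q p(1-4) by (simp add: fan_chart_def)
    qed
    ultimately show ?thesis using f(1,2) by blast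
  qed
  show "\<exists>h. (\<exists>g. homeomorphism L L h g) \<and> mixing L h"
  proof -
    let ?H = "hypograph (codes {}) roof"
    obtain q where q: "fan_chart L (codes {}) roof q" using chart by blast
    have qL: "q ` ?H = L" using q by (simp add: fan_chart_def)
    obtain f where f: "continuous_on L f" "f ` L \<subseteq> L" "\<forall>p\<in>?H. f (q p) = q (step_map {} p)"
      using push[OF empty_subsetI q] by blast
    obtain g where g: "continuous_on L g" "g ` L \<subseteq> L" "\<forall>p\<in>?H. g (q p) = q (step_back p)"
      using fan_chart_push[OF q compact_hypograph_codes continuous_on_step_back step_back_in_hypograph]
      by (auto simp: step_back_def)
    have gf: "g (f x) = x" if x: "x \<in> L" for x
    proof -
      obtain p where p: "p \<in> ?H" "x = q p" using qL x by blast
      have "step_map {} p \<in> ?H" using step_map_in_hypograph[OF empty_subsetI p(1)] .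
      then show ?thesis using p f(3) g(3) by (simp add: step_back_step_map)
    qed
    have fg: "f (g x) = x" if x: "x \<in> L" for x
    proof -
      obtain p where p: "p \<in> ?H" "x = q p" using qL x by blast
      have "step_back p \<in> ?H" using step_back_in_hypograph[OF p(1)] .
      then show ?thesis using p f(3) g(3) by (simp add: step_map_step_back)
    qed
    have "L \<subseteq> f ` L"
    proof
      fix x assume "x \<in> L"
      then have "x = f (g x)" "g x \<in> L" using fg g(2) by auto
      then show "x \<in> f ` L" by (rule image_eqI)
    qed
    moreover have "L \<subseteq> g ` L"
    proof
      fix x assume "x \<in> L"
      then have "x = g (f x)" "f x \<in> L" using gf f(2) by auto
      then show "x \<in> g ` L" by (rule image_eqI)
    qed
    ultimately have "homeomorphism L L f g"
      using f(1,2) g(1,2) gf fg unfolding homeomorphism_def by (intro conjI ballI subset_antisym) auto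
    moreover have "mixing L f" by (rule mixing_push[OF empty_subsetI _ q f]) simp
    ultimately show ?thesis by blast
  qed
qed

end
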